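(* $\mathrm{CT}$ is solid.
   Context: $\mathcal{L}_{\mathrm{A}}=\{+,\cdot,\mathrm{S},<,0\}$. $\mathrm{CT}$ is the theory in $\mathcal{L}_{\mathrm{A}}\cup\{T\}$ consisting of $\mathrm{PA}$ with induction for all $\mathcal{L}_{\mathrm{A}}\cup\{T\}$-formulae, plus a single sentence stating that $T$ satisfies Tarski's inductive clauses for a truth predicate for all (codes of) arithmetical sentences in the model. For structures, $\mathcal{M}\trianglerighteq\mathcal{N}$ means the universe of $\mathcal{N}$ and interpretations of all its symbols are definable (with parameters) in $\mathcal{M}$. A theory $U$ is solid if for all models $\mathcal{M},\mathcal{M}^*,\mathcal{N}$ of $U$ with $\mathcal{M}\trianglerighteq\mathcal{N}\trianglerighteq\mathcal{M}^*$ and an $\mathcal{M}$-definable isomorphism $\mathcal{M}\to\mathcal{M}^*$, there is an $\mathcal{M}$-definable isomorphism $\mathcal{M}\to\mathcal{N}$. *)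

theory Defs
  imports Main
begin

section \<open>First-order logic over the language of arithmetic with a truth predicate\<close>

text \<open>Bound variables are de Bruijn indices.  The arithmetical formulae are those without
  \<open>Tr\<close>; the remaining connectives are abbreviations.\<close>

datatype tm =
    Var nat
  | Zero
  | Succ tm
  | Add tm tm (infixl "\<^bold>+" 85)
  | Mul tm tm (infixl "\<^bold>*" 90)

datatype fm =
    Eq tm tm (infix "\<^bold>=" 75)
  | Less tm tm (infix "\<^bold><" 75)
  | Tr tm
  | Neg fm ("\<^bold>\<not> _" [70] 70)
  | Or fm fm (infixr "\<^bold>\<or>" 60)
  | Ex fm

abbreviation And :: "fm \<Rightarrow> fm \<Rightarrow> fm" (infixr "\<^bold>\<and>" 65) where
  "\<phi> \<^bold>\<and> \<psi> \<equiv> \<^bold>\<not> (\<^bold>\<not> \<phi> \<^bold>\<or> \<^bold>\<not> \<psi>)"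

abbreviation Imp :: "fm \<Rightarrow> fm \<Rightarrow> fm" (infixr "\<^bold>\<rightarrow>" 55) where
  "\<phi> \<^bold>\<rightarrow> \<psi> \<equiv> \<^bold>\<not> \<phi> \<^bold>\<or> \<psi>"

abbreviation Iff :: "fm \<Rightarrow> fm \<Rightarrow> fm" (infix "\<^bold>\<leftrightarrow>" 52) where
  "\<phi> \<^bold>\<leftrightarrow> \<psi> \<equiv> (\<phi> \<^bold>\<rightarrow> \<psi>) \<^bold>\<and> (\<psi> \<^bold>\<rightarrow> \<phi>)"

abbreviation All :: "fm \<Rightarrow> fm" where
  "All \<phi> \<equiv> \<^bold>\<not> Ex (\<^bold>\<not> \<phi>)"

primrec subst_tm :: "(nat \<Rightarrow> tm) \<Rightarrow> tm \<Rightarrow> tm" where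
  "subst_tm \<sigma> (Var i) = \<sigma> i"
| "subst_tm \<sigma> Zero = Zero"
| "subst_tm \<sigma> (Succ t) = Succ (subst_tm \<sigma> t)"
| "subst_tm \<sigma> (s \<^bold>+ t) = subst_tm \<sigma> s \<^bold>+ subst_tm \<sigma> t"
| "subst_tm \<sigma> (s \<^bold>* t) = subst_tm \<sigma> s \<^bold>* subst_tm \<sigma> t"

text \<open>\<open>sh n t\<close> is \<open>t\<close> as it must be written under \<open>n\<close> additional quantifiers.\<close>

definition sh :: "nat \<Rightarrow> tm \<Rightarrow> tm" where
  "sh n = subst_tm (\<lambda>i. Var (i + n))"

primrec subst_fm :: "(nat \<Rightarrow> tm) \<Rightarrow> fm \<Rightarrow> fm" where
  "subst_fm \<sigma> (s \<^bold>= t) = (subst_tm \<sigma> s \<^bold>= subst_tm \<sigma> t)"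
| "subst_fm \<sigma> (s \<^bold>< t) = (subst_tm \<sigma> s \<^bold>< subst_tm \<sigma> t)"
| "subst_fm \<sigma> (Tr t) = Tr (subst_tm \<sigma> t)"
| "subst_fm \<sigma> (\<^bold>\<not> \<phi>) = \<^bold>\<not> subst_fm \<sigma> \<phi>"
| "subst_fm \<sigma> (\<phi> \<^bold>\<or> \<psi>) = (subst_fm \<sigma> \<phi> \<^bold>\<or> subst_fm \<sigma> \<psi>)"
| "subst_fm \<sigma> (Ex \<phi>) = Ex (subst_fm (case_nat (Var 0) (\<lambda>i. sh 1 (\<sigma> i))) \<phi>)"

record 'a struct =
  univ :: "'a set"
  zero :: 'a
  succ :: "'a \<Rightarrow> 'a"
  add :: "'a \<Rightarrow> 'a \<Rightarrow> 'a"
  mul :: "'a \<Rightarrow> 'a \<Rightarrow> 'a"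
  less :: "'a \<Rightarrow> 'a \<Rightarrow> bool"
  truth :: "'a \<Rightarrow> bool"

text \<open>The values of the operations and relations outside the universe are irrelevant.\<close>

definition is_struct :: "'a struct \<Rightarrow> bool" where
  "is_struct M \<longleftrightarrow> zero M \<in> univ M \<and> (\<forall>x\<in>univ M. succ M x \<in> univ M) \<and>
     (\<forall>x\<in>univ M. \<forall>y\<in>univ M. add M x y \<in> univ M \<and> mul M x y \<in> univ M)"

primrec eval :: "'a struct \<Rightarrow> (nat \<Rightarrow> 'a) \<Rightarrow> tm \<Rightarrow> 'a" where
  "eval M e (Var i) = e i"
| "eval M e Zero = zero M"
| "eval M e (Succ t) = succ M (eval M e t)"
| "eval M e (s \<^bold>+ t) = add M (eval M e s) (eval M e t)"
| "eval M e (s \<^bold>* t) = mul M (eval M e s) (eval M e t)"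

primrec sat :: "'a struct \<Rightarrow> (nat \<Rightarrow> 'a) \<Rightarrow> fm \<Rightarrow> bool" where
  "sat M e (s \<^bold>= t) \<longleftrightarrow> eval M e s = eval M e t"
| "sat M e (s \<^bold>< t) \<longleftrightarrow> less M (eval M e s) (eval M e t)"
| "sat M e (Tr t) \<longleftrightarrow> truth M (eval M e t)"
| "sat M e (\<^bold>\<not> \<phi>) \<longleftrightarrow> \<not> sat M e \<phi>"
| "sat M e (\<phi> \<^bold>\<or> \<psi>) \<longleftrightarrow> sat M e \<phi> \<or> sat M e \<psi>"
| "sat M e (Ex \<phi>) \<longleftrightarrow> (\<exists>x\<in>univ M. sat M (case_nat x e) \<phi>)"

text \<open>Free variables of axioms are read as universally quantified.\<close>

definition is_model :: "'a struct \<Rightarrow> fm set \<Rightarrow> bool" where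
  "is_model M U \<longleftrightarrow> is_struct M \<and> (\<forall>\<phi>\<in>U. \<forall>e. range e \<subseteq> univ M \<longrightarrow> sat M e \<phi>)"


section \<open>Definability and solidity\<close>

text \<open>A set of tuples (lists of a common length \<open>n\<close>) of elements of \<open>M\<close> is definable if some
  formula, whose variables from \<open>n\<close> on are assigned parameters by \<open>e\<close>, defines it.\<close>

definition definable :: "'a struct \<Rightarrow> 'a list set \<Rightarrow> bool" where
  "definable M R \<longleftrightarrow> (\<exists>n \<phi> e. range e \<subseteq> univ M \<and>
     R = {xs. length xs = n \<and> set xs \<subseteq> univ M \<and> sat M (foldr case_nat xs e) \<phi>})"

text \<open>The universe of the interpreted structure is a definable set of tuples of some length
  \<open>k\<close>, so an \<open>n\<close>-ary relation on it is a set of \<open>n * k\<close>-tuples of elements of \<open>M\<close>.\<close>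

definition interprets :: "'a struct \<Rightarrow> 'a list struct \<Rightarrow> bool" (infix "\<unrhd>" 50) where
  "M \<unrhd> N \<longleftrightarrow>
     definable M (univ N) \<and>
     definable M {zero N} \<and>
     definable M {x @ succ N x |x. x \<in> univ N} \<and>
     definable M {x @ y @ add N x y |x y. x \<in> univ N \<and> y \<in> univ N} \<and>
     definable M {x @ y @ mul N x y |x y. x \<in> univ N \<and> y \<in> univ N} \<and>
     definable M {x @ y |x y. x \<in> univ N \<and> y \<in> univ N \<and> less N x y} \<and>
     definable M {x. x \<in> univ N \<and> truth N x}"

definition is_iso :: "'a struct \<Rightarrow> 'b struct \<Rightarrow> ('a \<Rightarrow> 'b) \<Rightarrow> bool" where
  "is_iso M N f \<longleftrightarrow>
     bij_betw f (univ M) (univ N) \<and>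
     f (zero M) = zero N \<and>
     (\<forall>x\<in>univ M. f (succ M x) = succ N (f x) \<and> (truth M x \<longleftrightarrow> truth N (f x))) \<and>
     (\<forall>x\<in>univ M. \<forall>y\<in>univ M. f (add M x y) = add N (f x) (f y) \<and>
        f (mul M x y) = mul N (f x) (f y) \<and> (less M x y \<longleftrightarrow> less N (f x) (f y)))"

text \<open>If \<open>M \<unrhd> N \<unrhd> M'\<close>, the elements of \<open>N\<close> are tuples of elements of \<open>M\<close> and those of \<open>M'\<close> are
  tuples of such tuples; \<open>concat\<close> turns the latter into tuples of elements of \<open>M\<close>.  No
  generality is lost by these element types.  The type argument stands for the type of elements
  of \<open>M\<close>, over which a definition in HOL cannot quantify: \<open>U\<close> is solid if
  \<open>solid TYPE('a) U\<close> holds for every \<open>'a\<close>.\<close>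

definition solid :: "'a itself \<Rightarrow> fm set \<Rightarrow> bool" where
  "solid _ U \<longleftrightarrow>
     (\<forall>(M :: 'a struct) (N :: 'a list struct) (M' :: 'a list list struct) f.
        is_model M U \<and> is_model N U \<and> is_model M' U \<and>
        M \<unrhd> N \<and> N \<unrhd> M' \<and>
        is_iso M M' f \<and> definable M {x # concat (f x) |x. x \<in> univ M} \<longrightarrow>
        (\<exists>g. is_iso M N g \<and> definable M {x # g x |x. x \<in> univ M}))"


section \<open>Peano arithmetic with full induction\<close>

definition PA_base :: "fm set" where
  "PA_base = {
     \<^bold>\<not> (Succ (Var 0) \<^bold>= Zero),
     Succ (Var 0) \<^bold>= Succ (Var 1) \<^bold>\<rightarrow> Var 0 \<^bold>= Var 1,
     Var 0 \<^bold>+ Zero \<^bold>= Var 0,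
     Var 0 \<^bold>+ Succ (Var 1) \<^bold>= Succ (Var 0 \<^bold>+ Var 1),
     Var 0 \<^bold>* Zero \<^bold>= Zero,
     Var 0 \<^bold>* Succ (Var 1) \<^bold>= Var 0 \<^bold>* Var 1 \<^bold>+ Var 0,
     Var 0 \<^bold>< Var 1 \<^bold>\<leftrightarrow> Ex (Var 1 \<^bold>+ Succ (Var 0) \<^bold>= Var 2)}"

definition induction :: "fm \<Rightarrow> fm" where
  "induction \<phi> =
     (subst_fm (case_nat Zero Var) \<phi> \<^bold>\<and>
      All (\<phi> \<^bold>\<rightarrow> subst_fm (case_nat (Succ (Var 0)) (\<lambda>i. Var (Suc i))) \<phi>)
      \<^bold>\<rightarrow> All \<phi>)"


section \<open>Arithmetized syntax\<close>

text \<open>\<open>pairF x y z\<close>: \<open>z\<close> is the Cantor pair \<open>(x, y)\<close>, i.e. \<open>2z = (x + y)(x + y + 1) + 2x\<close>.\<close>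

definition pairF :: "tm \<Rightarrow> tm \<Rightarrow> tm \<Rightarrow> fm" where
  "pairF x y z = (z \<^bold>+ z \<^bold>= (x \<^bold>+ y) \<^bold>* Succ (x \<^bold>+ y) \<^bold>+ (x \<^bold>+ x))"

text \<open>Goedel's beta function: \<open>y = a mod (1 + (i + 1) b)\<close>, where \<open>c\<close> is the pair \<open>(a, b)\<close>.\<close>

definition betaF :: "tm \<Rightarrow> tm \<Rightarrow> tm \<Rightarrow> fm" where
  "betaF c i y =
     (let m = Succ (Succ (sh 3 i) \<^bold>* Var 1)
      in Ex (Ex (Ex (pairF (Var 2) (Var 1) (sh 3 c) \<^bold>\<and>
           Var 2 \<^bold>= Var 0 \<^bold>* m \<^bold>+ sh 3 y \<^bold>\<and> sh 3 y \<^bold>< m))))"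

text \<open>\<open>w\<close>, or the pair \<open>(u, v)\<close>, or the triple \<open>(u, (v, w))\<close>, is an entry of the sequence \<open>c\<close>
  before position \<open>j\<close>.\<close>

definition earlierF :: "tm \<Rightarrow> tm \<Rightarrow> tm \<Rightarrow> fm" where
  "earlierF c j w = Ex (Var 0 \<^bold>< sh 1 j \<^bold>\<and> betaF (sh 1 c) (Var 0) (sh 1 w))"

definition earlier2F :: "tm \<Rightarrow> tm \<Rightarrow> tm \<Rightarrow> tm \<Rightarrow> fm" where
  "earlier2F c j u v = Ex (pairF (sh 1 u) (sh 1 v) (Var 0) \<^bold>\<and> earlierF (sh 1 c) (sh 1 j) (Var 0))"

definition earlier3F :: "tm \<Rightarrow> tm \<Rightarrow> tm \<Rightarrow> tm \<Rightarrow> tm \<Rightarrow> fm" where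
  "earlier3F c j u v w =
     Ex (pairF (sh 1 v) (sh 1 w) (Var 0) \<^bold>\<and> earlier2F (sh 1 c) (sh 1 j) (sh 1 u) (Var 0))"

text \<open>Inductive definitions inside the theory: \<open>w\<close> is the last entry of a finite sequence \<open>c\<close>
  each of whose entries \<open>y\<close> (at position \<open>j\<close>) satisfies the rule \<open>K p c j y\<close>, which may refer to
  the entries before \<open>j\<close> and to a parameter \<open>p\<close>.\<close>

definition derivF :: "(tm \<Rightarrow> tm \<Rightarrow> tm \<Rightarrow> tm \<Rightarrow> fm) \<Rightarrow> tm \<Rightarrow> tm \<Rightarrow> fm" where
  "derivF K p w =
     Ex (Ex (betaF (Var 1) (Var 0) (sh 2 w) \<^bold>\<and>
       All (All (Var 1 \<^bold>< Succ (Var 2) \<^bold>\<and> betaF (Var 3) (Var 1) (Var 0)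
         \<^bold>\<rightarrow> K (sh 4 p) (Var 3) (Var 1) (Var 0)))))"

text \<open>
  Codes of arithmetical terms and formulae (pairs are right-nested Cantor pairs):
    \<open>Var i\<close> is \<open>(0, i)\<close>, \<open>Zero\<close> is \<open>(1, 0)\<close>, \<open>Succ t\<close> is \<open>(2, t)\<close>,
    \<open>s \<^bold>+ t\<close> is \<open>(3, s, t)\<close>, \<open>s \<^bold>* t\<close> is \<open>(4, s, t)\<close>,
    \<open>s \<^bold>= t\<close> is \<open>(5, s, t)\<close>, \<open>s \<^bold>< t\<close> is \<open>(6, s, t)\<close>,
    \<open>\<^bold>\<not> \<phi>\<close> is \<open>(7, \<phi>)\<close>, \<open>\<phi> \<^bold>\<or> \<psi>\<close> is \<open>(8, \<phi>, \<psi>)\<close>, \<open>Ex \<phi>\<close> is \<open>(9, \<phi>)\<close>.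
\<close>

definition node1F :: "nat \<Rightarrow> tm \<Rightarrow> tm \<Rightarrow> fm" where
  "node1F k x z = pairF ((Succ ^^ k) Zero) x z"

definition node2F :: "nat \<Rightarrow> tm \<Rightarrow> tm \<Rightarrow> tm \<Rightarrow> fm" where
  "node2F k x y z = Ex (pairF (sh 1 x) (sh 1 y) (Var 0) \<^bold>\<and> node1F k (Var 0) (sh 1 z))"

text \<open>\<open>termF n t\<close>: \<open>t\<close> is a term all of whose variables have index below \<open>n\<close>.\<close>

definition termF :: "tm \<Rightarrow> tm \<Rightarrow> fm" where
  "termF = derivF (\<lambda>n c j t.
      Ex (Var 0 \<^bold>< sh 1 n \<^bold>\<and> node1F 0 (Var 0) (sh 1 t))
    \<^bold>\<or> node1F 1 Zero t
    \<^bold>\<or> Ex (earlierF (sh 1 c) (sh 1 j) (Var 0) \<^bold>\<and> node1F 2 (Var 0) (sh 1 t))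
    \<^bold>\<or> Ex (Ex (earlierF (sh 2 c) (sh 2 j) (Var 1) \<^bold>\<and> earlierF (sh 2 c) (sh 2 j) (Var 0) \<^bold>\<and>
         (node2F 3 (Var 1) (Var 0) (sh 2 t) \<^bold>\<or> node2F 4 (Var 1) (Var 0) (sh 2 t)))))"

text \<open>\<open>formF n \<phi>\<close>: \<open>\<phi>\<close> is an arithmetical formula all of whose free variables have index below
  \<open>n\<close>.  The derivation consists of pairs \<open>(n, \<phi>)\<close>.\<close>

definition form_rule :: "tm \<Rightarrow> tm \<Rightarrow> tm \<Rightarrow> tm \<Rightarrow> fm" where
  "form_rule n c j \<phi> =
     (Ex (Ex (termF (sh 2 n) (Var 1) \<^bold>\<and> termF (sh 2 n) (Var 0) \<^bold>\<and>
        (node2F 5 (Var 1) (Var 0) (sh 2 \<phi>) \<^bold>\<or> node2F 6 (Var 1) (Var 0) (sh 2 \<phi>))))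
    \<^bold>\<or> Ex (earlier2F (sh 1 c) (sh 1 j) (sh 1 n) (Var 0) \<^bold>\<and> node1F 7 (Var 0) (sh 1 \<phi>))
    \<^bold>\<or> Ex (Ex (earlier2F (sh 2 c) (sh 2 j) (sh 2 n) (Var 1) \<^bold>\<and>
         earlier2F (sh 2 c) (sh 2 j) (sh 2 n) (Var 0) \<^bold>\<and> node2F 8 (Var 1) (Var 0) (sh 2 \<phi>)))
    \<^bold>\<or> Ex (earlier2F (sh 1 c) (sh 1 j) (Succ (sh 1 n)) (Var 0) \<^bold>\<and> node1F 9 (Var 0) (sh 1 \<phi>)))"

definition formF :: "tm \<Rightarrow> tm \<Rightarrow> fm" where
  "formF n \<phi> = Ex (pairF (sh 1 n) (sh 1 \<phi>) (Var 0) \<^bold>\<and>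
     derivF (\<lambda>_ c j y. Ex (Ex (pairF (Var 1) (Var 0) (sh 2 y) \<^bold>\<and>
       form_rule (Var 1) (sh 2 c) (sh 2 j) (Var 0)))) Zero (Var 0))"

abbreviation sentF :: "tm \<Rightarrow> fm" where
  "sentF \<phi> \<equiv> formF Zero \<phi>"

abbreviation closed_termF :: "tm \<Rightarrow> fm" where
  "closed_termF t \<equiv> termF Zero t"

text \<open>\<open>valF t x\<close>: the closed term \<open>t\<close> has the value \<open>x\<close>.\<close>

definition val_rule :: "tm \<Rightarrow> tm \<Rightarrow> tm \<Rightarrow> tm \<Rightarrow> fm" where
  "val_rule t c j x =
     (node1F 1 Zero t \<^bold>\<and> x \<^bold>= Zero
    \<^bold>\<or> Ex (Ex (earlier2F (sh 2 c) (sh 2 j) (Var 1) (Var 0) \<^bold>\<and>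
         node1F 2 (Var 1) (sh 2 t) \<^bold>\<and> sh 2 x \<^bold>= Succ (Var 0)))
    \<^bold>\<or> Ex (Ex (Ex (Ex (earlier2F (sh 4 c) (sh 4 j) (Var 3) (Var 2) \<^bold>\<and>
         earlier2F (sh 4 c) (sh 4 j) (Var 1) (Var 0) \<^bold>\<and>
         (node2F 3 (Var 3) (Var 1) (sh 4 t) \<^bold>\<and> sh 4 x \<^bold>= Var 2 \<^bold>+ Var 0
        \<^bold>\<or> node2F 4 (Var 3) (Var 1) (sh 4 t) \<^bold>\<and> sh 4 x \<^bold>= Var 2 \<^bold>* Var 0))))))"

definition valF :: "tm \<Rightarrow> tm \<Rightarrow> fm" where
  "valF t x = Ex (pairF (sh 1 t) (sh 1 x) (Var 0) \<^bold>\<and>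
     derivF (\<lambda>_ c j y. Ex (Ex (pairF (Var 1) (Var 0) (sh 2 y) \<^bold>\<and>
       val_rule (Var 1) (sh 2 c) (sh 2 j) (Var 0)))) Zero (Var 0))"

text \<open>\<open>numeralF x t\<close>: \<open>t\<close> is the numeral of \<open>x\<close>.\<close>

definition numeral_rule :: "tm \<Rightarrow> tm \<Rightarrow> tm \<Rightarrow> tm \<Rightarrow> fm" where
  "numeral_rule x c j t =
     (x \<^bold>= Zero \<^bold>\<and> node1F 1 Zero t
    \<^bold>\<or> Ex (Ex (earlier2F (sh 2 c) (sh 2 j) (Var 1) (Var 0) \<^bold>\<and>
         sh 2 x \<^bold>= Succ (Var 1) \<^bold>\<and> node1F 2 (Var 0) (sh 2 t))))"

definition numeralF :: "tm \<Rightarrow> tm \<Rightarrow> fm" where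
  "numeralF x t = Ex (pairF (sh 1 x) (sh 1 t) (Var 0) \<^bold>\<and>
     derivF (\<lambda>_ c j y. Ex (Ex (pairF (Var 1) (Var 0) (sh 2 y) \<^bold>\<and>
       numeral_rule (Var 1) (sh 2 c) (sh 2 j) (Var 0)))) Zero (Var 0))"

text \<open>\<open>substF r d x x'\<close>: the term or formula \<open>x'\<close> results from \<open>x\<close> by replacing the variable with
  index \<open>d\<close> by the closed term \<open>r\<close> (which needs no shifting under quantifiers).  Indices above
  \<open>d\<close>, which do not occur where this is used, are left alone.\<close>

definition subst_rule :: "tm \<Rightarrow> tm \<Rightarrow> tm \<Rightarrow> tm \<Rightarrow> tm \<Rightarrow> tm \<Rightarrow> fm" where
  "subst_rule r d c j x x' =
     (node1F 0 d x \<^bold>\<and> x' \<^bold>= r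
    \<^bold>\<or> Ex (\<^bold>\<not> (Var 0 \<^bold>= sh 1 d) \<^bold>\<and> node1F 0 (Var 0) (sh 1 x) \<^bold>\<and> sh 1 x' \<^bold>= sh 1 x)
    \<^bold>\<or> node1F 1 Zero x \<^bold>\<and> x' \<^bold>= x
    \<^bold>\<or> Ex (Ex (earlier3F (sh 2 c) (sh 2 j) (sh 2 d) (Var 1) (Var 0) \<^bold>\<and>
         (node1F 2 (Var 1) (sh 2 x) \<^bold>\<and> node1F 2 (Var 0) (sh 2 x')
        \<^bold>\<or> node1F 7 (Var 1) (sh 2 x) \<^bold>\<and> node1F 7 (Var 0) (sh 2 x'))))
    \<^bold>\<or> Ex (Ex (Ex (Ex (earlier3F (sh 4 c) (sh 4 j) (sh 4 d) (Var 3) (Var 2) \<^bold>\<and>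
         earlier3F (sh 4 c) (sh 4 j) (sh 4 d) (Var 1) (Var 0) \<^bold>\<and>
         (node2F 3 (Var 3) (Var 1) (sh 4 x) \<^bold>\<and> node2F 3 (Var 2) (Var 0) (sh 4 x')
        \<^bold>\<or> node2F 4 (Var 3) (Var 1) (sh 4 x) \<^bold>\<and> node2F 4 (Var 2) (Var 0) (sh 4 x')
        \<^bold>\<or> node2F 5 (Var 3) (Var 1) (sh 4 x) \<^bold>\<and> node2F 5 (Var 2) (Var 0) (sh 4 x')
        \<^bold>\<or> node2F 6 (Var 3) (Var 1) (sh 4 x) \<^bold>\<and> node2F 6 (Var 2) (Var 0) (sh 4 x')
        \<^bold>\<or> node2F 8 (Var 3) (Var 1) (sh 4 x) \<^bold>\<and> node2F 8 (Var 2) (Var 0) (sh 4 x'))))))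
    \<^bold>\<or> Ex (Ex (earlier3F (sh 2 c) (sh 2 j) (Succ (sh 2 d)) (Var 1) (Var 0) \<^bold>\<and>
         node1F 9 (Var 1) (sh 2 x) \<^bold>\<and> node1F 9 (Var 0) (sh 2 x'))))"

definition tripleF :: "tm \<Rightarrow> tm \<Rightarrow> tm \<Rightarrow> tm \<Rightarrow> fm" where
  "tripleF x y z w = Ex (pairF (sh 1 y) (sh 1 z) (Var 0) \<^bold>\<and> pairF (sh 1 x) (Var 0) (sh 1 w))"

definition substF :: "tm \<Rightarrow> tm \<Rightarrow> tm \<Rightarrow> tm \<Rightarrow> fm" where
  "substF r d x x' = Ex (tripleF (sh 1 d) (sh 1 x) (sh 1 x') (Var 0) \<^bold>\<and>
     derivF (\<lambda>r c j y. Ex (Ex (Ex (tripleF (Var 2) (Var 1) (Var 0) (sh 3 y) \<^bold>\<and>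
       subst_rule (sh 3 r) (Var 2) (sh 3 c) (sh 3 j) (Var 1) (Var 0))))) (sh 1 r) (Var 0))"


section \<open>The theory CT\<close>

text \<open>Tarski's clauses, including that only codes of arithmetical sentences are true.\<close>

definition Tarski :: fm where
  "Tarski =
     (All (Tr (Var 0) \<^bold>\<rightarrow> sentF (Var 0)) \<^bold>\<and>
      All (All (All (closed_termF (Var 2) \<^bold>\<and> closed_termF (Var 1) \<^bold>\<and> node2F 5 (Var 2) (Var 1) (Var 0) \<^bold>\<rightarrow>
        (Tr (Var 0) \<^bold>\<leftrightarrow> Ex (Ex (valF (Var 4) (Var 1) \<^bold>\<and> valF (Var 3) (Var 0) \<^bold>\<and> Var 1 \<^bold>= Var 0)))))) \<^bold>\<and>
      All (All (All (closed_termF (Var 2) \<^bold>\<and> closed_termF (Var 1) \<^bold>\<and> node2F 6 (Var 2) (Var 1) (Var 0) \<^bold>\<rightarrow>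
        (Tr (Var 0) \<^bold>\<leftrightarrow> Ex (Ex (valF (Var 4) (Var 1) \<^bold>\<and> valF (Var 3) (Var 0) \<^bold>\<and> Var 1 \<^bold>< Var 0)))))) \<^bold>\<and>
      All (All (sentF (Var 1) \<^bold>\<and> node1F 7 (Var 1) (Var 0) \<^bold>\<rightarrow>
        (Tr (Var 0) \<^bold>\<leftrightarrow> \<^bold>\<not> Tr (Var 1)))) \<^bold>\<and>
      All (All (All (sentF (Var 2) \<^bold>\<and> sentF (Var 1) \<^bold>\<and> node2F 8 (Var 2) (Var 1) (Var 0) \<^bold>\<rightarrow>
        (Tr (Var 0) \<^bold>\<leftrightarrow> Tr (Var 2) \<^bold>\<or> Tr (Var 1))))) \<^bold>\<and>
      All (All (sentF (Var 0) \<^bold>\<and> node1F 9 (Var 1) (Var 0) \<^bold>\<rightarrow>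
        (Tr (Var 0) \<^bold>\<leftrightarrow> Ex (Ex (Ex (numeralF (Var 2) (Var 1) \<^bold>\<and>
           substF (Var 1) Zero (Var 4) (Var 0) \<^bold>\<and> Tr (Var 0))))))))"

definition CT :: "fm set" where
  "CT = PA_base \<union> range induction \<union> {Tarski}"

end

theory Submission
  imports Defs
begin

text \<open>Let \<open>M\<close> interpret \<open>N\<close> and \<open>N\<close> interpret \<open>M'\<close>, and let \<open>f\<close> be an \<open>M\<close>-definable isomorphism from \<open>M\<close> to \<open>M'\<close>.
  By recursion inside \<open>N\<close>, coded by Goedel's beta function, there is an \<open>N\<close>-definable embedding \<open>h\<close>
  of the arithmetic of \<open>N\<close> into \<open>M'\<close> that commutes with zero and successor.  The set of \<open>x\<close> with \<open>f x\<close> in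
  the range of \<open>h\<close> is \<open>M\<close>-definable, so it is everything by induction in \<open>M\<close>, and \<open>h\<close> is onto.  The truth
  predicate of \<open>M'\<close> pulls back along \<open>h\<close> to an \<open>N\<close>-definable predicate that satisfies Tarski's clauses
  in \<open>N\<close>; by induction in \<open>N\<close> on the depth of formulae it agrees with the truth predicate of \<open>N\<close>.
  Hence \<open>h\<close> is an isomorphism, and the inverse of \<open>h\<close> after \<open>f\<close> is the required one.\<close>

section \<open>Substitution and isomorphism\<close>

text \<open>The range of \<open>h\<close> is closed under successor, but nothing makes it definable
  in \<open>M'\<close>, whose induction covers only its own definable sets. \<open>M\<close> is the
  model that sees both maps: \<open>f\<close> by hypothesis, and \<open>h\<close> once tuples of
  tuples are flattened. An isomorphism of the arithmetic does not settle truth, since truth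
  predicates on one nonstandard model of arithmetic can differ. What forces agreement is that the
  pulled-back predicate is definable in \<open>N\<close>, so that the induction scheme of
  \<open>N\<close>, which admits formulae with \<open>Tr\<close>, applies to the comparison. At an
  existential sentence both predicates range over the same numeral instances. The clause that only
  sentences are true makes each instance accepted by either one a sentence, and depth, unlike the
  code, is smaller for the instance than for the quantified sentence. Recursion inside a model
  yields functions on single elements, so an interpreted structure is first copied onto codes of
  tuples.\<close>

lemma eval_subst: "eval M e (subst_tm \<sigma> t) = eval M (\<lambda>i. eval M e (\<sigma> i)) t"
  by (induction t) auto

lemma eval_sh1 [simp]: "eval M (case_nat x e) (sh (Suc 0) t) = eval M e t"
  by (simp add: sh_def eval_subst)

lemma eval_sh2 [simp]: "eval M (case_nat x (case_nat y e)) (sh 2 t) = eval M e t"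
  by (simp add: sh_def eval_subst numeral_2_eq_2)

lemma eval_sh3 [simp]: "eval M (case_nat x (case_nat y (case_nat z e))) (sh 3 t) = eval M e t"
  by (simp add: sh_def eval_subst numeral_3_eq_3)

lemma eval_sh4 [simp]:
  "eval M (case_nat x (case_nat y (case_nat z (case_nat w e)))) (sh 4 t) = eval M e t"
  by (simp add: sh_def eval_subst eval_nat_numeral)

lemma sat_subst: "sat M e (subst_fm \<sigma> \<phi>) = sat M (\<lambda>i. eval M e (\<sigma> i)) \<phi>"
proof (induction \<phi> arbitrary: e \<sigma>)
  case (Ex \<phi>)
  have "(\<lambda>i. eval M (case_nat x e) (case i of 0 \<Rightarrow> Var 0 | Suc i \<Rightarrow> sh 1 (\<sigma> i))) =
      case_nat x (\<lambda>i. eval M e (\<sigma> i))" for x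
    by (auto simp: fun_eq_iff split: nat.split)
  then show ?case by (simp only: subst_fm.simps sat.simps Ex.IH)
qed (simp_all add: eval_subst)

lemma eval_closed:
  "is_struct M \<Longrightarrow> range e \<subseteq> univ M \<Longrightarrow> eval M e t \<in> univ M"
  by (induction t) (auto simp: is_struct_def)

lemma range_case_nat: "range (case_nat x e) \<subseteq> A \<longleftrightarrow> x \<in> A \<and> range e \<subseteq> A"
  by (auto simp: image_subset_iff split: nat.split)

lemma sat_iso:
  assumes iso: "is_iso M N f" and M: "is_struct M"
  shows "range e \<subseteq> univ M \<Longrightarrow> sat M e \<phi> = sat N (f \<circ> e) \<phi>"
proof (induction \<phi> arbitrary: e)
  case (Ex \<phi>)
  have "sat M (case_nat x e) \<phi> = sat N (case_nat (f x) (f \<circ> e)) \<phi>" if "x \<in> univ M" for x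
  proof -
    have "f \<circ> case_nat x e = case_nat (f x) (f \<circ> e)"
      by (auto simp: fun_eq_iff split: nat.split)
    with Ex.IH[of "case_nat x e"] Ex.prems that show ?thesis by (simp add: range_case_nat)
  qed
  moreover have "f ` univ M = univ N" using iso by (simp add: is_iso_def bij_betw_def)
  ultimately show ?case by (simp only: sat.simps) (metis imageE imageI)
next
  case (Eq s t)
  have ev: "eval N (\<lambda>i. f (e i)) t = f (eval M e t)" for t
    using Eq M iso by (induction t) (auto simp: is_iso_def eval_closed)
  have "inj_on f (univ M)" using iso by (simp add: is_iso_def bij_betw_def)
  then show ?case using Eq M by (simp add: ev comp_def eval_closed inj_on_eq_iff)
next
  case (Less s t)
  have ev: "eval N (\<lambda>i. f (e i)) t = f (eval M e t)" for t
    using Less M iso by (induction t) (auto simp: is_iso_def eval_closed)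
  show ?case using Less M iso by (simp add: ev comp_def eval_closed is_iso_def)
next
  case (Tr t)
  have ev: "eval N (\<lambda>i. f (e i)) t = f (eval M e t)" for t
    using Tr M iso by (induction t) (auto simp: is_iso_def eval_closed)
  show ?case using Tr M iso by (simp add: ev comp_def eval_closed is_iso_def)
qed auto

section \<open>Definable predicates and terms\<close>

text \<open>Variables are moved to the even positions and parameters to the odd ones, so that the parameters
  of two formulae can be merged by renaming.\<close>

definition interleave :: "(nat \<Rightarrow> 'a) \<Rightarrow> (nat \<Rightarrow> 'a) \<Rightarrow> nat \<Rightarrow> 'a" where
  "interleave e p i = (if even i then e (i div 2) else p (i div 2))"

text \<open>A predicate of whole assignments rather than a relation of fixed arity: closure under
  connectives and quantifiers then takes the form of introduction rules, and later definability
  goals are met without writing formulae.\<close>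

definition dpred :: "'a struct \<Rightarrow> ((nat \<Rightarrow> 'a) \<Rightarrow> bool) \<Rightarrow> bool" where
  "dpred M P \<longleftrightarrow> (\<exists>\<phi> p. range p \<subseteq> univ M \<and>
     (\<forall>e. range e \<subseteq> univ M \<longrightarrow> P e = sat M (interleave e p) \<phi>))"

text \<open>A definable function is handled through its graph: variable 0 holds the value and the
  arguments move up by one.\<close>

definition dterm :: "'a struct \<Rightarrow> ((nat \<Rightarrow> 'a) \<Rightarrow> 'a) \<Rightarrow> bool" where
  "dterm M t \<longleftrightarrow> (\<forall>e. range e \<subseteq> univ M \<longrightarrow> t e \<in> univ M) \<and>
     dpred M (\<lambda>e. e 0 = t (\<lambda>i. e (Suc i)))"

lemma sat_rename: "sat M e (subst_fm (\<lambda>i. Var (\<rho> i)) \<phi>) = sat M (\<lambda>i. e (\<rho> i)) \<phi>"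
  by (simp add: sat_subst)

lemma dpred_rename:
  assumes "dpred M P" shows "dpred M (\<lambda>e. P (\<lambda>i. e (f i)))"
proof -
  obtain \<phi> p where p: "range p \<subseteq> univ M"
    and P: "\<And>e. range e \<subseteq> univ M \<Longrightarrow> P e = sat M (interleave e p) \<phi>"
    using assms unfolding dpred_def by blast
  let ?\<rho> = "\<lambda>i. if even i then 2 * f (i div 2) else i"
  have "(\<lambda>i. interleave e p (?\<rho> i)) = interleave (\<lambda>i. e (f i)) p" for e
    by (auto simp: interleave_def)
  then have "P (\<lambda>i. e (f i)) = sat M (interleave e p) (subst_fm (\<lambda>i. Var (?\<rho> i)) \<phi>)"
    if "range e \<subseteq> univ M" for e
    using P[of "\<lambda>i. e (f i)"] that by (auto simp: sat_rename)
  then show ?thesis using p unfolding dpred_def by blast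
qed

lemma dpred_cong:
  assumes "dpred M P" "\<And>e. range e \<subseteq> univ M \<Longrightarrow> P e = Q e"
  shows "dpred M Q"
  using assms unfolding dpred_def by (metis (no_types, lifting))

lemma dpred_Not: "dpred M P \<Longrightarrow> dpred M (\<lambda>e. \<not> P e)"
  unfolding dpred_def by (metis sat.simps(4))

lemma dpred_disj:
  assumes "dpred M P" "dpred M Q" shows "dpred M (\<lambda>e. P e \<or> Q e)"
proof -
  obtain \<phi> p where p: "range p \<subseteq> univ M"
    and P: "\<And>e. range e \<subseteq> univ M \<Longrightarrow> P e = sat M (interleave e p) \<phi>"
    using assms(1) unfolding dpred_def by blast
  obtain \<psi> q where q: "range q \<subseteq> univ M"
    and Q: "\<And>e. range e \<subseteq> univ M \<Longrightarrow> Q e = sat M (interleave e q) \<psi>"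
    using assms(2) unfolding dpred_def by blast
  \<comment> \<open>In \<open>interleave e ?r\<close> the parameters \<open>p\<close> sit at the
    positions congruent to 1 modulo 4 and \<open>q\<close> at those congruent to 3, which is where
    the two renamings send the odd indices.\<close>
  let ?r = "interleave p q"
  let ?\<rho> = "\<lambda>k i. if even i then i else 4 * (i div 2) + k"
  have r: "range ?r \<subseteq> univ M" using p q by (auto simp: interleave_def)
  have 1: "(\<lambda>i. interleave e ?r (?\<rho> 1 i)) = interleave e p" for e
    by (auto simp: interleave_def fun_eq_iff elim!: oddE)
  have 4: "(4 * b + 3) div 2 = Suc (2 * b)" for b :: nat by presburger
  have 2: "(\<lambda>i. interleave e ?r (?\<rho> 3 i)) = interleave e q" for e
    by (auto simp: interleave_def fun_eq_iff 4 elim!: oddE)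
  have "(P e \<or> Q e) = sat M (interleave e ?r)
     (subst_fm (\<lambda>i. Var (?\<rho> 1 i)) \<phi> \<^bold>\<or> subst_fm (\<lambda>i. Var (?\<rho> 3 i)) \<psi>)"
    if "range e \<subseteq> univ M" for e
    by (simp only: sat.simps sat_rename 1 2 P[OF that] Q[OF that])
  then show ?thesis using r unfolding dpred_def by blast
qed

lemma dpred_conj: "dpred M P \<Longrightarrow> dpred M Q \<Longrightarrow> dpred M (\<lambda>e. P e \<and> Q e)"
  using dpred_Not[OF dpred_disj[OF dpred_Not[of M P] dpred_Not[of M Q]]] by simp

lemma dpred_imp: "dpred M P \<Longrightarrow> dpred M Q \<Longrightarrow> dpred M (\<lambda>e. P e \<longrightarrow> Q e)"
  unfolding imp_conv_disj by (intro dpred_disj dpred_Not)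

lemma dpred_iff: "dpred M P \<Longrightarrow> dpred M Q \<Longrightarrow> dpred M (\<lambda>e. P e \<longleftrightarrow> Q e)"
  unfolding iff_conv_conj_imp by (intro dpred_conj dpred_imp)

lemma dpred_ex:
  assumes "dpred M (\<lambda>e. P (e 0) (\<lambda>i. e (Suc i)))"
  shows "dpred M (\<lambda>e. \<exists>x\<in>univ M. P x e)"
proof -
  obtain \<phi> p where p: "range p \<subseteq> univ M"
    and P: "\<And>e. range e \<subseteq> univ M \<Longrightarrow> P (e 0) (\<lambda>i. e (Suc i)) = sat M (interleave e p) \<phi>"
    using assms unfolding dpred_def by blast
  \<comment> \<open>Pushing \<open>x\<close> in front of \<open>interleave e p\<close> exchanges the
    parities: the old variables now occupy odd positions and the parameters the positive even
    ones.\<close>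
  let ?\<rho> = "\<lambda>i. if i = 0 then 0 else if even i then i - 1 else i + 1"
  have 0: "2 * a \<noteq> Suc (2 * b)" for a b :: nat by presburger
  have 1: "(\<lambda>i. case_nat x (interleave e p) (?\<rho> i)) = interleave (case_nat x e) p" for x e
    by (auto simp: interleave_def fun_eq_iff 0 split: nat.split elim!: evenE oddE)
  have "P x e = sat M (case_nat x (interleave e p)) (subst_fm (\<lambda>i. Var (?\<rho> i)) \<phi>)"
    if "range e \<subseteq> univ M" "x \<in> univ M" for e x
    using P[of "case_nat x e"] that by (simp only: sat_rename 1) (simp add: range_case_nat)
  then have "(\<exists>x\<in>univ M. P x e) = sat M (interleave e p) (Ex (subst_fm (\<lambda>i. Var (?\<rho> i)) \<phi>))"
    if "range e \<subseteq> univ M" for e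
    using that by simp
  then show ?thesis using p unfolding dpred_def by blast
qed

lemma dpred_all:
  assumes "dpred M (\<lambda>e. P (e 0) (\<lambda>i. e (Suc i)))"
  shows "dpred M (\<lambda>e. \<forall>x\<in>univ M. P x e)"
  using dpred_Not[OF dpred_ex[where P="\<lambda>x e. \<not> P x e", OF dpred_Not[OF assms]]] by simp

lemma dterm_rename: "dterm M t \<Longrightarrow> dterm M (\<lambda>e. t (\<lambda>i. e (f i)))"
  unfolding dterm_def
  using dpred_rename[of M "\<lambda>e. e 0 = t (\<lambda>i. e (Suc i))" "case_nat 0 (\<lambda>i. Suc (f i))"]
  by (auto simp: image_subset_iff)

text \<open>A term is eliminated through its graph: \<open>P (t e) e\<close> says that some
  \<open>x\<close> equals \<open>t e\<close> and satisfies \<open>P x e\<close>.\<close>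

lemma dpred_subst:
  assumes t: "dterm M t" and P: "dpred M (\<lambda>e. P (e 0) (\<lambda>i. e (Suc i)))"
  shows "dpred M (\<lambda>e. P (t e) e)"
proof -
  have "dpred M (\<lambda>e. \<exists>x\<in>univ M. x = t e \<and> P x e)"
    using t P by (intro dpred_ex dpred_conj) (simp_all add: dterm_def)
  then show ?thesis by (rule dpred_cong) (use t in \<open>auto simp: dterm_def\<close>)
qed

lemma dpred_comp1:
  assumes "dpred M (\<lambda>e. P (e 0))" "dterm M s"
  shows "dpred M (\<lambda>e. P (s e))"
  using dpred_subst[of M s "\<lambda>x e. P x"] assms by simp

text \<open>Terms are substituted one at a time, the last argument first, each for variable 0; hence
  the permutations of variables here and in the ternary version.\<close>

lemma dpred_comp2:
  assumes P: "dpred M (\<lambda>e. P (e 0) (e (Suc 0)))" and s: "dterm M s" "dterm M t"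
  shows "dpred M (\<lambda>e. P (s e) (t e))"
proof -
  have "dpred M (\<lambda>e. P (e 0) (t (\<lambda>i. e (Suc i))))"
    by (rule dpred_subst[of M "\<lambda>e. t (\<lambda>i. e (Suc i))" "\<lambda>y e. P (e 0) y"])
      (rule dterm_rename[OF s(2)], use dpred_rename[OF P, of "\<lambda>i. if i = 0 then 1 else 0"] in simp)
  then show ?thesis by (rule dpred_subst[OF s(1)])
qed

lemma dpred_comp3:
  assumes P: "dpred M (\<lambda>e. P (e 0) (e (Suc 0)) (e (Suc (Suc 0))))"
    and s: "dterm M s" "dterm M t" "dterm M u"
  shows "dpred M (\<lambda>e. P (s e) (t e) (u e))"
proof -
  have "dpred M (\<lambda>e. P (e (Suc 0)) (e 0) (u (\<lambda>i. e (Suc (Suc i)))))"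
    by (rule dpred_subst[of M "\<lambda>e. u (\<lambda>i. e (Suc (Suc i)))" "\<lambda>y e. P (e (Suc 0)) (e 0) y"])
      (rule dterm_rename[OF s(3)], use dpred_rename[OF P, of "\<lambda>i. Suc (Suc 0) - i"] in simp)
  from dpred_subst[of M "\<lambda>e. t (\<lambda>i. e (Suc i))" "\<lambda>y e. P (e 0) y (u (\<lambda>i. e (Suc i)))",
      OF dterm_rename[OF s(2)] this]
  show ?thesis by (rule dpred_subst[OF s(1)])
qed

lemma dterm_graph:
  assumes "\<And>e. range e \<subseteq> univ M \<Longrightarrow> t e \<in> univ M" "dpred M (\<lambda>e. e 0 = t (\<lambda>i. e (Suc i)))"
  shows "dterm M t"
  using assms by (simp add: dterm_def)

lemma dterm_comp1:
  assumes F: "dterm M (\<lambda>e. F (e 0))" and s: "dterm M s"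
  shows "dterm M (\<lambda>e. F (s e))"
proof (rule dterm_graph)
  fix e :: "nat \<Rightarrow> 'a" assume "range e \<subseteq> univ M"
  then have "s e \<in> univ M" using s by (simp add: dterm_def)
  then have "range (\<lambda>_::nat. s e) \<subseteq> univ M" by auto
  then have "F ((\<lambda>_::nat. s e) 0) \<in> univ M" using F unfolding dterm_def by blast
  then show "F (s e) \<in> univ M" .
next
  have "dpred M (\<lambda>e. e (Suc 0) = F (e 0))"
    using F dpred_rename[of M "\<lambda>e. e 0 = F (e (Suc 0))" "\<lambda>i. 1 - i"] by (simp add: dterm_def)
  from dpred_subst[of M "\<lambda>e. s (\<lambda>i. e (Suc i))" "\<lambda>y e. e 0 = F y", OF dterm_rename[OF s] this]
  show "dpred M (\<lambda>e. e 0 = F (s (\<lambda>i. e (Suc i))))" .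
qed

lemma dterm_comp2:
  assumes F: "dterm M (\<lambda>e. F (e 0) (e (Suc 0)))" and s: "dterm M s" "dterm M t"
  shows "dterm M (\<lambda>e. F (s e) (t e))"
proof (rule dterm_graph)
  fix e :: "nat \<Rightarrow> 'a" assume "range e \<subseteq> univ M"
  then have "s e \<in> univ M" "t e \<in> univ M" using s by (simp_all add: dterm_def)
  then have "range (case_nat (s e) (\<lambda>_::nat. t e)) \<subseteq> univ M" by (auto simp: range_case_nat)
  then show "F (s e) (t e) \<in> univ M" using F unfolding dterm_def by fastforce
next
  have "dpred M (\<lambda>e. e (Suc (Suc 0)) = F (e (Suc 0)) (e 0))"
    using F dpred_rename[of M "\<lambda>e. e 0 = F (e (Suc 0)) (e (Suc (Suc 0)))" "\<lambda>i. Suc (Suc 0) - i"]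
    by (simp add: dterm_def)
  from dpred_subst[of M "\<lambda>e. t (\<lambda>i. e (Suc (Suc i)))" "\<lambda>y e. e (Suc 0) = F (e 0) y",
      OF dterm_rename[OF s(2)] this]
  show "dpred M (\<lambda>e. e 0 = F (s (\<lambda>i. e (Suc i))) (t (\<lambda>i. e (Suc i))))"
    by (rule dpred_subst[of M "\<lambda>e. s (\<lambda>i. e (Suc i))"
          "\<lambda>y e. e 0 = F y (t (\<lambda>i. e (Suc i)))", OF dterm_rename[OF s(1)]])
qed

lemma dterm_comp3:
  assumes F: "dterm M (\<lambda>e. F (e 0) (e (Suc 0)) (e (Suc (Suc 0))))"
    and s: "dterm M s" "dterm M t" "dterm M u"
  shows "dterm M (\<lambda>e. F (s e) (t e) (u e))"
proof (rule dterm_graph)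
  fix e :: "nat \<Rightarrow> 'a" assume "range e \<subseteq> univ M"
  then have "s e \<in> univ M" "t e \<in> univ M" "u e \<in> univ M" using s by (simp_all add: dterm_def)
  then have "range (case_nat (s e) (case_nat (t e) (\<lambda>_::nat. u e))) \<subseteq> univ M"
    by (auto simp: range_case_nat)
  then show "F (s e) (t e) (u e) \<in> univ M" using F unfolding dterm_def by fastforce
next
  have "dpred M (\<lambda>e. e (Suc (Suc (Suc 0))) = F (e (Suc (Suc 0))) (e (Suc 0)) (e 0))"
    using F dpred_rename[of M "\<lambda>e. e 0 = F (e (Suc 0)) (e (Suc (Suc 0))) (e (Suc (Suc (Suc 0))))"
        "\<lambda>i. Suc (Suc (Suc 0)) - i"]
    by (simp add: dterm_def)
  from dpred_subst[of M "\<lambda>e. u (\<lambda>i. e (Suc (Suc (Suc i))))"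
      "\<lambda>y e. e (Suc (Suc 0)) = F (e (Suc 0)) (e 0) y", OF dterm_rename[OF s(3)] this]
  have "dpred M (\<lambda>e. e (Suc (Suc 0)) = F (e (Suc 0)) (e 0) (u (\<lambda>i. e (Suc (Suc (Suc i))))))" .
  from dpred_subst[of M "\<lambda>e. t (\<lambda>i. e (Suc (Suc i)))"
      "\<lambda>y e. e (Suc 0) = F (e 0) y (u (\<lambda>i. e (Suc (Suc i))))", OF dterm_rename[OF s(2)] this]
  show "dpred M (\<lambda>e. e 0 = F (s (\<lambda>i. e (Suc i))) (t (\<lambda>i. e (Suc i))) (u (\<lambda>i. e (Suc i))))"
    by (rule dpred_subst[of M "\<lambda>e. s (\<lambda>i. e (Suc i))"
          "\<lambda>y e. e 0 = F y (t (\<lambda>i. e (Suc i))) (u (\<lambda>i. e (Suc i)))", OF dterm_rename[OF s(1)]])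
qed

lemma dpred_const: "is_struct M \<Longrightarrow> dpred M (\<lambda>e. Q)"
  unfolding dpred_def is_struct_def
  by (rule exI[of _ "if Q then Zero \<^bold>= Zero else \<^bold>\<not> (Zero \<^bold>= Zero)"], rule exI[of _ "\<lambda>_. zero M"]) auto

lemma dterm_var:
  assumes "is_struct M" shows "dterm M (\<lambda>e. e n)"
  unfolding dterm_def dpred_def
proof (intro conjI exI[of _ "Var 0 \<^bold>= Var (2 * Suc n)"] exI[of _ "\<lambda>_. zero M"])
  show "range (\<lambda>_. zero M) \<subseteq> univ M" using assms by (auto simp: is_struct_def)
qed (auto simp: interleave_def)

lemma dterm_const: "c \<in> univ M \<Longrightarrow> dterm M (\<lambda>e. c)"
  unfolding dterm_def dpred_def
  by (intro conjI exI[of _ "Var 0 \<^bold>= Var 1"] exI[of _ "\<lambda>_. c"]) (auto simp: interleave_def)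

lemma dpred_fm:
  assumes "is_struct M" shows "dpred M (\<lambda>e. sat M e \<phi>)"
  unfolding dpred_def
proof (intro exI[of _ "subst_fm (\<lambda>i. Var (2 * i)) \<phi>"] exI[of _ "\<lambda>_. zero M"] conjI)
  show "range (\<lambda>_. zero M) \<subseteq> univ M" using assms by (auto simp: is_struct_def)
qed (simp add: sat_rename interleave_def)

lemma dterm_tm:
  assumes "is_struct M" shows "dterm M (\<lambda>e. eval M e t)"
proof (rule dterm_graph)
  have "eval M e (sh 1 t) = eval M (\<lambda>i. e (Suc i)) t" for e
    by (simp add: sh_def eval_subst)
  then show "dpred M (\<lambda>e. e 0 = eval M (\<lambda>i. e (Suc i)) t)"
    using dpred_fm[OF assms, of "Var 0 \<^bold>= sh 1 t"] by simp
qed (use assms in \<open>simp add: eval_closed\<close>)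

lemma dpred_eq: "is_struct M \<Longrightarrow> dterm M s \<Longrightarrow> dterm M t \<Longrightarrow> dpred M (\<lambda>e. s e = t e)"
  by (rule dpred_comp2) (use dpred_fm[of M "Var 0 \<^bold>= Var (Suc 0)"] in simp_all)

lemma dpred_less: "is_struct M \<Longrightarrow> dterm M s \<Longrightarrow> dterm M t \<Longrightarrow> dpred M (\<lambda>e. less M (s e) (t e))"
  by (rule dpred_comp2) (use dpred_fm[of M "Var 0 \<^bold>< Var (Suc 0)"] in simp_all)

lemma dpred_truth: "is_struct M \<Longrightarrow> dterm M s \<Longrightarrow> dpred M (\<lambda>e. truth M (s e))"
  by (rule dpred_comp1) (use dpred_fm[of M "Tr (Var 0)"] in simp_all)

lemma dterm_succ: "is_struct M \<Longrightarrow> dterm M s \<Longrightarrow> dterm M (\<lambda>e. succ M (s e))"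
  by (rule dterm_comp1) (use dterm_tm[of M "Succ (Var 0)"] in simp_all)

lemma dterm_add: "is_struct M \<Longrightarrow> dterm M s \<Longrightarrow> dterm M t \<Longrightarrow> dterm M (\<lambda>e. add M (s e) (t e))"
  by (rule dterm_comp2) (use dterm_tm[of M "Var 0 \<^bold>+ Var (Suc 0)"] in simp_all)

lemma dterm_mul: "is_struct M \<Longrightarrow> dterm M s \<Longrightarrow> dterm M t \<Longrightarrow> dterm M (\<lambda>e. mul M (s e) (t e))"
  by (rule dterm_comp2) (use dterm_tm[of M "Var 0 \<^bold>* Var (Suc 0)"] in simp_all)

lemma dterm_if:
  assumes M: "is_struct M" and P: "dpred M P" and s: "dterm M s" and t: "dterm M t"
  shows "dterm M (\<lambda>e. if P e then s e else t e)"
proof (rule dterm_graph)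
  have "dpred M (\<lambda>e. P (\<lambda>i. e (Suc i)) \<and> e 0 = s (\<lambda>i. e (Suc i)) \<or>
      \<not> P (\<lambda>i. e (Suc i)) \<and> e 0 = t (\<lambda>i. e (Suc i)))"
    using s t by (intro dpred_disj dpred_conj dpred_Not dpred_rename[OF P]) (simp_all add: dterm_def)
  then show "dpred M (\<lambda>e. e 0 = (if P (\<lambda>i. e (Suc i)) then s (\<lambda>i. e (Suc i)) else t (\<lambda>i. e (Suc i))))"
    by (rule dpred_cong) auto
qed (use s t in \<open>auto simp: dterm_def\<close>)


section \<open>Arithmetic in models of PA\<close>

text \<open>Induction is assumed for formulae with \<open>Tr\<close> as well, whereas Tarski's
  sentence enters separately, as a property of a predicate on the universe.\<close>

locale peano =
  fixes M :: "'a struct"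
  assumes model: "is_model M (PA_base \<union> range induction)"
begin

abbreviation "U \<equiv> univ M"
abbreviation Z ("\<zero>") where "\<zero> \<equiv> zero M"
abbreviation S where "S \<equiv> succ M"
abbreviation plus_M (infixl "\<oplus>" 65) where "x \<oplus> y \<equiv> add M x y"
abbreviation times_M (infixl "\<otimes>" 70) where "x \<otimes> y \<equiv> mul M x y"
abbreviation less_M (infix "\<prec>" 50) where "x \<prec> y \<equiv> less M x y"

lemma is_struct: "is_struct M"
  using model by (simp add: is_model_def)

lemma closed [simp]:
  "\<zero> \<in> U" "x \<in> U \<Longrightarrow> S x \<in> U" "x \<in> U \<Longrightarrow> y \<in> U \<Longrightarrow> x \<oplus> y \<in> U"
  "x \<in> U \<Longrightarrow> y \<in> U \<Longrightarrow> x \<otimes> y \<in> U"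
  using is_struct by (auto simp: is_struct_def)

lemmas dintros = dpred_const[OF is_struct] dpred_eq[OF is_struct] dpred_less[OF is_struct]
  dpred_truth[OF is_struct] dpred_Not dpred_disj dpred_conj dpred_imp dpred_iff dpred_ex dpred_all
  dterm_var[OF is_struct] dterm_const dterm_succ[OF is_struct] dterm_add[OF is_struct]
  dterm_mul[OF is_struct] dterm_if[OF is_struct]

lemma axiom:
  assumes "x \<in> U" "y \<in> U"
  shows "\<forall>\<phi>\<in>PA_base. sat M (case_nat x (case_nat y (\<lambda>_. \<zero>))) \<phi>"
proof -
  have "range (case_nat x (case_nat y (\<lambda>_. \<zero>))) \<subseteq> U"
    using assms by (auto simp: range_case_nat)
  then show ?thesis using model unfolding is_model_def by blast
qed

lemma
  assumes "x \<in> U"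
  shows S_not_0 [simp]: "S x \<noteq> \<zero>" "\<zero> \<noteq> S x"
    and add_0 [simp]: "x \<oplus> \<zero> = x"
    and mul_0 [simp]: "x \<otimes> \<zero> = \<zero>"
  using axiom[OF assms assms] unfolding PA_base_def by (auto simp: numeral_2_eq_2)

lemma
  assumes "x \<in> U" "y \<in> U"
  shows S_eq_iff [simp]: "S x = S y \<longleftrightarrow> x = y"
    and add_S [simp]: "x \<oplus> S y = S (x \<oplus> y)"
    and mul_S [simp]: "x \<otimes> S y = x \<otimes> y \<oplus> x"
    and less_iff: "x \<prec> y \<longleftrightarrow> (\<exists>z\<in>U. x \<oplus> S z = y)"
  using axiom[OF assms] unfolding PA_base_def by (auto simp: numeral_2_eq_2)

lemma dinduct [consumes 1, case_names dpred zero succ]: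
  assumes x: "x \<in> U" and P: "dpred M (\<lambda>e. P (e 0))"
    and zero: "P \<zero>" and step: "\<And>y. y \<in> U \<Longrightarrow> P y \<Longrightarrow> P (S y)"
  shows "P x"
proof -
  obtain \<phi> p where p: "range p \<subseteq> univ M"
    and sat: "\<And>e. range e \<subseteq> univ M \<Longrightarrow> P (e 0) = sat M (interleave e p) \<phi>"
    using P unfolding dpred_def by blast
  \<comment> \<open>The predicate looks only at \<open>e 0\<close>, so every even position may be
    read as the induction variable; parameter \<open>m\<close> moves to index \<open>m + 1\<close>,
    the shape that \<open>induction\<close> expects.\<close>
  let ?\<rho> = "\<lambda>i. if even i then 0 else Suc (i div 2)"
  let ?\<psi> = "subst_fm (\<lambda>i. Var (?\<rho> i)) \<phi>"
  have 1: "(\<lambda>i. case_nat x p (?\<rho> i)) = interleave (\<lambda>_. x) p" for x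
    by (auto simp: interleave_def fun_eq_iff)
  have \<psi>: "sat M (case_nat x p) ?\<psi> = P x" if "x \<in> U" for x
    using sat[of "\<lambda>_. x"] that by (auto simp only: sat_rename 1)
  have 2: "(\<lambda>i. eval M p (case_nat Zero Var i)) = case_nat \<zero> p"
    by (auto simp: fun_eq_iff split: nat.split)
  have 3: "(\<lambda>i. eval M (case_nat y p) (case_nat (Succ (Var 0)) (\<lambda>i. Var (Suc i)) i)) =
      case_nat (S y) p" for y
    by (auto simp: fun_eq_iff split: nat.split)
  have "sat M p (induction ?\<psi>)" using model p unfolding is_model_def by blast
  then have "P \<zero> \<and> (\<forall>y\<in>U. P y \<longrightarrow> P (S y)) \<longrightarrow> (\<forall>y\<in>U. P y)"
    unfolding induction_def using closed
    by (simp only: sat.simps sat_subst[of M p] sat_subst[of M "case_nat _ p" "case_nat _ _"] 2 3 \<psi>)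
      (simp add: \<psi>, blast)
  then show ?thesis using x zero step by blast
qed

section \<open>Semiring laws\<close>

lemma add_0_left [simp]: "x \<in> U \<Longrightarrow> \<zero> \<oplus> x = x"
  by (induction rule: dinduct) (intro dintros, simp_all)

lemma add_S_left [simp]: assumes "y \<in> U" "x \<in> U" shows "S x \<oplus> y = S (x \<oplus> y)"
  using assms(1) by (induction rule: dinduct) (intro dintros, simp_all add: assms)

lemma add_assoc: assumes "z \<in> U" "x \<in> U" "y \<in> U" shows "x \<oplus> y \<oplus> z = x \<oplus> (y \<oplus> z)"
  using assms(1) by (induction rule: dinduct) (intro dintros, simp_all add: assms)

lemma add_comm: assumes "y \<in> U" "x \<in> U" shows "x \<oplus> y = y \<oplus> x"
  using assms(1) by (induction rule: dinduct) (intro dintros, simp_all add: assms)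

lemma add_lcomm: assumes "z \<in> U" "x \<in> U" "y \<in> U" shows "x \<oplus> (y \<oplus> z) = y \<oplus> (x \<oplus> z)"
  using assms by (metis add_assoc add_comm)

lemmas a_ac = add_assoc add_comm add_lcomm

lemma mul_0_left [simp]: "x \<in> U \<Longrightarrow> \<zero> \<otimes> x = \<zero>"
  by (induction rule: dinduct) (intro dintros, simp_all)

lemma mul_S_left [simp]: assumes "y \<in> U" "x \<in> U" shows "S x \<otimes> y = x \<otimes> y \<oplus> y"
  using assms(1) by (induction rule: dinduct) (intro dintros, simp_all add: assms a_ac)

lemma mul_comm: assumes "y \<in> U" "x \<in> U" shows "x \<otimes> y = y \<otimes> x"
  using assms(1) by (induction rule: dinduct) (intro dintros, simp_all add: assms)

lemma distrib_left: assumes "z \<in> U" "x \<in> U" "y \<in> U" shows "x \<otimes> (y \<oplus> z) = x \<otimes> y \<oplus> x \<otimes> z"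
  using assms(1) by (induction rule: dinduct) (intro dintros, simp_all add: assms a_ac)

lemma distrib_right: assumes "z \<in> U" "x \<in> U" "y \<in> U" shows "(y \<oplus> z) \<otimes> x = y \<otimes> x \<oplus> z \<otimes> x"
  using assms by (simp add: distrib_left mul_comm)

lemma mul_assoc: assumes "z \<in> U" "x \<in> U" "y \<in> U" shows "x \<otimes> y \<otimes> z = x \<otimes> (y \<otimes> z)"
  using assms(1) by (induction rule: dinduct) (intro dintros, simp_all add: assms distrib_left)

lemma mul_lcomm: assumes "z \<in> U" "x \<in> U" "y \<in> U" shows "x \<otimes> (y \<otimes> z) = y \<otimes> (x \<otimes> z)"
  using assms by (metis mul_assoc mul_comm)

lemmas m_ac = mul_assoc mul_comm mul_lcomm

lemma add_cancel_right [simp]: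
  assumes "x \<in> U" "y \<in> U" "z \<in> U" shows "y \<oplus> x = z \<oplus> x \<longleftrightarrow> y = z"
  using assms(1) by (induction rule: dinduct) (intro dintros, simp_all add: assms)

lemma add_cancel_left [simp]:
  assumes "x \<in> U" "y \<in> U" "z \<in> U" shows "x \<oplus> y = x \<oplus> z \<longleftrightarrow> y = z"
  using assms by (simp add: add_comm[of _ x])

lemma S_cases: assumes "x \<in> U" obtains "x = \<zero>" | y where "y \<in> U" "x = S y"
proof -
  have "x = \<zero> \<or> (\<exists>y\<in>U. x = S y)"
    using assms by (induction rule: dinduct) (intro dintros, auto)
  then show thesis using that by blast
qed

lemma add_eq_0 [simp]: "x \<in> U \<Longrightarrow> y \<in> U \<Longrightarrow> x \<oplus> y = \<zero> \<longleftrightarrow> x = \<zero> \<and> y = \<zero>"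
  by (rule S_cases[of y]) simp_all

end

lemma dterm_closed1: "dterm M (\<lambda>e. F (e 0)) \<Longrightarrow> x \<in> univ M \<Longrightarrow> F x \<in> univ M"
  unfolding dterm_def by (fastforce dest!: conjunct1 spec[where x = "\<lambda>_. x"])

context peano
begin

section \<open>Order and strong induction\<close>

definition le (infix "\<preceq>" 50) where "x \<preceq> y \<longleftrightarrow> (\<exists>z\<in>U. x \<oplus> z = y)"

lemma dpred_le: "dterm M s \<Longrightarrow> dterm M t \<Longrightarrow> dpred M (\<lambda>e. s e \<preceq> t e)"
  by (rule dpred_comp2[where P="\<lambda>x y. x \<preceq> y"], unfold le_def, intro dintros)

lemma less_iff_le: "x \<in> U \<Longrightarrow> y \<in> U \<Longrightarrow> x \<prec> y \<longleftrightarrow> S x \<preceq> y"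
  by (simp add: less_iff le_def)

lemma leE: assumes "x \<preceq> y" "x \<in> U" obtains z where "z \<in> U" "y = x \<oplus> z"
  using assms by (auto simp: le_def)

lemma le_refl [simp]: "x \<in> U \<Longrightarrow> x \<preceq> x"
  unfolding le_def by (rule bexI[of _ \<zero>]) simp_all

lemma le_add [simp]: "x \<in> U \<Longrightarrow> y \<in> U \<Longrightarrow> x \<preceq> x \<oplus> y" "x \<in> U \<Longrightarrow> y \<in> U \<Longrightarrow> x \<preceq> y \<oplus> x"
  unfolding le_def by (auto intro: add_comm)

lemma zero_le [simp]: "x \<in> U \<Longrightarrow> \<zero> \<preceq> x"
  using le_add(1)[of \<zero> x] by simp

lemma le_trans [trans]: "x \<preceq> y \<Longrightarrow> y \<preceq> z \<Longrightarrow> x \<in> U \<Longrightarrow> y \<in> U \<Longrightarrow> z \<in> U \<Longrightarrow> x \<preceq> z"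
  by (auto elim!: leE simp: add_assoc)

lemma le_antisym: assumes "x \<preceq> y" "y \<preceq> x" "x \<in> U" "y \<in> U" shows "x = y"
proof -
  obtain a b where "a \<in> U" "b \<in> U" "y = x \<oplus> a" "x = y \<oplus> b" using assms by (metis leE)
  then have "x \<oplus> (a \<oplus> b) = x \<oplus> \<zero>" using assms(3) by (metis add_0 add_assoc)
  then have "a = \<zero>" using \<open>a \<in> U\<close> \<open>b \<in> U\<close> assms by (simp del: add_0)
  then show ?thesis using \<open>y = x \<oplus> a\<close> assms by simp
qed

lemma S_le_S [simp]: "x \<in> U \<Longrightarrow> y \<in> U \<Longrightarrow> S x \<preceq> S y \<longleftrightarrow> x \<preceq> y"
  by (simp add: le_def)

lemma S_le_0 [simp]: "x \<in> U \<Longrightarrow> \<not> S x \<preceq> \<zero>"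
  by (auto simp: le_def)

lemma not_less_0 [simp]: "x \<in> U \<Longrightarrow> \<not> x \<prec> \<zero>"
  by (simp add: less_iff_le)

lemma less_S_iff [simp]: "x \<in> U \<Longrightarrow> y \<in> U \<Longrightarrow> x \<prec> S y \<longleftrightarrow> x \<preceq> y"
  by (simp add: less_iff_le)

lemma le_S [simp]: "x \<in> U \<Longrightarrow> x \<preceq> S x"
  unfolding le_def by (rule bexI[of _ "S \<zero>"]) simp_all

lemma less_irrefl [simp]: assumes "x \<in> U" shows "\<not> x \<prec> x"
proof
  assume "x \<prec> x"
  then obtain z where "z \<in> U" "x \<oplus> S z = x \<oplus> \<zero>" using assms less_iff by auto
  then show False using assms by (simp del: add_0 add_S)
qed

lemma less_le: assumes "x \<in> U" "y \<in> U" shows "x \<prec> y \<longleftrightarrow> x \<preceq> y \<and> x \<noteq> y"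
proof
  assume "x \<prec> y" then show "x \<preceq> y \<and> x \<noteq> y"
    using assms by (auto simp: less_iff_le intro: le_trans[of x "S x"])
     (use less_irrefl less_iff_le in blast)
next
  assume "x \<preceq> y \<and> x \<noteq> y"
  then obtain z where "z \<in> U" "y = x \<oplus> z" using assms by (auto elim!: leE)
  moreover from this have "z \<noteq> \<zero>" using \<open>x \<preceq> y \<and> x \<noteq> y\<close> assms by auto
  ultimately show "x \<prec> y" using assms by (auto simp: less_iff elim!: S_cases[of z])
qed

lemma le_less: "x \<in> U \<Longrightarrow> y \<in> U \<Longrightarrow> x \<preceq> y \<longleftrightarrow> x \<prec> y \<or> x = y"
  by (auto simp: less_le)

lemma le_linear: assumes "x \<in> U" "y \<in> U" shows "x \<preceq> y \<or> y \<preceq> x"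
  using assms(1)
proof (induction rule: dinduct)
  case (succ x)
  then show ?case using assms(2) le_trans[of y x "S x"] by (metis closed(2) le_S less_iff_le less_le)
qed (intro dintros dpred_le, use assms in simp_all)

lemma not_le: "x \<in> U \<Longrightarrow> y \<in> U \<Longrightarrow> \<not> x \<preceq> y \<longleftrightarrow> y \<prec> x"
  using le_linear le_antisym by (auto simp: less_le)

lemma not_less: "x \<in> U \<Longrightarrow> y \<in> U \<Longrightarrow> \<not> x \<prec> y \<longleftrightarrow> y \<preceq> x"
  using not_le by blast

lemma le_less_trans: "x \<preceq> y \<Longrightarrow> y \<prec> z \<Longrightarrow> x \<in> U \<Longrightarrow> y \<in> U \<Longrightarrow> z \<in> U \<Longrightarrow> x \<prec> z"
  by (metis S_le_S closed(2) le_trans less_iff_le)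

lemma less_le_trans: "x \<prec> y \<Longrightarrow> y \<preceq> z \<Longrightarrow> x \<in> U \<Longrightarrow> y \<in> U \<Longrightarrow> z \<in> U \<Longrightarrow> x \<prec> z"
  by (metis closed(2) le_trans less_iff_le)

lemma add_mono:
  assumes "x \<preceq> x'" "y \<preceq> y'" "x \<in> U" "y \<in> U" shows "x \<oplus> y \<preceq> x' \<oplus> y'"
proof -
  obtain a b where "a \<in> U" "x' = x \<oplus> a" "b \<in> U" "y' = y \<oplus> b" using assms by (metis leE)
  moreover from this have "x' \<oplus> y' = (x \<oplus> y) \<oplus> (a \<oplus> b)" using assms(3,4) by (simp add: a_ac)
  ultimately show ?thesis using assms(3,4) by simp
qed

lemma le_add_cancel [simp]:
  assumes "x \<in> U" "y \<in> U" "z \<in> U" shows "x \<oplus> y \<preceq> x \<oplus> z \<longleftrightarrow> y \<preceq> z"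
proof
  assume "x \<oplus> y \<preceq> x \<oplus> z"
  then obtain d where d: "d \<in> U" "x \<oplus> z = x \<oplus> y \<oplus> d" using assms by (metis closed(3) leE)
  then have "x \<oplus> z = x \<oplus> (y \<oplus> d)" using assms by (simp add: add_assoc)
  then show "y \<preceq> z" using assms d(1) by simp
qed (use assms in \<open>simp add: add_mono\<close>)

lemma mul_mono: "x \<preceq> x' \<Longrightarrow> y \<preceq> y' \<Longrightarrow> x \<in> U \<Longrightarrow> y \<in> U \<Longrightarrow> x \<otimes> y \<preceq> x' \<otimes> y'"
  by (auto elim!: leE simp: distrib_left distrib_right add_assoc)

lemma less_induct [consumes 1, case_names dpred less]:
  assumes x: "x \<in> U" and P: "dpred M (\<lambda>e. P (e 0))"
    and step: "\<And>y. y \<in> U \<Longrightarrow> (\<And>z. z \<in> U \<Longrightarrow> z \<prec> y \<Longrightarrow> P z) \<Longrightarrow> P y"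
  shows "P x"
proof -
  have "\<forall>z\<in>U. z \<prec> x \<longrightarrow> P z"
    using x
  proof (induction rule: dinduct)
    case dpred
    show ?case by (intro dintros dpred_comp1[OF P])
  next
    case (succ y)
    then show ?case by (auto simp: le_less intro: step)
  qed simp
  with step x show ?thesis by blast
qed

subsection \<open>Pairs\<close>

lemma double_inj: assumes "x \<oplus> x = y \<oplus> y" "x \<in> U" "y \<in> U" shows "x = y"
proof -
  have *: "x = y" if "x \<oplus> x = y \<oplus> y" "x \<preceq> y" "x \<in> U" "y \<in> U" for x y
  proof -
    obtain d where d: "d \<in> U" "y = x \<oplus> d" using leE[OF \<open>x \<preceq> y\<close> \<open>x \<in> U\<close>] by blast
    then have "y \<oplus> y = (x \<oplus> x) \<oplus> (d \<oplus> d)" using that(3) by (simp add: a_ac)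
    then have "(x \<oplus> x) \<oplus> (d \<oplus> d) = (x \<oplus> x) \<oplus> \<zero>" using that by simp
    then have "d = \<zero>" using that(3) d(1) by (simp del: add_0)
    then show ?thesis using that d by simp
  qed
  show ?thesis using *[of x y] *[of y x] le_linear[of x y] assms by auto
qed

lemma ex_half: assumes "n \<in> U" shows "\<exists>z\<in>U. z \<oplus> z = n \<otimes> S n"
  using assms
proof (induction rule: dinduct)
  case (succ n)
  then obtain z where z: "z \<in> U" "z \<oplus> z = n \<otimes> S n" by auto
  have "(z \<oplus> S n) \<oplus> (z \<oplus> S n) = (z \<oplus> z) \<oplus> S n \<oplus> S n"
    using z(1) succ(1) by (simp add: a_ac)
  also have "\<dots> = S n \<otimes> S (S n)"
    using z succ(1) by simp
  finally show ?case using z succ(1) by (intro bexI[of _ "z \<oplus> S n"]) simp_all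
qed (intro dintros, auto intro: bexI[of _ \<zero>])

definition pr where
  "pr x y = (THE z. z \<in> U \<and> z \<oplus> z = (x \<oplus> y) \<otimes> S (x \<oplus> y) \<oplus> (x \<oplus> x))"

lemma pr_eq_iff:
  assumes "x \<in> U" "y \<in> U" "z \<in> U"
  shows "z = pr x y \<longleftrightarrow> z \<oplus> z = (x \<oplus> y) \<otimes> S (x \<oplus> y) \<oplus> (x \<oplus> x)"
    and "pr x y \<in> U"
proof -
  \<comment> \<open>With s = x + y, the pair is x plus one half of s(s + 1).\<close>
  obtain w where w: "w \<in> U" "w \<oplus> w = (x \<oplus> y) \<otimes> S (x \<oplus> y)"
    using ex_half[of "x \<oplus> y"] assms by auto
  have "(w \<oplus> x) \<oplus> (w \<oplus> x) = (x \<oplus> y) \<otimes> S (x \<oplus> y) \<oplus> (x \<oplus> x)"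
    unfolding w(2)[symmetric] using w(1) assms by (simp add: a_ac)
  moreover have "w \<oplus> x \<in> U" using w assms by simp
  ultimately have "\<exists>!z. z \<in> U \<and> z \<oplus> z = (x \<oplus> y) \<otimes> S (x \<oplus> y) \<oplus> (x \<oplus> x)"
    using double_inj by metis
  then have pr: "pr x y \<in> U \<and> pr x y \<oplus> pr x y = (x \<oplus> y) \<otimes> S (x \<oplus> y) \<oplus> (x \<oplus> x)"
    unfolding pr_def by (rule theI')
  then show "pr x y \<in> U" ..
  show "z = pr x y \<longleftrightarrow> z \<oplus> z = (x \<oplus> y) \<otimes> S (x \<oplus> y) \<oplus> (x \<oplus> x)"
    using pr double_inj[of z "pr x y"] assms(3) by metis
qed

lemma pr_closed [simp]: "x \<in> U \<Longrightarrow> y \<in> U \<Longrightarrow> pr x y \<in> U"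
  using pr_eq_iff(2) by blast

lemma pr_double: "x \<in> U \<Longrightarrow> y \<in> U \<Longrightarrow> pr x y \<oplus> pr x y = (x \<oplus> y) \<otimes> S (x \<oplus> y) \<oplus> (x \<oplus> x)"
  using pr_eq_iff(1) pr_closed by blast

text \<open>With s = x + y, twice the pair lies between s(s + 1) and s(s + 1) + 2s, which is below
  (s + 1)(s + 2). Equal pairs therefore have equal sums, after which 2x = 2x' remains.\<close>

lemma pr_inj [simp]:
  assumes "x \<in> U" "y \<in> U" "x' \<in> U" "y' \<in> U"
  shows "pr x y = pr x' y' \<longleftrightarrow> x = x' \<and> y = y'"
proof
  have *: "\<not> x \<oplus> y \<prec> x' \<oplus> y'"
    if "pr x y = pr x' y'" "x \<in> U" "y \<in> U" "x' \<in> U" "y' \<in> U" for x y x' y'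
  proof
    let ?s = "x \<oplus> y" let ?s' = "x' \<oplus> y'"
    assume "?s \<prec> ?s'"
    then have "S ?s \<preceq> ?s'" using that by (simp add: less_iff_le)
    then have "S ?s \<otimes> S (S ?s) \<preceq> ?s' \<otimes> S ?s'" using that by (intro mul_mono) simp_all
    also have "?s' \<otimes> S ?s' \<preceq> ?s' \<otimes> S ?s' \<oplus> (x' \<oplus> x')" using that by simp
    finally have "S ?s \<otimes> S (S ?s) \<preceq> pr x' y' \<oplus> pr x' y'"
      using that by (simp add: pr_double)
    also have "pr x' y' \<oplus> pr x' y' = ?s \<otimes> S ?s \<oplus> (x \<oplus> x)"
      using pr_double[of x y] that by simp
    also have "\<dots> \<preceq> ?s \<otimes> S ?s \<oplus> (?s \<oplus> ?s)"
      using that by (intro add_mono) simp_all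
    finally have "S ?s \<otimes> S (S ?s) \<preceq> ?s \<otimes> S ?s \<oplus> (?s \<oplus> ?s)"
      using that by simp
    moreover have "S ?s \<otimes> S (S ?s) = S (S (?s \<otimes> S ?s \<oplus> (?s \<oplus> ?s)))"
      using that by (simp add: a_ac)
    ultimately show False
      using that less_irrefl le_trans[of "S (?s \<otimes> S ?s \<oplus> (?s \<oplus> ?s))"
          "S (S (?s \<otimes> S ?s \<oplus> (?s \<oplus> ?s)))" "?s \<otimes> S ?s \<oplus> (?s \<oplus> ?s)"] by (simp del: mul_S mul_S_left add_S add_S_left add: less_iff_le[symmetric])
  qed
  assume eq: "pr x y = pr x' y'"
  then have s: "x \<oplus> y = x' \<oplus> y'"
    using *[of x y x' y'] *[of x' y' x y] assms by (auto simp: not_less intro: le_antisym)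
  have "x \<oplus> x = x' \<oplus> x'"
    using pr_double[of x y] pr_double[of x' y'] assms unfolding eq s by simp
  then have "x = x'" using assms double_inj by blast
  then show "x = x' \<and> y = y'" using s assms by simp
qed simp

lemma le_doubleD: assumes "x \<oplus> x \<preceq> y \<oplus> y" "x \<in> U" "y \<in> U" shows "x \<preceq> y"
proof (rule ccontr)
  assume "\<not> x \<preceq> y"
  then have "S y \<preceq> x" using assms by (simp add: not_le less_iff_le)
  then have "S y \<oplus> S y \<preceq> x \<oplus> x" using assms by (intro add_mono) simp_all
  then have "S y \<oplus> S y \<preceq> y \<oplus> y" using assms by (auto intro: le_trans)
  then have "S (y \<oplus> y) \<prec> y \<oplus> y" using assms by (simp add: less_iff_le)
  then show False using assms by (metis closed(2,3) le_S le_less_trans less_irrefl)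
qed

lemma le_pr: assumes "x \<in> U" "y \<in> U" shows "y \<preceq> pr x y"
proof (rule le_doubleD)
  show "y \<oplus> y \<preceq> pr x y \<oplus> pr x y"
  proof (cases rule: S_cases[OF assms(2)])
    case (2 z)
    have "y \<oplus> y \<preceq> y \<otimes> S y"
      using mul_mono[of "S \<zero>" y y y] assms 2 by (simp add: add_mono)
    also have "\<dots> \<preceq> (x \<oplus> y) \<otimes> S (x \<oplus> y)" using assms by (intro mul_mono) simp_all
    also have "\<dots> \<preceq> pr x y \<oplus> pr x y" using assms unfolding pr_double[OF assms] by simp
    finally show ?thesis using assms by simp
  qed (use assms in simp)
qed (use assms in simp_all)

text \<open>Node tags from 1 on are successors, so this makes codes strictly larger than the codes
  of their parts. The bound is (y + 1)(y + 2) = 2(y + 1) + (y + 1)y.\<close>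

lemma less_pr: assumes "x \<in> U" "y \<in> U" shows "y \<prec> pr (S x) y"
proof -
  have "S y \<preceq> pr (S x) y"
  proof (rule le_doubleD)
    have "S y \<oplus> S y \<preceq> (S y \<oplus> S y) \<oplus> S y \<otimes> y" using assms by (intro le_add) simp_all
    also have "\<dots> = S y \<otimes> S (S y)" using assms by (simp add: a_ac)
    finally have "S y \<oplus> S y \<preceq> S y \<otimes> S (S y)" .
    also have "\<dots> \<preceq> (S x \<oplus> y) \<otimes> S (S x \<oplus> y)" using assms by (intro mul_mono) simp_all
    also have "\<dots> \<preceq> pr (S x) y \<oplus> pr (S x) y"
      using assms pr_double[of "S x" y] by (simp del: mul_S mul_S_left add_S add_S_left)
    finally show "S y \<oplus> S y \<preceq> pr (S x) y \<oplus> pr (S x) y" using assms by simp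
  qed (use assms in simp_all)
  then show ?thesis using assms by (simp add: less_iff_le)
qed

lemma dterm_pr: "dterm M s \<Longrightarrow> dterm M t \<Longrightarrow> dterm M (\<lambda>e. pr (s e) (t e))"
proof (rule dterm_comp2[where F=pr], rule dterm_graph)
  have "dpred M (\<lambda>e. e 0 \<oplus> e 0 = (e (Suc 0) \<oplus> e (Suc (Suc 0))) \<otimes>
      S (e (Suc 0) \<oplus> e (Suc (Suc 0))) \<oplus> (e (Suc 0) \<oplus> e (Suc 0)))"
    by (intro dintros)
  then show "dpred M (\<lambda>e. e 0 = pr (e (Suc 0)) (e (Suc (Suc 0))))"
    by (rule dpred_cong) (auto simp: pr_eq_iff(1) image_subset_iff)
qed (auto simp: image_subset_iff)

end

context peano
begin

subsection \<open>Division and congruences\<close>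

lemma ex_div:
  assumes x: "x \<in> U" and m: "m \<in> U"
  shows "\<exists>q\<in>U. \<exists>r\<in>U. x = q \<otimes> S m \<oplus> r \<and> r \<prec> S m"
  using x
proof (induction rule: dinduct)
  case dpred
  show ?case by (intro dintros) (use m in simp_all)
next
  case zero
  show ?case using m by (intro bexI[of _ \<zero>]) (simp_all del: mul_S)
next
  case (succ x)
  then obtain q r where qr: "q \<in> U" "r \<in> U" "x = q \<otimes> S m \<oplus> r" "r \<preceq> m" using m by auto
  show ?case
  proof (cases "r = m")
    case True
    then have "S x = S q \<otimes> S m \<oplus> \<zero>" using qr m by (simp del: mul_S)
    then show ?thesis using qr m by (intro bexI[of _ "S q"] bexI[of _ \<zero>]) (simp_all del: mul_S)
  next
    case False
    then have "S r \<preceq> m" using qr m by (simp add: less_le flip: less_iff_le)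
    then have "S r \<prec> S m" using qr m by simp
    moreover have "S x = q \<otimes> S m \<oplus> S r" using qr m by (simp del: mul_S)
    ultimately show ?thesis using qr closed(2) by blast
  qed
qed

text \<open>If the quotients differed, one of the remainders would be at least
  \<open>m\<close>.\<close>

lemma div_unique:
  assumes "q \<otimes> m \<oplus> r = q' \<otimes> m \<oplus> r'" "r \<prec> m" "r' \<prec> m"
    and U: "q \<in> U" "q' \<in> U" "r \<in> U" "r' \<in> U" "m \<in> U"
  shows "r = r'"
proof -
  have *: "r = r'" if eq: "q \<otimes> m \<oplus> r = q' \<otimes> m \<oplus> r'" and r: "r \<prec> m" and le: "q \<preceq> q'"
    and U: "q \<in> U" "q' \<in> U" "r \<in> U" "r' \<in> U" "m \<in> U" for q q' r r'
  proof -
    obtain d where d: "d \<in> U" "q' = q \<oplus> d" using leE[OF le U(1)] by blast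
    then have "q \<otimes> m \<oplus> r = q \<otimes> m \<oplus> (d \<otimes> m \<oplus> r')"
      using eq U by (simp add: distrib_right add_assoc)
    then have r: "r = d \<otimes> m \<oplus> r'" "d \<otimes> m \<oplus> r' \<prec> m" using d U r by simp_all
    show ?thesis
    proof (rule S_cases[OF d(1)])
      fix c assume c: "c \<in> U" "d = S c"
      then have "m \<preceq> d \<otimes> m" "d \<otimes> m \<preceq> d \<otimes> m \<oplus> r'" using U by simp_all
      then have "m \<preceq> d \<otimes> m \<oplus> r'" using le_trans[of m "d \<otimes> m" "d \<otimes> m \<oplus> r'"] d U by simp
      then show ?thesis using r(2) U d by (simp flip: not_less)
    qed (use r U in simp)
  qed
  show ?thesis using *[of q r q' r'] *[of q' r' q r] le_linear[of q q'] assms by auto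
qed

text \<open>Congruence modulo \<open>m\<close>; in the absence of subtraction, multiples of
  \<open>m\<close> are added on both sides.\<close>

definition cg where
  "cg m x y \<longleftrightarrow> (\<exists>s\<in>U. \<exists>t\<in>U. x \<oplus> s \<otimes> m = y \<oplus> t \<otimes> m)"

lemma cg_refl [simp]: "x \<in> U \<Longrightarrow> cg m x x"
  unfolding cg_def by auto

lemma cg_sym: "cg m x y \<Longrightarrow> cg m y x"
  unfolding cg_def by metis

lemma cg_trans:
  assumes "cg m x y" "cg m y z" and U: "m \<in> U" "x \<in> U" "y \<in> U" "z \<in> U"
  shows "cg m x z"
proof -
  obtain s t s' t' where st: "s \<in> U" "t \<in> U" "s' \<in> U" "t' \<in> U"
    and eq: "x \<oplus> s \<otimes> m = y \<oplus> t \<otimes> m" "y \<oplus> s' \<otimes> m = z \<oplus> t' \<otimes> m"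
    using assms(1,2) unfolding cg_def by metis
  have "x \<oplus> (s \<oplus> s') \<otimes> m = (x \<oplus> s \<otimes> m) \<oplus> s' \<otimes> m"
    using st U by (simp add: distrib_right add_assoc)
  also have "\<dots> = (y \<oplus> s' \<otimes> m) \<oplus> t \<otimes> m" unfolding eq(1) using st U by (simp add: a_ac)
  also have "\<dots> = z \<oplus> (t' \<oplus> t) \<otimes> m" unfolding eq(2) using st U by (simp add: distrib_right add_assoc)
  finally show ?thesis unfolding cg_def using st by (metis closed(3))
qed

lemma cg_add:
  assumes "cg m x x'" "cg m y y'" and U: "m \<in> U" "x \<in> U" "y \<in> U" "x' \<in> U" "y' \<in> U"
  shows "cg m (x \<oplus> y) (x' \<oplus> y')"
proof -
  obtain s t s' t' where st: "s \<in> U" "t \<in> U" "s' \<in> U" "t' \<in> U"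
    and eq: "x \<oplus> s \<otimes> m = x' \<oplus> t \<otimes> m" "y \<oplus> s' \<otimes> m = y' \<oplus> t' \<otimes> m"
    using assms(1,2) unfolding cg_def by metis
  have "x \<oplus> y \<oplus> (s \<oplus> s') \<otimes> m = (x \<oplus> s \<otimes> m) \<oplus> (y \<oplus> s' \<otimes> m)"
    using st U by (simp add: distrib_right a_ac)
  also have "\<dots> = x' \<oplus> y' \<oplus> (t \<oplus> t') \<otimes> m"
    unfolding eq using st U by (simp add: distrib_right a_ac)
  finally show ?thesis unfolding cg_def using st by (metis closed(3))
qed

lemma cg_mul:
  assumes "cg m x x'" "cg m y y'" and U: "m \<in> U" "x \<in> U" "y \<in> U" "x' \<in> U" "y' \<in> U"
  shows "cg m (x \<otimes> y) (x' \<otimes> y')"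
proof -
  have *: "cg m (x \<otimes> y) (x' \<otimes> y)" if xx: "cg m x x'" and U: "m \<in> U" "x \<in> U" "y \<in> U" "x' \<in> U" for x x' y
  proof -
    obtain s t where st: "s \<in> U" "t \<in> U" and eq: "x \<oplus> s \<otimes> m = x' \<oplus> t \<otimes> m"
      using xx unfolding cg_def by metis
    have "x \<otimes> y \<oplus> (s \<otimes> y) \<otimes> m = (x \<oplus> s \<otimes> m) \<otimes> y" using st U by (simp add: distrib_left distrib_right m_ac)
    also have "\<dots> = x' \<otimes> y \<oplus> (t \<otimes> y) \<otimes> m" unfolding eq using st U by (simp add: distrib_left distrib_right m_ac)
    finally show ?thesis unfolding cg_def using st U by (metis closed(4))
  qed
  have "cg m (x \<otimes> y) (x' \<otimes> y)" "cg m (x' \<otimes> y) (x' \<otimes> y')"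
    using *[of x x' y] *[of y y' x'] assms by (simp_all add: mul_comm[of _ x'])
  then show ?thesis using cg_trans[of m "x \<otimes> y" "x' \<otimes> y" "x' \<otimes> y'"] U by simp
qed

lemma dpred_cg: "dterm M r \<Longrightarrow> dterm M s \<Longrightarrow> dterm M t \<Longrightarrow> dpred M (\<lambda>e. cg (r e) (s e) (t e))"
  by (rule dpred_comp3[where P=cg], unfold cg_def, intro dintros)

text \<open>Invertibility modulo \<open>m\<close> plays the part of coprimality to \<open>m\<close>:
  it is preserved by products and hands over directly the inverse that Chinese remaindering
  uses.\<close>

definition unit_mod where
  "unit_mod m x \<longleftrightarrow> (\<exists>u\<in>U. cg m (u \<otimes> x) (S \<zero>))"

lemma dpred_unit_mod: "dterm M s \<Longrightarrow> dterm M t \<Longrightarrow> dpred M (\<lambda>e. unit_mod (s e) (t e))"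
  by (rule dpred_comp2[where P=unit_mod], unfold unit_mod_def, intro dintros dpred_cg) simp_all

lemma unit_mod_mul:
  assumes "unit_mod m x" "unit_mod m y" and U: "m \<in> U" "x \<in> U" "y \<in> U"
  shows "unit_mod m (x \<otimes> y)"
proof -
  obtain u v where uv: "u \<in> U" "v \<in> U" "cg m (u \<otimes> x) (S \<zero>)" "cg m (v \<otimes> y) (S \<zero>)"
    using assms unfolding unit_mod_def by blast
  have "cg m ((u \<otimes> x) \<otimes> (v \<otimes> y)) (S \<zero> \<otimes> S \<zero>)" using uv U by (intro cg_mul) simp_all
  moreover have "(u \<otimes> x) \<otimes> (v \<otimes> y) = (u \<otimes> v) \<otimes> (x \<otimes> y)" using uv U by (simp add: m_ac)
  ultimately show ?thesis using uv unfolding unit_mod_def by (intro bexI[of _ "u \<otimes> v"]) simp_all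
qed

lemma unit_mod_factor:
  assumes "unit_mod m (x \<otimes> y)" and U: "m \<in> U" "x \<in> U" "y \<in> U"
  shows "unit_mod m x" "unit_mod m y"
proof -
  obtain u where u: "u \<in> U" "cg m (u \<otimes> (x \<otimes> y)) (S \<zero>)"
    using assms unfolding unit_mod_def by blast
  have "u \<otimes> (x \<otimes> y) = (u \<otimes> y) \<otimes> x" "u \<otimes> (x \<otimes> y) = (u \<otimes> x) \<otimes> y"
    using u(1) U by (simp_all add: m_ac)
  then show "unit_mod m x" "unit_mod m y" using u U unfolding unit_mod_def
    by (auto intro: bexI[of _ "u \<otimes> y"] bexI[of _ "u \<otimes> x"])
qed

lemma unit_mod_cg:
  assumes "unit_mod m x" "cg m x y" and U: "m \<in> U" "x \<in> U" "y \<in> U"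
  shows "unit_mod m y"
proof -
  obtain u where u: "u \<in> U" "cg m (u \<otimes> x) (S \<zero>)" using assms unfolding unit_mod_def by blast
  have "cg m (u \<otimes> y) (u \<otimes> x)" using u U by (intro cg_mul[OF cg_refl cg_sym[OF assms(2)]]) simp_all
  then show ?thesis using cg_trans[of m "u \<otimes> y" "u \<otimes> x" "S \<zero>"] u U
    unfolding unit_mod_def by auto
qed

subsection \<open>Goedel's beta function\<close>

definition divides where "divides x y \<longleftrightarrow> (\<exists>z\<in>U. y = x \<otimes> z)"

lemma dpred_divides: "dterm M s \<Longrightarrow> dterm M t \<Longrightarrow> dpred M (\<lambda>e. divides (s e) (t e))"
  by (rule dpred_comp2[where P=divides], unfold divides_def, intro dintros)

lemma divides_mul: assumes "divides x y" "x \<in> U" "z \<in> U" shows "divides x (y \<otimes> z)"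
  using assms unfolding divides_def by (metis mul_assoc closed(4))

abbreviation modulus where "modulus b i \<equiv> S (S i \<otimes> b)"

text \<open>Modulo \<open>S k\<close>, the element \<open>k\<close> is -1 and hence its own
  inverse.\<close>

lemma unit_minus_one: assumes "k \<in> U" shows "unit_mod (S k) k"
proof -
  have "k \<otimes> k \<oplus> S \<zero> \<otimes> S k = S \<zero> \<oplus> k \<otimes> S k" using assms by simp
  then show ?thesis unfolding unit_mod_def cg_def using assms by (metis closed(1,2))
qed

text \<open>With \<open>j = i + d\<close> and \<open>k = (j + 1) b \<equiv> -1\<close> modulo the larger modulus \<open>k + 1\<close>, the smaller modulus is
  congruent to \<open>k d b\<close>, and \<open>b\<close> and hence its divisor \<open>d\<close> are units because \<open>b\<close> divides \<open>k\<close>.\<close>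

lemma moduli_coprime:
  assumes ij: "i \<prec> j" and d: "\<And>d. d \<in> U \<Longrightarrow> S d \<preceq> j \<Longrightarrow> divides (S d) b"
    and U: "i \<in> U" "j \<in> U" "b \<in> U"
  shows "unit_mod (modulus b j) (modulus b i)"
proof -
  obtain d where d0: "d \<in> U" "j = i \<oplus> S d" using ij U by (auto simp: less_iff)
  let ?k = "S j \<otimes> b"
  have k: "unit_mod (S ?k) ?k" using U by (simp add: unit_minus_one)
  then have b: "unit_mod (S ?k) b" using unit_mod_factor[of _ "S j" b] U by simp
  have "S d \<preceq> j" using d0 U by (metis closed(2) le_add(2))
  then obtain c where "c \<in> U" "b = S d \<otimes> c" using d[of d] d0 by (auto simp: divides_def)
  then have "unit_mod (S ?k) (S d)" using unit_mod_factor[of "S ?k" "S d" c] b U d0 by simp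
  then have unit: "unit_mod (S ?k) (?k \<otimes> (S d \<otimes> b))"
    using unit_mod_mul[OF k unit_mod_mul[OF _ b, of "S d"]] U d0 by simp
  have "S j = S i \<oplus> S d" using d0 U by simp
  then have "?k = S i \<otimes> b \<oplus> S d \<otimes> b" using d0 U by (simp only: distrib_right closed)
  then have Sk: "S ?k = modulus b i \<oplus> S d \<otimes> b" using d0 U by (simp del: mul_S_left mul_S)
  let ?w = "S d \<otimes> b"
  have w: "?w \<in> U" "modulus b i \<in> U" "?k \<in> U" using d0(1) U by simp_all
  \<comment> \<open>Modulo \<open>S ?k\<close> the smaller modulus is -\<open>?w\<close> and -1 is
    \<open>?k\<close>; the chain writes this congruence out with explicit multiples.\<close>
  have "modulus b i \<oplus> ?w \<otimes> S ?k = modulus b i \<oplus> (?k \<otimes> ?w \<oplus> ?w)"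
    using w by (simp only: mul_S mul_comm[of ?w ?k])
  also have "\<dots> = ?k \<otimes> ?w \<oplus> (modulus b i \<oplus> ?w)"
    using w by (simp only: add_lcomm closed)
  also have "\<dots> = ?k \<otimes> ?w \<oplus> S \<zero> \<otimes> S ?k"
    unfolding Sk[symmetric] using w by (simp only: mul_S_left mul_0_left add_0_left closed)
  finally have "modulus b i \<oplus> ?w \<otimes> S ?k = ?k \<otimes> ?w \<oplus> S \<zero> \<otimes> S ?k" .
  then have "cg (S ?k) (modulus b i) (?k \<otimes> (S d \<otimes> b))"
    unfolding cg_def using U d0 by (metis closed)
  from unit_mod_cg[OF unit cg_sym[OF this]] show ?thesis using U d0 by simp
qed

lemma crt:
  assumes F: "dterm M (\<lambda>e. F (e 0))" and n: "n \<in> U" and x: "x \<in> U" and b: "b \<in> U"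
    and d: "\<And>d. d \<in> U \<Longrightarrow> S d \<preceq> x \<Longrightarrow> divides (S d) b"
  shows "n \<preceq> x \<longrightarrow> (\<exists>a\<in>U. \<exists>p\<in>U.
    (\<forall>i\<in>U. i \<prec> n \<longrightarrow> cg (modulus b i) a (F i) \<and> divides (modulus b i) p) \<and>
    (\<forall>j\<in>U. n \<preceq> j \<and> j \<prec> x \<longrightarrow> unit_mod (modulus b j) p))"
  using n
proof (induction rule: dinduct)
  case dpred
  show ?case
    by (intro dintros dpred_le dpred_cg dpred_divides dpred_unit_mod dterm_comp1[OF F])
      (use x b in simp_all)
next
  case zero
  have "cg (modulus b j) (S \<zero> \<otimes> S \<zero>) (S \<zero>)" if "j \<in> U" for j using that b by simp
  then have "unit_mod (modulus b j) (S \<zero>)" if "j \<in> U" for j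
    using that unfolding unit_mod_def by (meson closed(1,2))
  then show ?case by (intro impI, rule_tac bexI[of _ \<zero>], rule_tac bexI[of _ "S \<zero>"]) simp_all
next
  case (succ n)
  show ?case
  proof
    assume "S n \<preceq> x"
    then have nx: "n \<prec> x" using succ(1) x by (simp add: less_iff_le)
    then obtain a p where U: "a \<in> U" "p \<in> U"
      and a: "\<And>i. i \<in> U \<Longrightarrow> i \<prec> n \<Longrightarrow> cg (modulus b i) a (F i)"
      and p: "\<And>i. i \<in> U \<Longrightarrow> i \<prec> n \<Longrightarrow> divides (modulus b i) p"
      and unit: "\<And>j. j \<in> U \<Longrightarrow> n \<preceq> j \<Longrightarrow> j \<prec> x \<Longrightarrow> unit_mod (modulus b j) p"
      using succ x by (auto simp: less_le)
    let ?m = "modulus b n" let ?k = "S n \<otimes> b"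
    have Fn [simp]: "F i \<in> U" if "i \<in> U" for i using F that by (rule dterm_closed1)
    obtain u where u: "u \<in> U" "cg ?m (u \<otimes> p) (S \<zero>)"
      using unit[of n] succ(1) nx unfolding unit_mod_def by auto
    \<comment> \<open>Since \<open>?k\<close> is -1 modulo \<open>?m\<close>, this is the difference
      of \<open>F n\<close> and \<open>a\<close> modulo \<open>?m\<close>.\<close>
    define v where "v = F n \<oplus> ?k \<otimes> a"
    have v: "v \<in> U" using U succ(1) b by (simp add: v_def)
    \<comment> \<open>The factor \<open>u\<close> inverts \<open>p\<close> modulo \<open>?m\<close>,
      so the correction amounts to \<open>v\<close> there, while it vanishes modulo the earlier
      moduli because they divide \<open>p\<close>.\<close>
    define a' where "a' = a \<oplus> p \<otimes> (u \<otimes> v)"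
    have a': "a' \<in> U" using U u v by (simp add: a'_def)
    have "cg ?m ((u \<otimes> p) \<otimes> v) (S \<zero> \<otimes> v)"
      by (rule cg_mul[OF u(2)]) (use v u U succ(1) b in simp_all)
    then have "cg ?m (p \<otimes> (u \<otimes> v)) v" using v u U by (simp add: m_ac)
    from cg_add[OF cg_refl this] have "cg ?m a' (a \<oplus> v)"
      using v u U succ(1) b by (simp add: a'_def)
    moreover have "a \<oplus> v = F n \<oplus> a \<otimes> ?m"
      using U succ(1) b by (simp add: v_def a_ac m_ac del: mul_S_left)
    then have "cg ?m (a \<oplus> v) (F n)"
      unfolding cg_def using U succ(1) b by (intro bexI[of _ \<zero>] bexI[of _ a]) (simp_all del: mul_S mul_S_left)
    ultimately have 1: "cg ?m a' (F n)"
      by (rule cg_trans) (use a' v U succ(1) b in simp_all)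
    have 2: "cg (modulus b i) a' (F i)" if i: "i \<in> U" "i \<prec> n" for i
    proof -
      obtain c where c: "c \<in> U" "p = modulus b i \<otimes> c" using p[OF i] by (auto simp: divides_def)
      have "p \<otimes> (u \<otimes> v) = (c \<otimes> (u \<otimes> v)) \<otimes> modulus b i"
        unfolding c(2) using c(1) u v i b by (simp add: m_ac del: mul_S mul_S_left)
      then have "cg (modulus b i) a' a"
        unfolding cg_def a'_def using U c(1) u v i b
        by (intro bexI[of _ \<zero>] bexI[of _ "c \<otimes> (u \<otimes> v)"]) (simp_all del: mul_S mul_S_left)
      then show ?thesis by (rule cg_trans[OF _ a[OF i]]) (use a' U i b in simp_all)
    qed
    have 3: "divides (modulus b i) (p \<otimes> ?m)" if "i \<in> U" "i \<preceq> n" for i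
    proof (cases "i = n")
      case True
      then show ?thesis using U succ(1) b mul_comm[of ?m p] unfolding divides_def by auto
    next
      case False
      then show ?thesis using p[of i] that U succ(1) b by (intro divides_mul) (simp_all add: less_le)
    qed
    have 4: "unit_mod (modulus b j) (p \<otimes> ?m)" if j: "j \<in> U" "S n \<preceq> j" "j \<prec> x" for j
    proof (rule unit_mod_mul)
      have nj: "n \<prec> j" using j succ(1) by (simp add: less_iff_le)
      then show "unit_mod (modulus b j) p" using unit[of j] j succ(1) by (simp add: less_le)
      have "divides (S d) b" if "d \<in> U" "S d \<preceq> j" for d
        using d[OF that(1)] le_trans[OF that(2), of x] that j x by (simp add: less_le)
      then show "unit_mod (modulus b j) ?m" using moduli_coprime[OF nj] j succ(1) b by blast
    qed (use j succ(1) b U in simp_all)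
    show "\<exists>a\<in>U. \<exists>p\<in>U.
      (\<forall>i\<in>U. i \<prec> S n \<longrightarrow> cg (modulus b i) a (F i) \<and> divides (modulus b i) p) \<and>
      (\<forall>j\<in>U. S n \<preceq> j \<and> j \<prec> x \<longrightarrow> unit_mod (modulus b j) p)"
    proof (rule bexI[of _ a'], rule bexI[of _ "p \<otimes> ?m"], intro conjI ballI impI)
      fix i assume i: "i \<in> U" "i \<prec> S n"
      then have "i \<preceq> n" using succ(1) by simp
      then show "cg (modulus b i) a' (F i)" using 1 2 i succ(1) by (cases "i = n") (auto simp: less_le)
      show "divides (modulus b i) (p \<otimes> ?m)" using 3 i \<open>i \<preceq> n\<close> by blast
    qed (use 4 a' U succ(1) b in auto)
  qed
qed

text \<open>This replaces the factorial and the maximum in the usual choice of \<open>b\<close> for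
  the beta function. At stage \<open>n\<close> the factor \<open>S n\<close> adds a divisor and the
  factor \<open>S (F n)\<close> makes the product dominate the new value; that domination is where
  \<open>b\<close> being nonzero enters.\<close>

lemma ex_common_multiple:
  assumes F: "dterm M (\<lambda>e. F (e 0))" and x: "x \<in> U"
  shows "\<exists>b\<in>U. b \<noteq> \<zero> \<and> (\<forall>d\<in>U. d \<prec> x \<longrightarrow> divides (S d) b \<and> F d \<preceq> b)"
  using x
proof (induction rule: dinduct)
  case dpred
  show ?case by (intro dintros dpred_le dpred_divides dterm_comp1[OF F]) simp_all
next
  case zero
  show ?case by (rule bexI[of _ "S \<zero>"]) simp_all
next
  case (succ n)
  have Fn [simp]: "F i \<in> U" if "i \<in> U" for i using F that by (rule dterm_closed1)
  obtain b where b: "b \<in> U" "b \<noteq> \<zero>"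
    and d: "\<And>d. d \<in> U \<Longrightarrow> d \<prec> n \<Longrightarrow> divides (S d) b \<and> F d \<preceq> b"
    using succ by auto
  define b' where "b' = b \<otimes> (S n \<otimes> S (F n))"
  obtain c where c: "c \<in> U" "b = S c" using b by (auto elim: S_cases)
  have b': "b' \<in> U" "b' = S n \<otimes> (b \<otimes> S (F n))"
    unfolding b'_def using b succ(1) by (simp_all del: mul_S mul_S_left add: mul_lcomm)
  have le: "b \<preceq> b'"
    using mul_mono[of b b "S \<zero>" "S n \<otimes> S (F n)"] b(1) succ(1) by (simp add: b'_def)
  have "F n \<preceq> S n \<otimes> S (F n)"
    using mul_mono[of "S \<zero>" "S n" "F n" "S (F n)"] b succ(1) by simp
  then have Fn': "F n \<preceq> b'"
    using mul_mono[of "S \<zero>" b "F n" "S n \<otimes> S (F n)"] b c succ(1) by (simp add: b'_def)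
  have "divides (S i) b' \<and> F i \<preceq> b'" if "i \<in> U" "i \<prec> S n" for i
  proof (cases "i = n")
    case True
    then show ?thesis using b b' succ(1) Fn' unfolding divides_def by auto
  next
    case False
    moreover have "i \<preceq> n" using that succ(1) by simp
    ultimately have "i \<prec> n" using that succ(1) by (simp add: less_le)
    then show ?thesis
      using d[OF that(1)] le_trans[OF _ le, of "F i"] divides_mul[of "S i" b "S n \<otimes> S (F n)"] that b b' succ(1)
      by (simp add: b'_def)
  qed
  moreover have "b' \<noteq> \<zero>" using le b' c by auto
  ultimately show ?case using b' by blast
qed

definition beta where
  "beta c i y \<longleftrightarrow> (\<exists>a\<in>U. \<exists>b\<in>U. \<exists>q\<in>U. c = pr a b \<and> a = q \<otimes> modulus b i \<oplus> y \<and> y \<prec> modulus b i)"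

lemma dpred_beta: "dterm M r \<Longrightarrow> dterm M s \<Longrightarrow> dterm M t \<Longrightarrow> dpred M (\<lambda>e. beta (r e) (s e) (t e))"
  by (rule dpred_comp3[where P=beta], unfold beta_def, intro dintros dterm_pr)

lemma beta_unique:
  assumes "beta c i y" "beta c i y'" and U: "i \<in> U" "y \<in> U" "y' \<in> U"
  shows "y = y'"
proof -
  obtain a b q where 1: "a \<in> U" "b \<in> U" "q \<in> U" "c = pr a b" "a = q \<otimes> modulus b i \<oplus> y" "y \<prec> modulus b i"
    using assms(1) unfolding beta_def by blast
  obtain a' b' q' where 2: "a' \<in> U" "b' \<in> U" "q' \<in> U" "c = pr a' b'"
      "a' = q' \<otimes> modulus b' i \<oplus> y'" "y' \<prec> modulus b' i"
    using assms(2) unfolding beta_def by blast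
  have "a' = a" "b' = b" using 1(1,2,4) 2(1,2,4) by simp_all
  then show ?thesis using div_unique[of q "modulus b i" y q' y'] 1 2 U
    by (metis closed(2,4))
qed

text \<open>Goedel's beta lemma. Chinese remaindering makes \<open>a\<close> congruent to each
  \<open>F i\<close>, and since \<open>F i\<close> is at most \<open>b\<close>, hence below the
  modulus, uniqueness of remainders turns the congruence into \<open>beta\<close>.\<close>

lemma comprehension:
  assumes F: "dterm M (\<lambda>e. F (e 0))" and x: "x \<in> U"
  shows "\<exists>c\<in>U. \<forall>i\<in>U. i \<prec> x \<longrightarrow> beta c i (F i)"
proof -
  have Fn [simp]: "F i \<in> U" if "i \<in> U" for i using F that by (rule dterm_closed1)
  obtain b where b: "b \<in> U" "\<And>d. d \<in> U \<Longrightarrow> d \<prec> x \<Longrightarrow> divides (S d) b \<and> F d \<preceq> b"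
    using ex_common_multiple[OF F x] by blast
  then obtain a where a: "a \<in> U" "\<And>i. i \<in> U \<Longrightarrow> i \<prec> x \<Longrightarrow> cg (modulus b i) a (F i)"
    using crt[OF F x x b(1)] x by (auto simp: less_iff_le)
  have "beta (pr a b) i (F i)" if i: "i \<in> U" "i \<prec> x" for i
  proof -
    have "b \<preceq> S i \<otimes> b" using b i by simp
    then have Fi: "F i \<prec> modulus b i" using b i le_trans[of "F i" b "S i \<otimes> b"] by simp
    obtain q r where qr: "q \<in> U" "r \<in> U" "a = q \<otimes> modulus b i \<oplus> r" "r \<prec> modulus b i"
      using ex_div[of a "S i \<otimes> b"] a b i by auto
    obtain s t where st: "s \<in> U" "t \<in> U" "a \<oplus> s \<otimes> modulus b i = F i \<oplus> t \<otimes> modulus b i"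
      using a(2)[OF i] unfolding cg_def by blast
    have "(q \<oplus> s) \<otimes> modulus b i \<oplus> r = a \<oplus> s \<otimes> modulus b i"
      unfolding qr(3) using qr(1,2) st(1) b i by (simp add: distrib_right a_ac del: mul_S mul_S_left)
    also have "\<dots> = t \<otimes> modulus b i \<oplus> F i"
      unfolding st(3) using st b i by (simp add: add_comm del: mul_S mul_S_left)
    finally have "r = F i" by (rule div_unique) (use qr st Fi b i in \<open>simp_all del: less_S_iff\<close>)
    then show ?thesis using qr a b i unfolding beta_def by blast
  qed
  then show ?thesis using a b by (intro bexI[of _ "pr a b"]) simp_all
qed

text \<open>Entries of the coded sequence as a total function, with zero for a missing entry, so
  that it can be a \<open>dterm\<close>.\<close>

definition bt where
  "bt c i = (if \<exists>y\<in>U. beta c i y then THE y. y \<in> U \<and> beta c i y else \<zero>)"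

lemma bt_eqI: assumes "beta c i y" "i \<in> U" "y \<in> U" shows "bt c i = y"
proof -
  have "(THE y. y \<in> U \<and> beta c i y) = y"
    using assms beta_unique by (intro the_equality) blast+
  then show ?thesis using assms unfolding bt_def by auto
qed

lemma bt_closed: "i \<in> U \<Longrightarrow> bt c i \<in> U"
  using bt_eqI[of c i] by (cases "\<exists>y\<in>U. beta c i y") (auto, simp add: bt_def)

lemma dterm_bt: "dterm M s \<Longrightarrow> dterm M t \<Longrightarrow> dterm M (\<lambda>e. bt (s e) (t e))"
proof (rule dterm_comp2[where F=bt], rule dterm_graph)
  have "dpred M (\<lambda>e. beta (e (Suc 0)) (e (Suc (Suc 0))) (e 0) \<or>
      e 0 = \<zero> \<and> \<not> (\<exists>y\<in>U. beta (e (Suc 0)) (e (Suc (Suc 0))) y))"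
    by (intro dintros dpred_beta) simp_all
  then show "dpred M (\<lambda>e. e 0 = bt (e (Suc 0)) (e (Suc (Suc 0))))"
  proof (rule dpred_cong)
    fix e :: "nat \<Rightarrow> 'a" assume "range e \<subseteq> U"
    then have "e 0 \<in> U" "e (Suc (Suc 0)) \<in> U" by (auto simp: image_subset_iff)
    then show "(beta (e (Suc 0)) (e (Suc (Suc 0))) (e 0) \<or>
      e 0 = \<zero> \<and> \<not> (\<exists>y\<in>U. beta (e (Suc 0)) (e (Suc (Suc 0))) y)) =
      (e 0 = bt (e (Suc 0)) (e (Suc (Suc 0))))"
    proof (cases "\<exists>y\<in>U. beta (e (Suc 0)) (e (Suc (Suc 0))) y")
      case True
      then show ?thesis using bt_eqI \<open>e 0 \<in> U\<close> \<open>e (Suc (Suc 0)) \<in> U\<close> by metis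
    next
      case False
      then show ?thesis using \<open>e 0 \<in> U\<close> by (auto simp: bt_def)
    qed
  qed
qed (auto simp: image_subset_iff bt_closed)

subsection \<open>Recursion\<close>

text \<open>Course-of-values recursion with two recursive calls, enough for a binary connective. The
  guards \<open>p x \<prec> x\<close> and \<open>q x \<prec> x\<close> make the equation meaningful
  for arbitrary \<open>p\<close> and \<open>q\<close>. The solution is read off coded
  approximations, which agree wherever both are defined and can be extended by
  \<open>comprehension\<close>.\<close>

lemma recursion:
  assumes G: "dterm M (\<lambda>e. G (e 0) (e (Suc 0)) (e (Suc (Suc 0))))"
    and p: "dterm M (\<lambda>e. p (e 0))" and q: "dterm M (\<lambda>e. q (e 0))"
  shows "\<exists>F. dterm M (\<lambda>e. F (e 0)) \<and> (\<forall>x\<in>U. F x =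
    G x (if p x \<prec> x then F (p x) else \<zero>) (if q x \<prec> x then F (q x) else \<zero>))"
proof -
  define step where "step c x =
    G x (if p x \<prec> x then bt c (p x) else \<zero>) (if q x \<prec> x then bt c (q x) else \<zero>)" for c x
  have [simp]: "p x \<in> U" "q x \<in> U" if "x \<in> U" for x
    using p q that by (blast intro: dterm_closed1)+
  have step: "dterm M (\<lambda>e. step (s e) (t e))" if "dterm M s" "dterm M t" for s t
    unfolding step_def
    by (intro dterm_comp3[OF G] dintros dterm_bt dterm_comp1[OF p] dterm_comp1[OF q] that) simp_all
  define ok where "ok c x \<longleftrightarrow> (\<forall>i\<in>U. i \<preceq> x \<longrightarrow> bt c i = step c i)" for c x
  have dok: "dpred M (\<lambda>e. ok (s e) (t e))" if "dterm M s" "dterm M t" for s t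
    by (rule dpred_comp2[where P=ok, OF _ that], unfold ok_def, intro dintros dpred_le dterm_bt step)
  have step_cong: "step c i = step c' i"
    if "i \<in> U" "\<And>j. j \<in> U \<Longrightarrow> j \<prec> i \<Longrightarrow> bt c j = bt c' j" for c c' i
    using that unfolding step_def by simp
  have step_closed: "step c i \<in> U" if "c \<in> U" "i \<in> U" for c i
    using step[OF dterm_const[OF that(1)] dterm_var[OF is_struct]] that(2) by (rule dterm_closed1)
  have unique: "i \<preceq> x \<and> i \<preceq> x' \<longrightarrow> bt c i = bt c' i"
    if "i \<in> U" and c: "ok c x" "ok c' x'" and U: "c \<in> U" "c' \<in> U" "x \<in> U" "x' \<in> U" for c c' x x' i
    using that(1)
  proof (induction rule: less_induct)
    case dpred
    show ?case by (intro dintros dpred_le dterm_bt) (use U in simp_all)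
  next
    case (less i)
    show ?case
    proof
      assume i: "i \<preceq> x \<and> i \<preceq> x'"
      have "bt c j = bt c' j" if "j \<in> U" "j \<prec> i" for j
        using less(2)[OF that] le_trans[of j i x] le_trans[of j i x'] that less(1) U i
        by (simp add: less_le)
      then show "bt c i = bt c' i" using step_cong[of i c c'] less(1) c i unfolding ok_def by simp
    qed
  qed
  have extend: "\<exists>c'\<in>U. ok c' x"
    \<comment> \<open>Correctness is demanded strictly below \<open>x\<close> only; so the base
      case, \<open>x\<close> being zero, holds vacuously, and the successor case supplies exactly
      this.\<close>
    if c: "c \<in> U" "\<And>i. i \<in> U \<Longrightarrow> i \<prec> x \<Longrightarrow> bt c i = step c i" and x: "x \<in> U" for c x
  proof -
    define F where "F i = (if i \<prec> x then bt c i else step c x)" for i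
    have "dterm M (\<lambda>e. F (e 0))"
      unfolding F_def by (intro dintros dterm_bt step) (use c x in simp_all)
    from comprehension[OF this, of "S x"] x
    obtain c' where c': "c' \<in> U" "\<And>i. i \<in> U \<Longrightarrow> i \<preceq> x \<Longrightarrow> beta c' i (F i)" by auto
    have "F i \<in> U" if "i \<in> U" for i
      using that c x by (simp add: F_def bt_closed step_closed)
    then have bt: "bt c' i = F i" if "i \<in> U" "i \<preceq> x" for i
      using c'(2)[OF that] that by (simp add: bt_eqI)
    have same: "bt c' i = bt c i" if "i \<in> U" "i \<prec> x" for i
      using bt[of i] that x by (simp add: F_def less_le)
    have "bt c' i = step c' i" if i: "i \<in> U" "i \<preceq> x" for i
    proof -
      have "step c' i = step c i"
        using i x by (intro step_cong same) (auto intro: less_le_trans)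
      moreover have "F i = step c i" using c(2) i x by (auto simp: F_def le_less)
      ultimately show ?thesis using bt[OF i] by simp
    qed
    then show ?thesis using c' unfolding ok_def by blast
  qed
  have ex: "\<exists>c\<in>U. ok c x" if "x \<in> U" for x
    using that
  proof (induction rule: dinduct)
    case dpred
    show ?case by (intro dintros dok)
  next
    case zero
    show ?case using extend[of \<zero> \<zero>] by simp
  next
    case (succ x)
    then obtain c where "c \<in> U" "ok c x" by blast
    then show ?case using extend[of c "S x"] succ(1) unfolding ok_def by simp
  qed
  \<comment> \<open>By \<open>unique\<close> the choice of the approximation does not affect the
    value, which is why the graph of \<open>F\<close> can be defined with a plain existential
    quantifier.\<close>
  define F where "F x = bt (SOME c. c \<in> U \<and> ok c x) x" for x
  have F: "F x = bt c x" if "x \<in> U" "c \<in> U" "ok c x" for c x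
  proof -
    let ?d = "SOME c. c \<in> U \<and> ok c x"
    have "?d \<in> U \<and> ok ?d x" using someI_ex[of "\<lambda>c. c \<in> U \<and> ok c x"] that by blast
    then show ?thesis using unique[of x ?d x c x] that unfolding F_def by simp
  qed
  have "dterm M (\<lambda>e. F (e 0))"
  proof (rule dterm_graph)
    have "dpred M (\<lambda>e. \<exists>c\<in>U. ok c (e (Suc 0)) \<and> e 0 = bt c (e (Suc 0)))"
      by (intro dintros dok dterm_bt)
    then show "dpred M (\<lambda>e. e 0 = F (e (Suc 0)))"
    proof (rule dpred_cong)
      fix e :: "nat \<Rightarrow> 'a" assume "range e \<subseteq> U"
      then have x: "e (Suc 0) \<in> U" by auto
      then obtain c where "c \<in> U" "ok c (e (Suc 0))" using ex by blast
      then show "(\<exists>c\<in>U. ok c (e (Suc 0)) \<and> e 0 = bt c (e (Suc 0))) = (e 0 = F (e (Suc 0)))"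
        using F[OF x] by metis
    qed
  qed (auto simp: F_def image_subset_iff bt_closed)
  moreover have "F x = G x (if p x \<prec> x then F (p x) else \<zero>) (if q x \<prec> x then F (q x) else \<zero>)"
    if x: "x \<in> U" for x
  proof -
    obtain c where c: "c \<in> U" "ok c x" using ex[OF x] by blast
    have "F y = bt c y" if "y \<in> U" "y \<prec> x" for y
    proof (rule F[OF that(1) c(1)])
      show "ok c y" using c(2) that x le_trans[of _ y x] unfolding ok_def by (simp add: less_le)
    qed
    then have "step c x = G x (if p x \<prec> x then F (p x) else \<zero>) (if q x \<prec> x then F (q x) else \<zero>)"
      using x by (simp add: step_def)
    then show ?thesis using F[OF x c] c(2) x unfolding ok_def by simp
  qed
  ultimately show ?thesis by blast
qed

end

lemma case_nat_literal:
  "case_nat a f (0::nat) = a" "case_nat a f (1::nat) = f 0" "case_nat a f (2::nat) = f 1"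
  "case_nat a f (3::nat) = f 2" "case_nat a f (4::nat) = f 3"
  by (simp_all add: eval_nat_numeral)

lemma not_Bex: "(\<not> (\<exists>x\<in>A. P x)) \<longleftrightarrow> (\<forall>x\<in>A. \<not> P x)"
  by blast

lemma not_Ball: "(\<not> (\<forall>x\<in>A. P x)) \<longleftrightarrow> (\<exists>x\<in>A. \<not> P x)"
  by blast

lemma eval_sh1': "eval M (case_nat x e) (sh 1 t) = eval M e t"
  by simp

text \<open>Conjunction, implication and \<open>All\<close> are abbreviations built from
  \<open>Neg\<close>, \<open>Or\<close> and \<open>Ex\<close>; the De Morgan equations restore their
  semantic form.\<close>

lemmas sat_unfold = sat.simps eval.simps case_nat_literal eval_sh1' eval_sh2 eval_sh3 eval_sh4
  de_Morgan_disj de_Morgan_conj not_not not_Bex not_Ball simp_thms(6)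

context peano
begin

section \<open>Arithmetized syntax\<close>

text \<open>The formulae of the arithmetized syntax contain no \<open>Tr\<close>, so with
  \<open>T\<close> left open one computation of their meaning serves both truth predicates that are
  to be compared.\<close>

abbreviation with_truth where "with_truth T \<equiv> M\<lparr>truth := T\<rparr>"

lemma eval_with_truth [simp]: "eval (with_truth T) e t = eval M e t"
  by (induction t) simp_all

lemma with_truth_simps:
  "univ (with_truth T) = U" "zero (with_truth T) = \<zero>" "succ (with_truth T) = S"
  "add (with_truth T) = add M" "mul (with_truth T) = mul M" "less (with_truth T) = less M"
  "truth (with_truth T) = T" "eval (with_truth T) e t = eval M e t"
  by simp_all

definition num where "num k = (S ^^ k) \<zero>"

lemma num_closed [simp]: "num k \<in> U"
  unfolding num_def by (induction k) simp_all

lemma num_eq_iff [simp]: "num j = num k \<longleftrightarrow> j = k"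
proof (induction j arbitrary: k)
  case 0
  show ?case using num_closed unfolding num_def by (cases k) simp_all
next
  case (Suc j)
  then show ?case using num_closed unfolding num_def by (cases k) simp_all
qed

lemma num_Suc: "num (Suc k) = S (num k)"
  by (simp add: num_def)

lemma eval_num [simp]: "eval M e ((Succ ^^ k) Zero) = num k"
  unfolding num_def by (induction k) simp_all

text \<open>The relations from here on mirror the formulae literally, with pairing as an equation
  and not through \<open>pr\<close>. The \<open>sat\<close> equations thus hold for all assignments;
  elements of the universe are required only when passing to \<open>pr\<close>.\<close>

definition P3 where "P3 x y z \<longleftrightarrow> z \<oplus> z = (x \<oplus> y) \<otimes> S (x \<oplus> y) \<oplus> (x \<oplus> x)"
definition B3 where "B3 c i y \<longleftrightarrow>
  (\<exists>a\<in>U. \<exists>b\<in>U. \<exists>q\<in>U. P3 a b c \<and> a = q \<otimes> S (S i \<otimes> b) \<oplus> y \<and> y \<prec> S (S i \<otimes> b))"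
definition earlier where "earlier c j w \<longleftrightarrow> (\<exists>i\<in>U. i \<prec> j \<and> B3 c i w)"
definition earlier2 where "earlier2 c j u v \<longleftrightarrow> (\<exists>w\<in>U. P3 u v w \<and> earlier c j w)"
definition earlier3 where "earlier3 c j u v w \<longleftrightarrow> (\<exists>x\<in>U. P3 v w x \<and> earlier2 c j u x)"
definition deriv where "deriv R w \<longleftrightarrow> (\<exists>c\<in>U. \<exists>j\<in>U. B3 c j w \<and>
  (\<forall>i\<in>U. \<forall>y\<in>U. i \<prec> S j \<and> B3 c i y \<longrightarrow> R c i y))"
definition node1 where "node1 k x z \<longleftrightarrow> P3 (num k) x z"
definition node2 where "node2 k x y z \<longleftrightarrow> (\<exists>w\<in>U. P3 x y w \<and> node1 k w z)"
definition triple where "triple x y z w \<longleftrightarrow> (\<exists>v\<in>U. P3 y z v \<and> P3 x v w)"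

lemma P3_iff: "x \<in> U \<Longrightarrow> y \<in> U \<Longrightarrow> z \<in> U \<Longrightarrow> P3 x y z \<longleftrightarrow> z = pr x y"
  by (simp only: pr_eq_iff(1) P3_def)

lemma sat_pairF [simp]:
  "sat (with_truth T) e (pairF x y z) \<longleftrightarrow> P3 (eval M e x) (eval M e y) (eval M e z)"
  unfolding pairF_def P3_def by simp

lemma sat_betaF [simp]:
  "sat (with_truth T) e (betaF c i y) \<longleftrightarrow> B3 (eval M e c) (eval M e i) (eval M e y)"
  unfolding betaF_def B3_def Let_def
  by (simp only: sat_unfold sat_pairF with_truth_simps)

lemma sat_earlierF [simp]:
  "sat (with_truth T) e (earlierF c j w) \<longleftrightarrow> earlier (eval M e c) (eval M e j) (eval M e w)"
  unfolding earlierF_def earlier_def by simp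

lemma sat_earlier2F [simp]: "sat (with_truth T) e (earlier2F c j u v) \<longleftrightarrow>
    earlier2 (eval M e c) (eval M e j) (eval M e u) (eval M e v)"
  unfolding earlier2F_def earlier2_def by simp

lemma sat_earlier3F [simp]: "sat (with_truth T) e (earlier3F c j u v w) \<longleftrightarrow>
    earlier3 (eval M e c) (eval M e j) (eval M e u) (eval M e v) (eval M e w)"
  unfolding earlier3F_def earlier3_def by simp

lemma sat_node1F [simp]:
  "sat (with_truth T) e (node1F k x z) \<longleftrightarrow> node1 k (eval M e x) (eval M e z)"
  unfolding node1F_def node1_def by simp

lemma sat_node2F [simp]: "sat (with_truth T) e (node2F k x y z) \<longleftrightarrow>
    node2 k (eval M e x) (eval M e y) (eval M e z)"
  unfolding node2F_def node2_def by simp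

lemma sat_tripleF [simp]: "sat (with_truth T) e (tripleF x y z w) \<longleftrightarrow>
    triple (eval M e x) (eval M e y) (eval M e z) (eval M e w)"
  unfolding tripleF_def triple_def by simp

lemma sat_derivF:
  assumes "\<And>e p c i y. sat (with_truth T) e (K p c i y) \<longleftrightarrow>
    R (eval M e p) (eval M e c) (eval M e i) (eval M e y)"
  shows "sat (with_truth T) e (derivF K p w) \<longleftrightarrow> deriv (R (eval M e p)) (eval M e w)"
  unfolding derivF_def deriv_def
  by (simp only: sat_unfold assms sat_betaF with_truth_simps imp_conv_disj)

definition term_rule where
  "term_rule n c j t \<longleftrightarrow> (\<exists>i\<in>U. i \<prec> n \<and> node1 0 i t) \<or> node1 1 \<zero> t \<or>
     (\<exists>u\<in>U. earlier c j u \<and> node1 2 u t) \<or>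
     (\<exists>u\<in>U. \<exists>v\<in>U. earlier c j u \<and> earlier c j v \<and> (node2 3 u v t \<or> node2 4 u v t))"

lemma sat_termF [simp]:
  "sat (with_truth T) e (termF n t) \<longleftrightarrow> deriv (term_rule (eval M e n)) (eval M e t)"
  unfolding termF_def
  by (rule sat_derivF) (simp only: term_rule_def sat_unfold sat_earlierF sat_node1F sat_node2F
      with_truth_simps conj_assoc)

definition formula_rule where
  "formula_rule n c j \<phi> \<longleftrightarrow>
     (\<exists>s\<in>U. \<exists>t\<in>U. deriv (term_rule n) s \<and> deriv (term_rule n) t \<and> (node2 5 s t \<phi> \<or> node2 6 s t \<phi>)) \<or>
     (\<exists>\<psi>\<in>U. earlier2 c j n \<psi> \<and> node1 7 \<psi> \<phi>) \<or>
     (\<exists>\<psi>\<in>U. \<exists>\<chi>\<in>U. earlier2 c j n \<psi> \<and> earlier2 c j n \<chi> \<and> node2 8 \<psi> \<chi> \<phi>) \<or>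
     (\<exists>\<psi>\<in>U. earlier2 c j (S n) \<psi> \<and> node1 9 \<psi> \<phi>)"

definition formula where
  "formula n \<phi> \<longleftrightarrow> (\<exists>w\<in>U. P3 n \<phi> w \<and>
     deriv (\<lambda>c j y. \<exists>n\<in>U. \<exists>\<phi>\<in>U. P3 n \<phi> y \<and> formula_rule n c j \<phi>) w)"

lemma sat_formF [simp]:
  "sat (with_truth T) e (formF n \<phi>) \<longleftrightarrow> formula (eval M e n) (eval M e \<phi>)"
proof -
  have "sat (with_truth T) e (derivF (\<lambda>_ c j y. Ex (Ex (pairF (Var 1) (Var 0) (sh 2 y) \<^bold>\<and>
      form_rule (Var 1) (sh 2 c) (sh 2 j) (Var 0)))) Zero w) \<longleftrightarrow>
      deriv ((\<lambda>_ c j y. \<exists>n\<in>U. \<exists>\<phi>\<in>U. P3 n \<phi> y \<and> formula_rule n c j \<phi>) (eval M e Zero)) (eval M e w)" for e w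
    by (rule sat_derivF) (simp only: form_rule_def formula_rule_def sat_unfold with_truth_simps sat_pairF sat_tripleF
        sat_node1F sat_node2F sat_earlier2F sat_earlier3F sat_termF conj_assoc)
  then show ?thesis
    unfolding formF_def formula_def
    by (simp only: sat_unfold with_truth_simps sat_pairF sat_tripleF)
qed

definition value_rule where
  "value_rule t c j x \<longleftrightarrow> node1 1 \<zero> t \<and> x = \<zero> \<or>
     (\<exists>u\<in>U. \<exists>v\<in>U. earlier2 c j u v \<and> node1 2 u t \<and> x = S v) \<or>
     (\<exists>u\<in>U. \<exists>v\<in>U. \<exists>u'\<in>U. \<exists>v'\<in>U. earlier2 c j u v \<and> earlier2 c j u' v' \<and>
        (node2 3 u u' t \<and> x = v \<oplus> v' \<or> node2 4 u u' t \<and> x = v \<otimes> v'))"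

definition has_value where
  "has_value t x \<longleftrightarrow> (\<exists>w\<in>U. P3 t x w \<and>
     deriv (\<lambda>c j y. \<exists>t\<in>U. \<exists>x\<in>U. P3 t x y \<and> value_rule t c j x) w)"

lemma sat_valF [simp]:
  "sat (with_truth T) e (valF t x) \<longleftrightarrow> has_value (eval M e t) (eval M e x)"
proof -
  have "sat (with_truth T) e (derivF (\<lambda>_ c j y. Ex (Ex (pairF (Var 1) (Var 0) (sh 2 y) \<^bold>\<and>
      val_rule (Var 1) (sh 2 c) (sh 2 j) (Var 0)))) Zero w) \<longleftrightarrow>
      deriv ((\<lambda>_ c j y. \<exists>t\<in>U. \<exists>x\<in>U. P3 t x y \<and> value_rule t c j x) (eval M e Zero)) (eval M e w)" for e w
    by (rule sat_derivF) (simp only: val_rule_def value_rule_def sat_unfold with_truth_simps sat_pairF sat_tripleF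
        sat_node1F sat_node2F sat_earlier2F sat_earlier3F sat_termF conj_assoc)
  then show ?thesis
    unfolding valF_def has_value_def
    by (simp only: sat_unfold with_truth_simps sat_pairF sat_tripleF)
qed

definition numeral_step where
  "numeral_step x c j t \<longleftrightarrow> x = \<zero> \<and> node1 1 \<zero> t \<or>
     (\<exists>u\<in>U. \<exists>v\<in>U. earlier2 c j u v \<and> x = S u \<and> node1 2 v t)"

definition is_numeral where
  "is_numeral x t \<longleftrightarrow> (\<exists>w\<in>U. P3 x t w \<and>
     deriv (\<lambda>c j y. \<exists>x\<in>U. \<exists>t\<in>U. P3 x t y \<and> numeral_step x c j t) w)"

lemma sat_numeralF [simp]:
  "sat (with_truth T) e (numeralF x t) \<longleftrightarrow> is_numeral (eval M e x) (eval M e t)"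
proof -
  have "sat (with_truth T) e (derivF (\<lambda>_ c j y. Ex (Ex (pairF (Var 1) (Var 0) (sh 2 y) \<^bold>\<and>
      numeral_rule (Var 1) (sh 2 c) (sh 2 j) (Var 0)))) Zero w) \<longleftrightarrow>
      deriv ((\<lambda>_ c j y. \<exists>x\<in>U. \<exists>t\<in>U. P3 x t y \<and> numeral_step x c j t) (eval M e Zero)) (eval M e w)" for e w
    by (rule sat_derivF) (simp only: numeral_rule_def numeral_step_def sat_unfold with_truth_simps sat_pairF sat_tripleF
        sat_node1F sat_node2F sat_earlier2F sat_earlier3F sat_termF conj_assoc)
  then show ?thesis
    unfolding numeralF_def is_numeral_def
    by (simp only: sat_unfold with_truth_simps sat_pairF sat_tripleF)
qed

definition subst_step where
  "subst_step r d c j x x' \<longleftrightarrow> node1 0 d x \<and> x' = r \<or>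
     (\<exists>i\<in>U. \<not> i = d \<and> node1 0 i x \<and> x' = x) \<or>
     node1 1 \<zero> x \<and> x' = x \<or>
     (\<exists>u\<in>U. \<exists>u'\<in>U. earlier3 c j d u u' \<and>
        (node1 2 u x \<and> node1 2 u' x' \<or> node1 7 u x \<and> node1 7 u' x')) \<or>
     (\<exists>u\<in>U. \<exists>u'\<in>U. \<exists>v\<in>U. \<exists>v'\<in>U. earlier3 c j d u u' \<and> earlier3 c j d v v' \<and>
        (node2 3 u v x \<and> node2 3 u' v' x' \<or> node2 4 u v x \<and> node2 4 u' v' x' \<or>
         node2 5 u v x \<and> node2 5 u' v' x' \<or> node2 6 u v x \<and> node2 6 u' v' x' \<or>
         node2 8 u v x \<and> node2 8 u' v' x')) \<or>
     (\<exists>u\<in>U. \<exists>u'\<in>U. earlier3 c j (S d) u u' \<and> node1 9 u x \<and> node1 9 u' x')"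

definition replaces where
  "replaces r d x x' \<longleftrightarrow> (\<exists>w\<in>U. triple d x x' w \<and>
     deriv (\<lambda>c j y. \<exists>d\<in>U. \<exists>x\<in>U. \<exists>x'\<in>U. triple d x x' y \<and> subst_step r d c j x x') w)"

lemma sat_substF [simp]: "sat (with_truth T) e (substF r d x x') \<longleftrightarrow>
    replaces (eval M e r) (eval M e d) (eval M e x) (eval M e x')"
proof -
  have "sat (with_truth T) e (derivF (\<lambda>r c j y. Ex (Ex (Ex (tripleF (Var 2) (Var 1) (Var 0) (sh 3 y) \<^bold>\<and>
      subst_rule (sh 3 r) (Var 2) (sh 3 c) (sh 3 j) (Var 1) (Var 0))))) r w) \<longleftrightarrow>
      deriv ((\<lambda>r c j y. \<exists>d\<in>U. \<exists>x\<in>U. \<exists>x'\<in>U. triple d x x' y \<and> subst_step r d c j x x') (eval M e r)) (eval M e w)" for e w and r :: tm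
    by (rule sat_derivF) (simp only: subst_rule_def subst_step_def sat_unfold with_truth_simps sat_pairF sat_tripleF
        sat_node1F sat_node2F sat_earlier2F sat_earlier3F sat_termF conj_assoc)
  then show ?thesis
    unfolding substF_def replaces_def
    by (simp only: sat_unfold with_truth_simps sat_pairF sat_tripleF)
qed

text \<open>The meaning of \<open>Tarski\<close> as a condition on a predicate \<open>T\<close>,
  applicable both to \<open>truth M\<close> and to a predicate pulled back from elsewhere.\<close>

definition tarski where
  "tarski T \<longleftrightarrow>
     (\<forall>x\<in>U. T x \<longrightarrow> formula \<zero> x) \<and>
     (\<forall>s\<in>U. \<forall>t\<in>U. \<forall>x\<in>U. deriv (term_rule \<zero>) s \<and> deriv (term_rule \<zero>) t \<and> node2 5 s t x \<longrightarrow>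
        (T x \<longleftrightarrow> (\<exists>u\<in>U. \<exists>v\<in>U. has_value s u \<and> has_value t v \<and> u = v))) \<and>
     (\<forall>s\<in>U. \<forall>t\<in>U. \<forall>x\<in>U. deriv (term_rule \<zero>) s \<and> deriv (term_rule \<zero>) t \<and> node2 6 s t x \<longrightarrow>
        (T x \<longleftrightarrow> (\<exists>u\<in>U. \<exists>v\<in>U. has_value s u \<and> has_value t v \<and> u \<prec> v))) \<and>
     (\<forall>y\<in>U. \<forall>x\<in>U. formula \<zero> y \<and> node1 7 y x \<longrightarrow> (T x \<longleftrightarrow> \<not> T y)) \<and>
     (\<forall>y\<in>U. \<forall>z\<in>U. \<forall>x\<in>U. formula \<zero> y \<and> formula \<zero> z \<and> node2 8 y z x \<longrightarrow> (T x \<longleftrightarrow> T y \<or> T z)) \<and>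
     (\<forall>y\<in>U. \<forall>x\<in>U. formula \<zero> x \<and> node1 9 y x \<longrightarrow>
        (T x \<longleftrightarrow> (\<exists>a\<in>U. \<exists>t\<in>U. \<exists>z\<in>U. is_numeral a t \<and> replaces t \<zero> y z \<and> T z)))"

lemma sat_Tarski: "sat (with_truth T) e Tarski \<longleftrightarrow> tarski T"
  unfolding Tarski_def tarski_def
  by (simp only: sat_unfold with_truth_simps sat_node1F sat_node2F sat_termF sat_formF
      sat_valF sat_numeralF sat_substF iff_conv_conj_imp imp_conv_disj conj_assoc disj_assoc)

end

context peano
begin

section \<open>Uniqueness of truth predicates\<close>

text \<open>A derivation of \<open>w\<close> restricts to a derivation of each of its earlier entries, so inversion
  needs no manipulation of codes of sequences.\<close>

lemma deriv_cases:
  assumes "deriv R w" "w \<in> U"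
  obtains c j where "c \<in> U" "j \<in> U" "R c j w" "\<And>v. v \<in> U \<Longrightarrow> earlier c j v \<Longrightarrow> deriv R v"
proof -
  obtain c j where c: "c \<in> U" "j \<in> U" "B3 c j w"
    and R: "\<And>i y. i \<in> U \<Longrightarrow> y \<in> U \<Longrightarrow> i \<preceq> j \<Longrightarrow> B3 c i y \<Longrightarrow> R c i y"
    using assms(1) unfolding deriv_def by (auto simp: less_S_iff)
  have "deriv R v" if v: "v \<in> U" "earlier c j v" for v
  proof -
    obtain i where i: "i \<in> U" "i \<prec> j" "B3 c i v" using v by (auto simp: earlier_def)
    have "k \<preceq> j" if "k \<in> U" "k \<preceq> i" for k using that i c le_trans[of k i j] by (simp add: less_le)
    then have "\<forall>k\<in>U. \<forall>y\<in>U. k \<prec> S i \<and> B3 c k y \<longrightarrow> R c k y" using R i(1) by simp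
    then show ?thesis using c i unfolding deriv_def by blast
  qed
  with c R[of j w] assms(2) show thesis by (intro that) simp_all
qed

section \<open>Projections and the depth of codes\<close>

text \<open>Zero is the value off the range of \<open>pr\<close>, which makes the projections total
  as \<open>dterm\<close> demands.\<close>

definition unpair1 where
  "unpair1 x = (if \<exists>a\<in>U. \<exists>b\<in>U. x = pr a b then THE a. a \<in> U \<and> (\<exists>b\<in>U. x = pr a b) else \<zero>)"
definition unpair2 where
  "unpair2 x = (if \<exists>a\<in>U. \<exists>b\<in>U. x = pr a b then THE b. b \<in> U \<and> (\<exists>a\<in>U. x = pr a b) else \<zero>)"

lemma unpair [simp]: assumes "a \<in> U" "b \<in> U" shows "unpair1 (pr a b) = a" "unpair2 (pr a b) = b"
proof -
  have "(THE a'. a' \<in> U \<and> (\<exists>b'\<in>U. pr a b = pr a' b')) = a"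
    "(THE b'. b' \<in> U \<and> (\<exists>a'\<in>U. pr a b = pr a' b')) = b"
    using assms by (auto intro!: the_equality)
  then show "unpair1 (pr a b) = a" "unpair2 (pr a b) = b"
    using assms unfolding unpair1_def unpair2_def by auto
qed

lemma unpair_closed: "x \<in> U \<Longrightarrow> unpair1 x \<in> U \<and> unpair2 x \<in> U"
  by (cases "\<exists>a\<in>U. \<exists>b\<in>U. x = pr a b") (auto, simp_all add: unpair1_def unpair2_def)

lemma dterm_unpair1: "dterm M s \<Longrightarrow> dterm M (\<lambda>e. unpair1 (s e))"
proof (rule dterm_comp1[where F=unpair1], rule dterm_graph)
  have "dpred M (\<lambda>e. (\<exists>b\<in>U. e (Suc 0) = pr (e 0) b) \<or>
      e 0 = \<zero> \<and> \<not> (\<exists>a\<in>U. \<exists>b\<in>U. e (Suc 0) = pr a b))"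
    by (intro dintros dterm_pr) simp_all
  then show "dpred M (\<lambda>e. e 0 = unpair1 (e (Suc 0)))"
  proof (rule dpred_cong)
    fix e :: "nat \<Rightarrow> 'a" assume "range e \<subseteq> U"
    then have U: "e 0 \<in> U" by auto
    show "((\<exists>b\<in>U. e (Suc 0) = pr (e 0) b) \<or> e 0 = \<zero> \<and> \<not> (\<exists>a\<in>U. \<exists>b\<in>U. e (Suc 0) = pr a b)) =
        (e 0 = unpair1 (e (Suc 0)))"
    proof (cases "\<exists>a\<in>U. \<exists>b\<in>U. e (Suc 0) = pr a b")
      case True
      then show ?thesis using U by auto
    qed (use U in \<open>auto simp: unpair1_def\<close>)
  qed
qed (simp add: unpair_closed image_subset_iff)

lemma dterm_unpair2: "dterm M s \<Longrightarrow> dterm M (\<lambda>e. unpair2 (s e))"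
proof (rule dterm_comp1[where F=unpair2], rule dterm_graph)
  have "dpred M (\<lambda>e. (\<exists>a\<in>U. e (Suc 0) = pr a (e 0)) \<or>
      e 0 = \<zero> \<and> \<not> (\<exists>a\<in>U. \<exists>b\<in>U. e (Suc 0) = pr a b))"
    by (intro dintros dterm_pr) simp_all
  then show "dpred M (\<lambda>e. e 0 = unpair2 (e (Suc 0)))"
  proof (rule dpred_cong)
    fix e :: "nat \<Rightarrow> 'a" assume "range e \<subseteq> U"
    then have U: "e 0 \<in> U" by auto
    show "((\<exists>a\<in>U. e (Suc 0) = pr a (e 0)) \<or> e 0 = \<zero> \<and> \<not> (\<exists>a\<in>U. \<exists>b\<in>U. e (Suc 0) = pr a b)) =
        (e 0 = unpair2 (e (Suc 0)))"
    proof (cases "\<exists>a\<in>U. \<exists>b\<in>U. e (Suc 0) = pr a b")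
      case True
      then show ?thesis using U by auto
    qed (use U in \<open>auto simp: unpair2_def\<close>)
  qed
qed (simp add: unpair_closed image_subset_iff)

lemma less_node1: "x \<in> U \<Longrightarrow> k \<noteq> 0 \<Longrightarrow> x \<prec> pr (num k) x"
  using less_pr[of "num (k - 1)" x] by (cases k) (simp_all add: num_Suc)

lemma less_node2:
  assumes "x \<in> U" "y \<in> U" "k \<noteq> 0"
  shows "x \<prec> pr (num k) (pr x y)" "y \<prec> pr (num k) (pr x y)"
proof -
  have "x \<preceq> pr x y"
    by (rule le_doubleD) (use assms in \<open>simp_all add: pr_double del: mul_S mul_S_left\<close>)
  then show "x \<prec> pr (num k) (pr x y)"
    using less_node1[of "pr x y" k] le_less_trans[of x "pr x y"] assms by simp
  show "y \<prec> pr (num k) (pr x y)"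
    using less_node1[of "pr x y" k] le_less_trans[OF le_pr, of x y] assms by simp
qed

text \<open>Codes of terms get depth zero, so that substituting numerals does not change the depth of a
  formula, although it does change its code.\<close>

lemma ex_depth:
  "\<exists>depth. dterm M (\<lambda>e. depth (e 0)) \<and>
    (\<forall>k x. k \<notin> {7, 8, 9} \<longrightarrow> x \<in> U \<longrightarrow> depth (pr (num k) x) = \<zero>) \<and>
    (\<forall>k x. k \<in> {7, 9} \<longrightarrow> x \<in> U \<longrightarrow> depth (pr (num k) x) = S (depth x)) \<and>
    (\<forall>x\<in>U. \<forall>y\<in>U. depth (pr (num 8) (pr x y)) = S (depth x \<oplus> depth y))"
proof -
  \<comment> \<open>The arguments \<open>u\<close> and \<open>v\<close> are the depths of the parts.
    A sum serves for disjunction as well as a maximum would: both disjuncts come out with smaller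
    depth.\<close>
  define G where "G x u v = (if unpair1 x = num 8 then S (u \<oplus> v)
    else if unpair1 x = num 7 \<or> unpair1 x = num 9 then S u else \<zero>)" for x u v
  \<comment> \<open>The first recursive call goes to the left disjunct under tag 8 and otherwise to
    the whole body; the second call, to \<open>unpair2 (unpair2 x)\<close>, finds the right
    disjunct.\<close>
  define p where "p x = (if unpair1 x = num 8 then unpair1 (unpair2 x) else unpair2 x)" for x
  have "dterm M (\<lambda>e. G (e 0) (e (Suc 0)) (e (Suc (Suc 0))))"
    unfolding G_def by (intro dintros dterm_unpair1) simp_all
  moreover have "dterm M (\<lambda>e. p (e 0))"
    unfolding p_def by (intro dintros dterm_unpair1 dterm_unpair2) simp_all
  moreover have "dterm M (\<lambda>e. unpair2 (unpair2 (e 0)))"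
    by (intro dintros dterm_unpair2)
  ultimately obtain F where F: "dterm M (\<lambda>e. F (e 0))" and rec: "\<And>x. x \<in> U \<Longrightarrow> F x =
    G x (if p x \<prec> x then F (p x) else \<zero>)
      (if unpair2 (unpair2 x) \<prec> x then F (unpair2 (unpair2 x)) else \<zero>)"
    using recursion[of G p "\<lambda>x. unpair2 (unpair2 x)"] by blast
  have "F (pr (num k) x) = \<zero>" if "k \<notin> {7, 8, 9}" "x \<in> U" for k x
    using that by (subst rec) (simp_all add: G_def)
  moreover have "F (pr (num k) x) = S (F x)" if "k \<in> {7, 9}" "x \<in> U" for k x
    using that less_node1[of x k] by (subst rec) (auto simp: G_def p_def)
  moreover have "F (pr (num 8) (pr x y)) = S (F x \<oplus> F y)" if "x \<in> U" "y \<in> U" for x y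
    using that less_node2[OF that, of 8] by (subst rec) (auto simp: G_def p_def)
  ultimately show ?thesis using F by blast
qed

lemma node1_iff: "x \<in> U \<Longrightarrow> z \<in> U \<Longrightarrow> node1 k x z \<longleftrightarrow> z = pr (num k) x"
  by (simp add: node1_def P3_iff)

lemma node2_iff: "x \<in> U \<Longrightarrow> y \<in> U \<Longrightarrow> z \<in> U \<Longrightarrow> node2 k x y z \<longleftrightarrow> z = pr (num k) (pr x y)"
  by (auto simp: node2_def node1_iff P3_iff)

lemma triple_iff:
  "x \<in> U \<Longrightarrow> y \<in> U \<Longrightarrow> z \<in> U \<Longrightarrow> w \<in> U \<Longrightarrow> triple x y z w \<longleftrightarrow> w = pr x (pr y z)"
  by (auto simp: triple_def P3_iff)

section \<open>Inversion of the arithmetized rules\<close>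

text \<open>Read off the last rule of a derivation, with \<open>deriv_cases\<close> making the
  premises derivable. In case \<open>ex\<close> just the code of the body is returned: the later
  induction passes to closed instances, whose being sentences is supplied by the truth
  predicates.\<close>

lemma formula_cases:
  assumes "formula n \<phi>" "n \<in> U" "\<phi> \<in> U"
  obtains (atom) k s t where "k \<in> {5, 6}" "s \<in> U" "t \<in> U" "deriv (term_rule n) s" "deriv (term_rule n) t"
      "\<phi> = pr (num k) (pr s t)"
  | (neg) \<psi> where "\<psi> \<in> U" "formula n \<psi>" "\<phi> = pr (num 7) \<psi>"
  | (disj) \<psi> \<chi> where "\<psi> \<in> U" "\<chi> \<in> U" "formula n \<psi>" "formula n \<chi>" "\<phi> = pr (num 8) (pr \<psi> \<chi>)"
  | (ex) \<psi> where "\<psi> \<in> U" "\<phi> = pr (num 9) \<psi>"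
proof -
  let ?R = "\<lambda>c j y. \<exists>n\<in>U. \<exists>\<phi>\<in>U. P3 n \<phi> y \<and> formula_rule n c j \<phi>"
  have "deriv ?R (pr n \<phi>)" using assms by (auto simp: formula_def P3_iff)
  then obtain c j where cj: "c \<in> U" "j \<in> U" "?R c j (pr n \<phi>)"
    and deriv: "\<And>v. v \<in> U \<Longrightarrow> earlier c j v \<Longrightarrow> deriv ?R v"
    by (rule deriv_cases) (use assms in simp_all)
  have form: "formula n \<psi>" if "earlier2 c j n \<psi>" "\<psi> \<in> U" for \<psi>
    using that deriv assms(2) by (auto simp: earlier2_def formula_def)
  have "formula_rule n c j \<phi>" using cj(3) assms by (auto simp: P3_iff)
  then show thesis unfolding formula_rule_def
  proof (elim disjE bexE conjE)
    fix s t assume "s \<in> U" "t \<in> U" "deriv (term_rule n) s" "deriv (term_rule n) t" "node2 5 s t \<phi>"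
    then show thesis using atom[of 5 s t] assms by (simp add: node2_iff)
  next
    fix s t assume "s \<in> U" "t \<in> U" "deriv (term_rule n) s" "deriv (term_rule n) t" "node2 6 s t \<phi>"
    then show thesis using atom[of 6 s t] assms by (simp add: node2_iff)
  next
    fix \<psi> assume "\<psi> \<in> U" "earlier2 c j n \<psi>" "node1 7 \<psi> \<phi>"
    then show thesis using neg form assms by (simp add: node1_iff)
  next
    fix \<psi> \<chi> assume "\<psi> \<in> U" "\<chi> \<in> U" "earlier2 c j n \<psi>" "earlier2 c j n \<chi>" "node2 8 \<psi> \<chi> \<phi>"
    then show thesis using disj form assms by (simp add: node2_iff)
  next
    fix \<psi> assume "\<psi> \<in> U" "node1 9 \<psi> \<phi>"
    then show thesis using ex assms by (simp add: node1_iff)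
  qed
qed

text \<open>Only the tag matters: with tag 1 or 2 a numeral has depth zero.\<close>

lemma numeral_cases:
  assumes "is_numeral x t" "x \<in> U" "t \<in> U"
  shows "\<exists>k\<in>{1, 2}. \<exists>y\<in>U. t = pr (num k) y"
proof -
  let ?R = "\<lambda>c j y. \<exists>x\<in>U. \<exists>t\<in>U. P3 x t y \<and> numeral_step x c j t"
  have "deriv ?R (pr x t)" using assms by (auto simp: is_numeral_def P3_iff)
  then obtain c j where "?R c j (pr x t)"
    by (rule deriv_cases) (use assms in simp_all)
  then have "numeral_step x c j t" using assms by (auto simp: P3_iff)
  then show ?thesis using assms by (auto simp: numeral_step_def node1_iff)
qed

text \<open>The rules are grouped by their effect on depth. Tags below 7, the terms and atomic
  formulae, go to \<open>const\<close>, where both sides have depth zero provided that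
  \<open>r\<close> has. The index in \<open>unary\<close> is a fresh \<open>d'\<close> because it
  rises under a quantifier.\<close>

lemma replaces_cases:
  assumes "replaces r d x x'" and U: "r \<in> U" "d \<in> U" "x \<in> U" "x' \<in> U"
  obtains (const) k k' y y' where "k < 7" "x' = r \<or> x' = x \<or> x' = pr (num k') y'" "k' < 7"
      "y \<in> U" "y' \<in> U" "x = pr (num k) y"
  | (unary) k d' u u' where "k \<in> {7, 9}" "d' \<in> U" "u \<in> U" "u' \<in> U" "replaces r d' u u'"
      "x = pr (num k) u" "x' = pr (num k) u'"
  | (binary) u v u' v' where "u \<in> U" "u' \<in> U" "v \<in> U" "v' \<in> U" "replaces r d u u'" "replaces r d v v'"
      "x = pr (num 8) (pr u v)" "x' = pr (num 8) (pr u' v')"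
proof -
  let ?R = "\<lambda>c j y. \<exists>d\<in>U. \<exists>x\<in>U. \<exists>x'\<in>U. triple d x x' y \<and> subst_step r d c j x x'"
  have "deriv ?R (pr d (pr x x'))" using assms by (auto simp: replaces_def triple_iff)
  then obtain c j where cj: "c \<in> U" "j \<in> U" "?R c j (pr d (pr x x'))"
    and deriv: "\<And>v. v \<in> U \<Longrightarrow> earlier c j v \<Longrightarrow> deriv ?R v"
    by (rule deriv_cases) (use U in simp_all)
  have repl: "replaces r d u u'" if "earlier3 c j d u u'" "d \<in> U" "u \<in> U" "u' \<in> U" for d u u'
  proof -
    have "earlier c j (pr d (pr u u'))"
      using that by (auto simp: earlier3_def earlier2_def P3_iff)
    then have "deriv ?R (pr d (pr u u'))" using deriv that by simp
    then show ?thesis unfolding replaces_def using that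
      by (intro bexI[of _ "pr d (pr u u')"]) (simp_all add: triple_iff)
  qed
  have "subst_step r d c j x x'" using cj(3) U by (auto simp: triple_iff)
  then show thesis unfolding subst_step_def
  proof (elim disjE bexE conjE)
    fix u u' assume "u \<in> U" "u' \<in> U" "earlier3 c j d u u'" "node1 7 u x" "node1 7 u' x'"
    then show thesis using unary[of 7 d u u'] repl[of d u u'] U by (simp add: node1_iff)
  next
    fix u u' assume "u \<in> U" "u' \<in> U" "earlier3 c j (S d) u u'" "node1 9 u x" "node1 9 u' x'"
    then show thesis using unary[of 9 "S d" u u'] repl[of "S d" u u'] U by (simp add: node1_iff)
  next
    fix u u' v v' assume "u \<in> U" "u' \<in> U" "v \<in> U" "v' \<in> U" "earlier3 c j d u u'" "earlier3 c j d v v'"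
      "node2 8 u v x" "node2 8 u' v' x'"
    then show thesis using binary[of u u' v v'] repl[of d u u'] repl[of d v v'] U by (simp add: node2_iff)
  next
    assume "node1 0 d x" "x' = r"
    then show thesis using const[where k=0 and k'=0 and y=d and y'=d] U by (simp add: node1_iff)
  next
    fix i assume "i \<in> U" "node1 0 i x" "x' = x"
    then show thesis using const[where k=0 and k'=0 and y=i and y'=i] U by (simp add: node1_iff)
  next
    assume "node1 1 \<zero> x" "x' = x"
    then show thesis using const[where k=1 and k'=1 and y="\<zero>" and y'="\<zero>"] U by (simp add: node1_iff)
  next
    fix u u' assume "u \<in> U" "u' \<in> U" "node1 2 u x" "node1 2 u' x'"
    then show thesis using const[where k=2 and k'=2 and y=u and y'=u'] U by (simp add: node1_iff)
  next
    fix u u' v v' assume "u \<in> U" "u' \<in> U" "v \<in> U" "v' \<in> U" "node2 3 u v x" "node2 3 u' v' x'"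
    then show thesis using const[where k=3 and k'=3 and y="pr u v" and y'="pr u' v'"] U by (simp add: node2_iff)
  next
    fix u u' v v' assume "u \<in> U" "u' \<in> U" "v \<in> U" "v' \<in> U" "node2 4 u v x" "node2 4 u' v' x'"
    then show thesis using const[where k=4 and k'=4 and y="pr u v" and y'="pr u' v'"] U by (simp add: node2_iff)
  next
    fix u u' v v' assume "u \<in> U" "u' \<in> U" "v \<in> U" "v' \<in> U" "node2 5 u v x" "node2 5 u' v' x'"
    then show thesis using const[where k=5 and k'=5 and y="pr u v" and y'="pr u' v'"] U by (simp add: node2_iff)
  next
    fix u u' v v' assume "u \<in> U" "u' \<in> U" "v \<in> U" "v' \<in> U" "node2 6 u v x" "node2 6 u' v' x'"
    then show thesis using const[where k=6 and k'=6 and y="pr u v" and y'="pr u' v'"] U by (simp add: node2_iff)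
  qed
qed

lemma dpred_formula: "dterm M s \<Longrightarrow> dterm M t \<Longrightarrow> dpred M (\<lambda>e. formula (s e) (t e))"
proof (rule dpred_comp2[where P=formula])
  show "dpred M (\<lambda>e. formula (e 0) (e (Suc 0)))"
    \<comment> \<open>Taking \<open>T\<close> to be \<open>truth M\<close> turns
      \<open>with_truth\<close> into the identity, so \<open>formF\<close> itself is the defining
      formula.\<close>
    using dpred_fm[OF is_struct, of "formF (Var 0) (Var (Suc 0))"] sat_formF[of "truth M"] by simp
qed

lemma dpred_replaces:
  assumes r: "r \<in> U"
  shows "dterm M s \<Longrightarrow> dterm M t \<Longrightarrow> dterm M u \<Longrightarrow> dpred M (\<lambda>e. replaces r (s e) (t e) (u e))"
proof (rule dpred_comp3[where P="replaces r"])
  have "dpred M (\<lambda>e. replaces (e 0) (e (Suc 0)) (e (Suc (Suc 0))) (e (Suc (Suc (Suc 0)))))"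
    using dpred_fm[OF is_struct, of "substF (Var 0) (Var (Suc 0)) (Var (Suc (Suc 0))) (Var (Suc (Suc (Suc 0))))"]
      sat_substF[of "truth M"] by simp
  then show "dpred M (\<lambda>e. replaces r (e 0) (e (Suc 0)) (e (Suc (Suc 0))))"
    by (rule dpred_subst[OF dterm_const[OF r],
          of "\<lambda>y e. replaces y (e 0) (e (Suc 0)) (e (Suc (Suc 0)))"])
qed

section \<open>Consequences of Tarski's clauses\<close>

lemma tarski_formula: "tarski T \<Longrightarrow> x \<in> U \<Longrightarrow> T x \<Longrightarrow> formula \<zero> x"
  unfolding tarski_def by blast

lemma tarski_atom:
  assumes T: "tarski T" and k: "k \<in> {5, 6}" and U: "s \<in> U" "t \<in> U"
    and st: "deriv (term_rule \<zero>) s" "deriv (term_rule \<zero>) t"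
  shows "T (pr (num k) (pr s t)) \<longleftrightarrow>
    (\<exists>u\<in>U. \<exists>v\<in>U. has_value s u \<and> has_value t v \<and> (if k = 5 then u = v else u \<prec> v))"
proof -
  have x: "pr (num k) (pr s t) \<in> U" "node2 k s t (pr (num k) (pr s t))"
    using U by (simp_all add: node2_iff)
  consider "k = 5" | "k = 6" using k by blast
  then show ?thesis
  proof cases
    case 1
    have "\<forall>s\<in>U. \<forall>t\<in>U. \<forall>x\<in>U. deriv (term_rule \<zero>) s \<and> deriv (term_rule \<zero>) t \<and> node2 5 s t x \<longrightarrow>
        (T x \<longleftrightarrow> (\<exists>u\<in>U. \<exists>v\<in>U. has_value s u \<and> has_value t v \<and> u = v))"
      using T unfolding tarski_def by (elim conjE) assumption
    from this[rule_format, OF U x(1)] show ?thesis using st x 1 by simp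
  next
    case 2
    have "\<forall>s\<in>U. \<forall>t\<in>U. \<forall>x\<in>U. deriv (term_rule \<zero>) s \<and> deriv (term_rule \<zero>) t \<and> node2 6 s t x \<longrightarrow>
        (T x \<longleftrightarrow> (\<exists>u\<in>U. \<exists>v\<in>U. has_value s u \<and> has_value t v \<and> u \<prec> v))"
      using T unfolding tarski_def by (elim conjE) assumption
    from this[rule_format, OF U x(1)] show ?thesis using st x 2 by simp
  qed
qed

lemma tarski_neg:
  assumes T: "tarski T" and y: "y \<in> U" "formula \<zero> y"
  shows "T (pr (num 7) y) \<longleftrightarrow> \<not> T y"
proof -
  have "\<forall>y\<in>U. \<forall>x\<in>U. formula \<zero> y \<and> node1 7 y x \<longrightarrow> (T x \<longleftrightarrow> \<not> T y)"
    using T unfolding tarski_def by (elim conjE) assumption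
  then show ?thesis using y by (simp add: node1_iff)
qed

lemma tarski_disj:
  assumes T: "tarski T" and y: "y \<in> U" "formula \<zero> y" "z \<in> U" "formula \<zero> z"
  shows "T (pr (num 8) (pr y z)) \<longleftrightarrow> T y \<or> T z"
proof -
  have "\<forall>y\<in>U. \<forall>z\<in>U. \<forall>x\<in>U. formula \<zero> y \<and> formula \<zero> z \<and> node2 8 y z x \<longrightarrow> (T x \<longleftrightarrow> T y \<or> T z)"
    using T unfolding tarski_def by (elim conjE) assumption
  then show ?thesis using y by (simp add: node2_iff)
qed

lemma tarski_ex:
  assumes T: "tarski T" and y: "y \<in> U" "formula \<zero> (pr (num 9) y)"
  shows "T (pr (num 9) y) \<longleftrightarrow> (\<exists>a\<in>U. \<exists>t\<in>U. \<exists>z\<in>U. is_numeral a t \<and> replaces t \<zero> y z \<and> T z)"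
proof -
  have "\<forall>y\<in>U. \<forall>x\<in>U. formula \<zero> x \<and> node1 9 y x \<longrightarrow>
      (T x \<longleftrightarrow> (\<exists>a\<in>U. \<exists>t\<in>U. \<exists>z\<in>U. is_numeral a t \<and> replaces t \<zero> y z \<and> T z))"
    using T unfolding tarski_def by (elim conjE) assumption
  from this[rule_format, OF y(1), of "pr (num 9) y"] show ?thesis using y by (simp add: node1_iff)
qed

text \<open>Definability of \<open>T'\<close> brings agreement of the two predicates at all
  sentences of depth \<open>n\<close> within reach of induction on \<open>n\<close>. Every clause of
  \<open>tarski\<close> then determines truth at depth \<open>n\<close> from truth at smaller
  depths, and atomic truth from values of terms.\<close>

lemma truth_unique:
  assumes T: "tarski (truth M)" and T': "tarski T'" and dT': "dpred M (\<lambda>e. T' (e 0))" and x: "x \<in> U"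
  shows "truth M x \<longleftrightarrow> T' x"
proof -
  obtain depth where ddepth: "dterm M (\<lambda>e. depth (e 0))"
    and depth: "\<forall>k x. k \<notin> {7, 8, 9} \<longrightarrow> x \<in> U \<longrightarrow> depth (pr (num k) x) = \<zero>"
      "\<forall>k x. k \<in> {7, 9} \<longrightarrow> x \<in> U \<longrightarrow> depth (pr (num k) x) = S (depth x)"
      "\<forall>x\<in>U. \<forall>y\<in>U. depth (pr (num 8) (pr x y)) = S (depth x \<oplus> depth y)"
    using ex_depth by (elim exE conjE) (rule that)
  have depth_0: "depth (pr (num k) x) = \<zero>" if "k \<notin> {7, 8, 9}" "x \<in> U" for k x
    using depth(1) that by blast
  have depth_1: "depth (pr (num k) x) = S (depth x)" if "k \<in> {7, 9}" "x \<in> U" for k x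
    using depth(2) that by blast
  have depth_2: "depth (pr (num 8) (pr x y)) = S (depth x \<oplus> depth y)" if "x \<in> U" "y \<in> U" for x y
    using depth(3) that by blast
  have depth_U [simp]: "depth y \<in> U" if "y \<in> U" for y
    using ddepth that by (rule dterm_closed1)
  \<comment> \<open>The index \<open>d\<close> is quantified inside the induction, since the rule
    for \<open>Ex\<close> passes to its successor.\<close>
  have depth_replaces: "\<forall>d\<in>U. \<forall>x'\<in>U. replaces r d x x' \<longrightarrow> depth x' = depth x"
    if r: "r \<in> U" "depth r = \<zero>" and x: "x \<in> U" for r x
    using x
  proof (induction rule: less_induct)
    case dpred
    show ?case by (intro dintros dpred_replaces[OF r(1)] dterm_comp1[OF ddepth])
  next
    case (less x)
    show ?case
    proof (intro ballI impI)
      fix d x' assume d: "d \<in> U" "x' \<in> U" "replaces r d x x'"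
      from d(3) r(1) d(1) less(1) d(2) show "depth x' = depth x"
      proof (cases rule: replaces_cases)
        case (const k k' y y')
        then show ?thesis using r depth_0[of k y] depth_0[of k' y'] by auto
      next
        case (unary k d' u u')
        then have "u \<prec> x" using less_node1[of u k] by auto
        then show ?thesis using less(2)[of u] unary depth_1[of k] by auto
      next
        case (binary u v u' v')
        then have "u \<prec> x" "v \<prec> x" using less_node2[of u v 8] by auto
        then show ?thesis using less(2)[of u] less(2)[of v] binary d depth_2 by auto
      qed
    qed
  qed
  have "\<forall>x\<in>U. formula \<zero> x \<and> depth x = n \<longrightarrow> (truth M x \<longleftrightarrow> T' x)" if "n \<in> U" for n
    using that
  proof (induction rule: less_induct)
    case dpred
    show ?case by (intro dintros dpred_formula dterm_comp1[OF ddepth] dpred_comp1[OF dT']) simp_all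
  next
    case (less n)
    have IH: "truth M y \<longleftrightarrow> T' y" if "y \<in> U" "formula \<zero> y" "depth y \<prec> n" for y
      using less(2)[OF _ that(3)] that(1,2) by simp
    show ?case
    proof (intro ballI impI)
      fix x assume x: "x \<in> U" "formula \<zero> x \<and> depth x = n"
      then have "formula \<zero> x" "\<zero> \<in> U" "x \<in> U" by auto
      then show "truth M x \<longleftrightarrow> T' x"
      proof (cases rule: formula_cases)
        case (atom k s t)
        show ?thesis unfolding atom(6)
          by (simp only: tarski_atom[OF T atom(1-5)] tarski_atom[OF T' atom(1-5)])
      next
        case (neg y)
        have "n = S (depth y)" using x(2) neg(1,3) depth_1[of 7 y] by simp
        then have "depth y \<prec> n" using neg(1) by simp
        with IH[OF neg(1,2)] show ?thesis
          unfolding neg(3) by (simp add: tarski_neg[OF T neg(1,2)] tarski_neg[OF T' neg(1,2)])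
      next
        case (disj y z)
        have "n = S (depth y \<oplus> depth z)" using x(2) disj(1,2,5) depth_2[of y z] by simp
        then have "depth y \<prec> n" "depth z \<prec> n" using disj(1,2) by simp_all
        with IH[of y] IH[of z] disj show ?thesis by (simp add: tarski_disj[OF T] tarski_disj[OF T'])
      next
        case (ex y)
        \<comment> \<open>An instance true under either predicate is a sentence by the first clause
          of \<open>tarski\<close>, and its depth is that of the body \<open>y\<close>, one less
          than \<open>n\<close>.\<close>
        have *: "truth M z \<longleftrightarrow> T' z"
          if "a \<in> U" "t \<in> U" "z \<in> U" "is_numeral a t" "replaces t \<zero> y z" "truth M z \<or> T' z" for a t z
        proof (rule IH)
          show "formula \<zero> z" using that tarski_formula[OF T] tarski_formula[OF T'] by blast
          have "depth t = \<zero>" using numeral_cases[of a t] that depth_0 by force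
          from depth_replaces[OF that(2) this ex(1), rule_format, OF _ that(3,5)]
          have "depth z = depth y" by simp
          moreover have "n = S (depth y)" using x(2) ex depth_1[of 9 y] by simp
          ultimately show "depth z \<prec> n" using ex(1) by simp
        qed (use that in simp)
        have "formula \<zero> (pr (num 9) y)" using x(2) ex by simp
        note tarski_ex[OF T ex(1) this] tarski_ex[OF T' ex(1) this]
        then show ?thesis unfolding ex(2) using * by blast
      qed
    qed
  qed
  \<comment> \<open>Off the sentences both predicates are false.\<close>
  moreover have "truth M x \<or> T' x \<longrightarrow> formula \<zero> x"
    using tarski_formula[OF T x] tarski_formula[OF T' x] by blast
  ultimately show ?thesis using x depth_U by blast
qed

end

section \<open>Definability with tuples\<close>

lemma definable_length:
  assumes "definable M R"
  obtains n where "\<And>xs. xs \<in> R \<Longrightarrow> length xs = n \<and> set xs \<subseteq> univ M"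
  using assms unfolding definable_def by auto

lemma foldr_case_nat: "foldr case_nat xs e i = (if i < length xs then xs ! i else e (i - length xs))"
  by (induction xs arbitrary: i) (auto split: nat.split)

text \<open>The list of terms is fixed in advance, so the tuple has the same length under every
  assignment.\<close>

definition dlist :: "'a struct \<Rightarrow> ((nat \<Rightarrow> 'a) \<Rightarrow> 'a list) \<Rightarrow> bool" where
  "dlist M ts \<longleftrightarrow> (\<exists>fs. (\<forall>t\<in>set fs. dterm M t) \<and> ts = (\<lambda>e. map (\<lambda>t. t e) fs))"

lemma dlist_Cons: assumes "dterm M t" "dlist M ts" shows "dlist M (\<lambda>e. t e # ts e)"
proof -
  obtain fs where "\<forall>t\<in>set fs. dterm M t" "ts = (\<lambda>e. map (\<lambda>t. t e) fs)"
    using assms unfolding dlist_def by blast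
  then show ?thesis using assms(1) unfolding dlist_def by (intro exI[of _ "t # fs"]) auto
qed

lemma dlist_append: assumes "dlist M ts" "dlist M us" shows "dlist M (\<lambda>e. ts e @ us e)"
proof -
  obtain fs gs where "\<forall>t\<in>set fs. dterm M t" "ts = (\<lambda>e. map (\<lambda>t. t e) fs)"
    "\<forall>t\<in>set gs. dterm M t" "us = (\<lambda>e. map (\<lambda>t. t e) gs)"
    using assms unfolding dlist_def by blast
  then show ?thesis unfolding dlist_def by (intro exI[of _ "fs @ gs"]) auto
qed

lemma dlist_vars: "is_struct M \<Longrightarrow> dlist M (\<lambda>e. map (\<lambda>i. e (f i)) xs)"
  unfolding dlist_def by (intro exI[of _ "map (\<lambda>i e. e (f i)) xs"]) (auto simp: dterm_var)

lemma dpred_ex_list: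
  "dpred M (\<lambda>e. P (map e [0..<k]) (\<lambda>i. e (k + i))) \<Longrightarrow>
    dpred M (\<lambda>e. \<exists>xs. length xs = k \<and> set xs \<subseteq> univ M \<and> P xs e)"
proof (induction k arbitrary: P)
  case (Suc k)
  \<comment> \<open>The head of the list is moved behind the \<open>k\<close> variables of the tail,
    so that the induction hypothesis can quantify the tail first and \<open>dpred_ex\<close> the
    head afterwards.\<close>
  let ?f = "\<lambda>i. if i = 0 then k else if i \<le> k then i - 1 else i"
  have 1: "map (\<lambda>i. e (?f i)) [0..<Suc k] = e k # map e [0..<k]" for e :: "nat \<Rightarrow> 'a"
    by (simp only: upt_rec[of 0 "Suc k"] map_Suc_upt[symmetric]) simp
  have 2: "(\<lambda>i. e (?f (Suc k + i))) = (\<lambda>i. e (k + Suc i))" for e :: "nat \<Rightarrow> 'a"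
    by auto
  have "dpred M (\<lambda>e. P (e k # map e [0..<k]) (\<lambda>i. e (k + Suc i)))"
    using dpred_rename[OF Suc.prems, of ?f] unfolding 1 2 .
  then have "dpred M (\<lambda>e. \<exists>xs. length xs = k \<and> set xs \<subseteq> univ M \<and> P (e 0 # xs) (\<lambda>i. e (Suc i)))"
    by (intro Suc.IH[of "\<lambda>xs e. P (e 0 # xs) (\<lambda>i. e (Suc i))"]) simp
  then have "dpred M (\<lambda>e. \<exists>x\<in>univ M. \<exists>xs. length xs = k \<and> set xs \<subseteq> univ M \<and> P (x # xs) e)"
    by (rule dpred_ex)
  then show ?case by (rule dpred_cong) (force simp: length_Suc_conv)
qed simp

lemma dpred_all_less: "is_struct M \<Longrightarrow> (\<And>i. i < k \<Longrightarrow> dpred M (P i)) \<Longrightarrow> dpred M (\<lambda>e. \<forall>i<(k::nat). P i e)"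
proof (induction k)
  case 0
  then show ?case by (simp add: dpred_const)
next
  case (Suc k)
  then have "dpred M (\<lambda>e. (\<forall>i<k. P i e) \<and> P k e)" by (intro dpred_conj) simp_all
  then show ?case by (rule dpred_cong) (auto simp: less_Suc_eq)
qed

lemma dpred_subst_list:
  assumes M: "is_struct M" and P: "dpred M (\<lambda>e. P (map e [0..<length fs]))"
    and fs: "\<forall>t\<in>set fs. dterm M t"
  shows "dpred M (\<lambda>e. P (map (\<lambda>t. t e) fs))"
proof -
  let ?k = "length fs"
  have "dpred M (\<lambda>e. \<exists>xs. length xs = ?k \<and> set xs \<subseteq> univ M \<and> (\<forall>i<?k. xs ! i = (fs ! i) e) \<and> P xs)"
  proof (rule dpred_ex_list, rule dpred_conj[OF dpred_all_less[OF M] P])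
    fix i assume i: "i < ?k"
    have "dpred M (\<lambda>e. e i = (fs ! i) (\<lambda>j. e (?k + j)))"
      using i fs by (intro dpred_eq[OF M dterm_var[OF M] dterm_rename]) simp
    then show "dpred M (\<lambda>e. map e [0..<?k] ! i = (fs ! i) (\<lambda>i. e (?k + i)))" using i by simp
  qed
  then show ?thesis
  proof (rule dpred_cong)
    fix e :: "nat \<Rightarrow> 'a" assume e: "range e \<subseteq> univ M"
    have "set (map (\<lambda>t. t e) fs) \<subseteq> univ M" using fs e by (auto simp: dterm_def)
    moreover have "xs = map (\<lambda>t. t e) fs" if "length xs = ?k" "\<forall>i<?k. xs ! i = (fs ! i) e" for xs
      using that by (auto intro: nth_equalityI)
    ultimately show "(\<exists>xs. length xs = ?k \<and> set xs \<subseteq> univ M \<and> (\<forall>i<?k. xs ! i = (fs ! i) e) \<and> P xs) =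
        P (map (\<lambda>t. t e) fs)"
      by (auto intro!: exI[of _ "map (\<lambda>t. t e) fs"])
  qed
qed

lemma dpred_mem:
  assumes M: "is_struct M" and R: "definable M R" and ts: "dlist M ts"
  shows "dpred M (\<lambda>e. ts e \<in> R)"
proof -
  obtain n \<phi> p where p: "range p \<subseteq> univ M"
    and R: "R = {xs. length xs = n \<and> set xs \<subseteq> univ M \<and> sat M (foldr case_nat xs p) \<phi>}"
    using R unfolding definable_def by blast
  obtain fs where fs: "\<forall>t\<in>set fs. dterm M t" and ts: "ts = (\<lambda>e. map (\<lambda>t. t e) fs)"
    using ts unfolding dlist_def by blast
  show ?thesis
  proof (cases "length fs = n")
    case True
    let ?\<rho> = "\<lambda>i. if i < n then 2 * i else Suc (2 * (i - n))"
    have "(\<lambda>i. interleave e p (?\<rho> i)) = foldr case_nat (map e [0..<n]) p" for e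
      by (auto simp: fun_eq_iff interleave_def foldr_case_nat)
    then have "sat M (foldr case_nat (map e [0..<n]) p) \<phi> =
        sat M (interleave e p) (subst_fm (\<lambda>i. Var (?\<rho> i)) \<phi>)" for e
      by (simp only: sat_rename)
    then have "dpred M (\<lambda>e. sat M (foldr case_nat (map e [0..<n]) p) \<phi>)"
      using p unfolding dpred_def by blast
    with fs True have "dpred M (\<lambda>e. sat M (foldr case_nat (map (\<lambda>t. t e) fs) p) \<phi>)"
      by (intro dpred_subst_list[OF M]) simp_all
    then show ?thesis
      by (rule dpred_cong) (use fs True in \<open>auto simp: ts R dterm_def\<close>)
  qed (simp add: R ts dpred_const[OF M])
qed

lemma definable_dpred:
  assumes M: "is_struct M" and P: "dpred M (\<lambda>e. P (map e [0..<n]))"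
  shows "definable M {xs. length xs = n \<and> set xs \<subseteq> univ M \<and> P xs}"
proof -
  obtain \<phi> p where p: "range p \<subseteq> univ M"
    and sat: "\<And>e. range e \<subseteq> univ M \<Longrightarrow> P (map e [0..<n]) = sat M (interleave e p) \<phi>"
    using P unfolding dpred_def by blast
  let ?z = "zero M"
  \<comment> \<open>Index \<open>n\<close> carries a padding element, to which all variables beyond
    the tuple are sent; the parameters start right after it.\<close>
  let ?\<rho> = "\<lambda>i. if even i then if i div 2 < n then i div 2 else n else Suc (n + i div 2)"
  have z: "?z \<in> univ M" using M by (simp add: is_struct_def)
  have "P xs = sat M (foldr case_nat xs (case_nat ?z p)) (subst_fm (\<lambda>i. Var (?\<rho> i)) \<phi>)"
    if xs: "length xs = n" "set xs \<subseteq> univ M" for xs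
  proof -
    let ?e = "foldr case_nat xs (\<lambda>_. ?z)"
    have "map ?e [0..<n] = xs" using xs(1) by (auto intro: nth_equalityI simp: foldr_case_nat)
    moreover have "range ?e \<subseteq> univ M" using xs z by (auto simp: foldr_case_nat)
    moreover have "(\<lambda>i. foldr case_nat xs (case_nat ?z p) (?\<rho> i)) = interleave ?e p"
      using xs(1) by (auto simp: fun_eq_iff foldr_case_nat interleave_def)
    ultimately show ?thesis using sat[of ?e] by (simp only: sat_rename)
  qed
  then have "{xs. length xs = n \<and> set xs \<subseteq> univ M \<and> P xs} = {xs. length xs = n \<and> set xs \<subseteq> univ M \<and>
      sat M (foldr case_nat xs (case_nat ?z p)) (subst_fm (\<lambda>i. Var (?\<rho> i)) \<phi>)}"
    by auto
  moreover have "range (case_nat ?z p) \<subseteq> univ M" using z p by (simp add: range_case_nat)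
  ultimately show ?thesis unfolding definable_def by blast
qed

lemma dpred_list_eq:
  assumes M: "is_struct M" and ts: "dlist M ts" "dlist M us"
  shows "dpred M (\<lambda>e. ts e = us e)"
proof -
  obtain fs gs where fs: "\<forall>t\<in>set fs. dterm M t" and ts: "ts = (\<lambda>e. map (\<lambda>t. t e) fs)"
    and gs: "\<forall>t\<in>set gs. dterm M t" and us: "us = (\<lambda>e. map (\<lambda>t. t e) gs)"
    using ts unfolding dlist_def by blast
  show ?thesis
  proof (cases "length fs = length gs")
    case True
    have "dpred M (\<lambda>e. \<forall>i<length fs. (fs ! i) e = (gs ! i) e)"
      using fs gs True by (intro dpred_all_less dpred_eq M) simp_all
    then show ?thesis by (rule dpred_cong) (auto simp: ts us True list_eq_iff_nth_eq)
  next
    case False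
    then have "ts e \<noteq> us e" for e unfolding ts us by (metis length_map)
    then show ?thesis by (simp add: dpred_const[OF M])
  qed
qed

lemma dpred_ex_tuple:
  assumes M: "is_struct M" and D: "definable M D" and k: "\<And>x. x \<in> D \<Longrightarrow> length x = k"
    and P: "dpred M (\<lambda>e. P (map e [0..<k]) (\<lambda>i. e (k + i)))"
  shows "dpred M (\<lambda>e. \<exists>x\<in>D. P x e)"
proof -
  have "dpred M (\<lambda>e. \<exists>xs. length xs = k \<and> set xs \<subseteq> univ M \<and> xs \<in> D \<and> P xs e)"
    by (intro dpred_ex_list dpred_conj P dpred_mem[OF M D] dlist_vars[OF M])
  moreover have "set x \<subseteq> univ M" if "x \<in> D" for x
    using D that unfolding definable_def by auto
  ultimately show ?thesis by (elim dpred_cong) (use k in blast)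
qed

text \<open>Freezes all variables from \<open>m\<close> on at once. In
  \<open>definable_concat\<close> this makes the parameters of a formula over \<open>N\<close>,
  spelled out in elements of \<open>M\<close>, into parameters over \<open>M\<close>.\<close>

lemma dpred_params:
  assumes P: "dpred M P" and p: "range p \<subseteq> univ M"
  shows "dpred M (\<lambda>e. P (\<lambda>i. if i < m then e i else p (i - m)))"
proof -
  obtain \<phi> q where q: "range q \<subseteq> univ M"
    and P: "\<And>e. range e \<subseteq> univ M \<Longrightarrow> P e = sat M (interleave e q) \<phi>"
    using P unfolding dpred_def by blast
  let ?r = "interleave p q"
  let ?\<rho> = "\<lambda>i. if even i then if i div 2 < m then i else 4 * (i div 2 - m) + 1 else 4 * (i div 2) + 3"
  have r: "range ?r \<subseteq> univ M" using p q by (auto simp: interleave_def)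
  have 3: "(4 * b + 3) div 2 = Suc (2 * b)" for b :: nat by presburger
  have "(\<lambda>i. interleave e ?r (?\<rho> i)) = interleave (\<lambda>i. if i < m then e i else p (i - m)) q" for e
    by (auto simp: interleave_def fun_eq_iff 3 elim!: oddE)
  then have "P (\<lambda>i. if i < m then e i else p (i - m)) =
      sat M (interleave e ?r) (subst_fm (\<lambda>i. Var (?\<rho> i)) \<phi>)" if "range e \<subseteq> univ M" for e
    using P[of "\<lambda>i. if i < m then e i else p (i - m)"] that p
    by (simp only: sat_rename) (auto simp: image_subset_iff)
  then show ?thesis using r unfolding dpred_def by blast
qed

section \<open>Composition of interpretations\<close>

locale tuple_interpretation =
  fixes M :: "'a struct" and N :: "'a list struct" and k :: nat
  assumes M: "is_struct M" and N: "is_struct N" and MN: "M \<unrhd> N"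
    and length_univ: "\<And>x. x \<in> univ N \<Longrightarrow> length x = k"
begin

lemma set_univ: "x \<in> univ N \<Longrightarrow> set x \<subseteq> univ M"
  using MN unfolding interprets_def definable_def by auto

lemma
  shows def_univ: "definable M (univ N)"
    and def_zero: "definable M {zero N}"
    and def_succ: "definable M {x @ succ N x |x. x \<in> univ N}"
    and def_add: "definable M {x @ y @ add N x y |x y. x \<in> univ N \<and> y \<in> univ N}"
    and def_mul: "definable M {x @ y @ mul N x y |x y. x \<in> univ N \<and> y \<in> univ N}"
    and def_less: "definable M {x @ y |x y. x \<in> univ N \<and> y \<in> univ N \<and> less N x y}"
    and def_truth: "definable M {x. x \<in> univ N \<and> truth N x}"
  using MN unfolding interprets_def by auto

text \<open>All elements of \<open>N\<close> have length \<open>k\<close>, so a concatenation splits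
  into blocks in one way only.\<close>

lemma
  assumes "x \<in> univ N" "y \<in> univ N" "length z = k"
  shows mem_succ: "x @ z \<in> {x @ succ N x |x. x \<in> univ N} \<longleftrightarrow> z = succ N x"
    and mem_add: "x @ y @ z \<in> {x @ y @ add N x y |x y. x \<in> univ N \<and> y \<in> univ N} \<longleftrightarrow> z = add N x y"
    and mem_mul: "x @ y @ z \<in> {x @ y @ mul N x y |x y. x \<in> univ N \<and> y \<in> univ N} \<longleftrightarrow> z = mul N x y"
    and mem_less: "x @ y \<in> {x @ y |x y. x \<in> univ N \<and> y \<in> univ N \<and> less N x y} \<longleftrightarrow> less N x y"
  using assms by (force simp: length_univ)+

text \<open>Blocks outside the universe of \<open>N\<close> are read as zero, so that formulae can be translated without
  assuming that the assignment consists of elements of \<open>N\<close>.\<close>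

definition blocks :: "(nat \<Rightarrow> 'a) \<Rightarrow> nat \<Rightarrow> 'a list" where
  "blocks e i = (let x = map (\<lambda>j. e (i * k + j)) [0..<k] in if x \<in> univ N then x else zero N)"

lemma blocks_univ: "blocks e i \<in> univ N"
  using N by (simp add: blocks_def Let_def is_struct_def)

lemma eval_blocks_univ: "eval N (blocks e) t \<in> univ N"
  by (rule eval_closed[OF N]) (auto simp: blocks_univ)

lemmas tuple_intros = dpred_conj dpred_disj dpred_Not dpred_mem[OF M def_univ]
  dpred_mem[OF M def_zero] dpred_mem[OF M def_succ] dpred_mem[OF M def_add] dpred_mem[OF M def_mul]
  dpred_mem[OF M def_less] dpred_mem[OF M def_truth] dpred_list_eq[OF M]
  dlist_append dlist_vars[OF M] dpred_ex_tuple[OF M def_univ length_univ]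

text \<open>The position maps \<open>a\<close> and \<open>b\<close> are arbitrary because each
  quantifier over an element of \<open>N\<close> introduces \<open>k\<close> new variables and
  shifts the rest; the induction hypotheses are applied to the shifted maps.\<close>

lemma dpred_eval:
  "dpred M (\<lambda>e. map (\<lambda>j. e (a j)) [0..<k] = eval N (blocks (\<lambda>j. e (b j))) t)"
proof (induction t arbitrary: a b)
  case (Var i)
  let ?x = "\<lambda>e. map (\<lambda>j. e (b (i * k + j))) [0..<k]"
  have "dpred M (\<lambda>e. ?x e \<in> univ N \<and> map (\<lambda>j. e (a j)) [0..<k] = ?x e \<or>
      ?x e \<notin> univ N \<and> map (\<lambda>j. e (a j)) [0..<k] \<in> {zero N})"
    by (intro tuple_intros)
  then show ?case by (rule dpred_cong) (auto simp: blocks_def Let_def)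
next
  case Zero
  have "dpred M (\<lambda>e. map (\<lambda>j. e (a j)) [0..<k] \<in> {zero N})"
    by (intro tuple_intros)
  then show ?case by simp
next
  case (Succ t)
  have "dpred M (\<lambda>e. \<exists>x\<in>univ N. x = eval N (blocks (\<lambda>j. e (b j))) t \<and>
      x @ map (\<lambda>j. e (a j)) [0..<k] \<in> {x @ succ N x |x. x \<in> univ N})"
    by (intro tuple_intros Succ.IH)
  then show ?case by (rule dpred_cong) (auto simp: mem_succ eval_blocks_univ simp del: mem_Collect_eq)
next
  case (Add s t)
  have "dpred M (\<lambda>e. \<exists>x\<in>univ N. \<exists>y\<in>univ N. x = eval N (blocks (\<lambda>j. e (b j))) s \<and>
      y = eval N (blocks (\<lambda>j. e (b j))) t \<and>
      x @ y @ map (\<lambda>j. e (a j)) [0..<k] \<in> {x @ y @ add N x y |x y. x \<in> univ N \<and> y \<in> univ N})"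
    by (intro tuple_intros Add.IH)
  then show ?case by (rule dpred_cong) (auto simp: mem_add eval_blocks_univ simp del: mem_Collect_eq)
next
  case (Mul s t)
  have "dpred M (\<lambda>e. \<exists>x\<in>univ N. \<exists>y\<in>univ N. x = eval N (blocks (\<lambda>j. e (b j))) s \<and>
      y = eval N (blocks (\<lambda>j. e (b j))) t \<and>
      x @ y @ map (\<lambda>j. e (a j)) [0..<k] \<in> {x @ y @ mul N x y |x y. x \<in> univ N \<and> y \<in> univ N})"
    by (intro tuple_intros Mul.IH)
  then show ?case by (rule dpred_cong) (auto simp: mem_mul eval_blocks_univ simp del: mem_Collect_eq)
qed

lemma dpred_sat: "dpred M (\<lambda>e. sat N (blocks (\<lambda>j. e (b j))) \<phi>)"
proof (induction \<phi> arbitrary: b)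
  case (Eq s t)
  have "dpred M (\<lambda>e. \<exists>x\<in>univ N. x = eval N (blocks (\<lambda>j. e (b j))) s \<and>
      x = eval N (blocks (\<lambda>j. e (b j))) t)"
    by (intro tuple_intros dpred_eval)
  then show ?case by (rule dpred_cong) (auto simp: eval_blocks_univ)
next
  case (Less s t)
  have "dpred M (\<lambda>e. \<exists>x\<in>univ N. \<exists>y\<in>univ N. x = eval N (blocks (\<lambda>j. e (b j))) s \<and>
      y = eval N (blocks (\<lambda>j. e (b j))) t \<and>
      x @ y \<in> {x @ y |x y. x \<in> univ N \<and> y \<in> univ N \<and> less N x y})"
    by (intro tuple_intros dpred_eval)
  then show ?case
    by (rule dpred_cong) (auto simp: mem_less[OF _ _ length_univ] eval_blocks_univ simp del: mem_Collect_eq)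
next
  case (Tr t)
  have "dpred M (\<lambda>e. \<exists>x\<in>univ N. x = eval N (blocks (\<lambda>j. e (b j))) t \<and> x \<in> {x. x \<in> univ N \<and> truth N x})"
    by (intro tuple_intros dpred_eval)
  then show ?case by (rule dpred_cong) (auto simp: eval_blocks_univ)
next
  case (Neg \<phi>)
  then show ?case by (simp add: dpred_Not)
next
  case (Or \<phi> \<psi>)
  then show ?case by (simp add: dpred_disj)
next
  case (Ex \<phi>)
  \<comment> \<open>The block of the quantified element occupies the first \<open>k\<close>
    variables, and all other blocks are read \<open>k\<close> places further up.\<close>
  let ?b = "\<lambda>j. if j < k then j else k + b (j - k)"
  have *: "blocks (\<lambda>j. e (?b j)) = case_nat (map e [0..<k]) (blocks (\<lambda>j. e (k + b j)))"
    if "map e [0..<k] \<in> univ N" for e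
  proof
    fix i
    have "map (\<lambda>j. e (?b (0 * k + j))) [0..<k] = map e [0..<k]" by simp
    moreover have "map (\<lambda>j. e (?b (Suc m * k + j))) [0..<k] = map (\<lambda>j. e (k + b (m * k + j))) [0..<k]" for m
      by (simp add: add.assoc)
    ultimately show "blocks (\<lambda>j. e (?b j)) i = case_nat (map e [0..<k]) (blocks (\<lambda>j. e (k + b j))) i"
      using that by (cases i) (simp_all only: blocks_def Let_def nat.case if_True)
  qed
  have "dpred M (\<lambda>e. map e [0..<k] \<in> univ N \<and> sat N (blocks (\<lambda>j. e (?b j))) \<phi>)"
    by (intro tuple_intros Ex.IH)
  then have "dpred M (\<lambda>e. map e [0..<k] \<in> univ N \<and>
      sat N (case_nat (map e [0..<k]) (blocks (\<lambda>j. e (k + b j)))) \<phi>)"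
    by (rule dpred_cong) (auto simp: *)
  then have "dpred M (\<lambda>e. \<exists>x\<in>univ N. x \<in> univ N \<and> sat N (case_nat x (blocks (\<lambda>j. e (b j)))) \<phi>)"
    by (intro dpred_ex_tuple[OF M def_univ length_univ,
      of "\<lambda>x e. x \<in> univ N \<and> sat N (case_nat x (blocks (\<lambda>j. e (b j)))) \<phi>"])
  then show ?case by (rule dpred_cong) auto
qed

lemma definable_concat:
  assumes k: "k > 0" and R: "definable N R"
  shows "definable M (concat ` R)"
proof -
  obtain n \<phi> p where p: "range p \<subseteq> univ N"
    and R: "R = {xs. length xs = n \<and> set xs \<subseteq> univ N \<and> sat N (foldr case_nat xs p) \<phi>}"
    using R unfolding definable_def by blast
  define q where "q i = p (i div k) ! (i mod k)" for i
  have pk: "p i \<in> univ N" "length (p i) = k" for i using p length_univ by auto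
  have q: "range q \<subseteq> univ M"
  proof
    fix x assume "x \<in> range q"
    then obtain i where "x = p (i div k) ! (i mod k)" by (auto simp: q_def)
    then have "x \<in> set (p (i div k))" using k pk by simp
    then show "x \<in> univ M" using set_univ[OF pk(1)] by blast
  qed
  define chop where "chop xs = map (\<lambda>i. map (\<lambda>j. xs ! (i * k + j)) [0..<k]) [0..<n]" for xs :: "'a list"
  define P where "P xs \<longleftrightarrow> (\<forall>i<n. map (\<lambda>j. xs ! (i * k + j)) [0..<k] \<in> univ N) \<and>
    sat N (blocks (\<lambda>i. if i < n * k then xs ! i else q (i - n * k))) \<phi>" for xs
  have lt: "i * k + j < n * k" if "i < n" "j < k" for i j
  proof -
    have "i * k + j < Suc i * k" using that by simp
    also have "\<dots> \<le> n * k" using that by (intro mult_le_mono1) simp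
    finally show ?thesis .
  qed
  have "dpred M (\<lambda>e. P (map e [0..<n * k]))"
  proof -
    have "dpred M (\<lambda>e. (\<forall>i<n. map (\<lambda>j. e (i * k + j)) [0..<k] \<in> univ N) \<and>
        sat N (blocks (\<lambda>i. if i < n * k then e i else q (i - n * k))) \<phi>)"
      by (intro dpred_conj dpred_all_less[OF M] tuple_intros dpred_params[OF dpred_sat[of "\<lambda>j. j"] q])
    then show ?thesis
    proof (rule dpred_cong)
      fix e :: "nat \<Rightarrow> 'a"
      have 1: "map (\<lambda>j. map e [0..<n * k] ! (i * k + j)) [0..<k] = map (\<lambda>j. e (i * k + j)) [0..<k]"
        if "i < n" for i
        using lt that by simp
      have 2: "(\<lambda>i. if i < n * k then map e [0..<n * k] ! i else q (i - n * k)) =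
          (\<lambda>i. if i < n * k then e i else q (i - n * k))"
        by auto
      show "((\<forall>i<n. map (\<lambda>j. e (i * k + j)) [0..<k] \<in> univ N) \<and>
          sat N (blocks (\<lambda>i. if i < n * k then e i else q (i - n * k))) \<phi>) = P (map e [0..<n * k])"
        unfolding P_def 2 by (auto simp only: 1)
    qed
  qed
  from definable_dpred[OF M this]
  have "definable M {xs. length xs = n * k \<and> set xs \<subseteq> univ M \<and> P xs}" .
  also have "{xs. length xs = n * k \<and> set xs \<subseteq> univ M \<and> P xs} = concat ` R"
  proof -
    have blocks: "blocks (\<lambda>i. if i < n * k then xs ! i else q (i - n * k)) = foldr case_nat (chop xs) p"
      if ch: "set (chop xs) \<subseteq> univ N" for xs
    proof
      fix i
      have "map (\<lambda>j. if i * k + j < n * k then xs ! (i * k + j) else q (i * k + j - n * k)) [0..<k] =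
          foldr case_nat (chop xs) p i"
      proof (cases "i < n")
        case True
        then show ?thesis using lt by (simp add: foldr_case_nat chop_def)
      next
        case False
        then have "n * k \<le> i * k" by simp
        then have 1: "\<not> i * k + j < n * k" "i * k + j - n * k = (i - n) * k + j" for j
          by (simp_all add: diff_mult_distrib trans_le_add1 not_less del: mult_le_cancel2)
        have "map (\<lambda>j. q ((i - n) * k + j)) [0..<k] = p (i - n)"
          using k pk by (intro nth_equalityI) (simp_all add: q_def)
        then show ?thesis using False 1 by (simp add: foldr_case_nat chop_def)
      qed
      moreover have "foldr case_nat (chop xs) p i \<in> univ N"
        using ch pk nth_mem[of i "chop xs"] by (auto simp: foldr_case_nat)
      ultimately show "blocks (\<lambda>i. if i < n * k then xs ! i else q (i - n * k)) i = foldr case_nat (chop xs) p i"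
        by (simp add: blocks_def Let_def)
    qed
    have nth: "concat xs ! (i * k + j) = xs ! i ! j"
      if "\<forall>x\<in>set xs. length x = k" "i < length xs" "j < k" for xs :: "'a list list" and i j
      using that
    proof (induction xs arbitrary: i)
      case (Cons x xs)
      then show ?case by (cases i) (simp_all add: nth_append)
    qed simp
    have len: "length (concat xs) = length xs * k"
      if "\<forall>x\<in>set xs. length x = k" for xs :: "'a list list"
      using that by (induction xs) simp_all
    have chop_concat: "chop (concat xs) = xs"
      if "\<forall>x\<in>set xs. length x = k" "length xs = n" for xs
      using that nth[of xs] by (auto simp: chop_def intro!: nth_equalityI)
    have len_chop: "\<forall>x\<in>set (chop xs). length x = k" "length (chop xs) = n" for xs
      by (auto simp: chop_def)
    have concat_chop: "concat (chop xs) = xs" if "length xs = n * k" for xs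
    proof (rule nth_equalityI)
      show "length (concat (chop xs)) = length xs" using that len[of "chop xs"] len_chop by simp
      fix i assume "i < length (concat (chop xs))"
      then have i: "i < n * k" using len[of "chop xs"] len_chop by simp
      then have "i div k < n" "i mod k < k" using k by (simp_all add: less_mult_imp_div_less)
      then have "concat (chop xs) ! (i div k * k + i mod k) = chop xs ! (i div k) ! (i mod k)"
        by (intro nth[OF len_chop(1)]) (simp_all only: len_chop)
      then show "concat (chop xs) ! i = xs ! i"
        using \<open>i div k < n\<close> \<open>i mod k < k\<close> by (simp add: chop_def)
    qed
    have P: "P xs \<longleftrightarrow> set (chop xs) \<subseteq> univ N \<and> sat N (foldr case_nat (chop xs) p) \<phi>" for xs
    proof -
      have *: "(\<forall>i<n. map (\<lambda>j. xs ! (i * k + j)) [0..<k] \<in> univ N) \<longleftrightarrow> set (chop xs) \<subseteq> univ N"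
        by (simp add: chop_def image_subset_iff Ball_def)
      show ?thesis unfolding P_def * by (rule conj_cong) (simp_all only: blocks)
    qed
    show ?thesis
    proof (intro equalityI subsetI)
      fix xs assume "xs \<in> {xs. length xs = n * k \<and> set xs \<subseteq> univ M \<and> P xs}"
      then show "xs \<in> concat ` R"
        using concat_chop[of xs] len_chop[of xs] P[of xs]
        by (intro image_eqI[of _ _ "chop xs"]) (auto simp: R)
    next
      fix ys assume "ys \<in> concat ` R"
      then obtain xs where xs: "ys = concat xs" "length xs = n" "set xs \<subseteq> univ N"
        "sat N (foldr case_nat xs p) \<phi>" by (auto simp: R)
      have "\<forall>x\<in>set xs. length x = k" using xs(3) length_univ by blast
      then show "ys \<in> {xs. length xs = n * k \<and> set xs \<subseteq> univ M \<and> P xs}"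
        using xs len[of xs] chop_concat[of xs] P[of ys] set_univ by auto
    qed
  qed
  finally show ?thesis .
qed

end

section \<open>Embedding a model into an interpreted one\<close>

lemma is_iso_sym:
  assumes iso: "is_iso M N f" and M: "is_struct M"
  shows "is_iso N M (inv_into (univ M) f)"
proof -
  let ?g = "inv_into (univ M) f"
  have inj: "inj_on f (univ M)" and im: "f ` univ M = univ N"
    using iso by (auto simp: is_iso_def bij_betw_def)
  have g: "?g (f x) = x" if "x \<in> univ M" for x using inj that by simp
  have "bij_betw ?g (univ N) (univ M)"
    using iso bij_betw_inv_into[of f "univ M" "univ N"] by (simp add: is_iso_def)
  moreover have "?g (f (zero M)) = zero M" using M by (intro g) (simp add: is_struct_def)
  then have "?g (zero N) = zero M" using iso by (simp add: is_iso_def)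
  moreover have "?g (succ N y) = succ M (?g y) \<and> (truth N y \<longleftrightarrow> truth M (?g y))"
    if y: "y \<in> univ N" for y
  proof -
    obtain x where x: "x \<in> univ M" "y = f x" using im y by blast
    then have "succ N y = f (succ M x)" "truth N y \<longleftrightarrow> truth M x" using iso by (simp_all add: is_iso_def)
    moreover have "succ M x \<in> univ M" using M x by (simp add: is_struct_def)
    ultimately show ?thesis using x by (simp add: g)
  qed
  moreover have "?g (add N y z) = add M (?g y) (?g z) \<and> ?g (mul N y z) = mul M (?g y) (?g z) \<and>
      (less N y z \<longleftrightarrow> less M (?g y) (?g z))" if yz: "y \<in> univ N" "z \<in> univ N" for y z
  proof -
    obtain x w where x: "x \<in> univ M" "y = f x" "w \<in> univ M" "z = f w" using im yz by blast
    then have "add N y z = f (add M x w)" "mul N y z = f (mul M x w)" "less N y z \<longleftrightarrow> less M x w"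
      using iso by (simp_all add: is_iso_def)
    moreover have "add M x w \<in> univ M" "mul M x w \<in> univ M" using M x by (simp_all add: is_struct_def)
    ultimately show ?thesis using x by (simp add: g)
  qed
  ultimately show ?thesis unfolding is_iso_def by blast
qed

lemma is_iso_trans:
  assumes "is_iso M N f" "is_iso N K g" shows "is_iso M K (g \<circ> f)"
proof -
  have "f x \<in> univ N" if "x \<in> univ M" for x
    using assms(1) that by (auto simp: is_iso_def bij_betw_def)
  then show ?thesis using assms unfolding is_iso_def by (auto intro: bij_betw_trans)
qed

lemma is_model_iso:
  assumes iso: "is_iso M N f" and M: "is_model M A" shows "is_model N A"
proof -
  let ?g = "inv_into (univ M) f"
  have im: "f ` univ M = univ N" and z: "f (zero M) = zero N"
    using iso by (auto simp: is_iso_def bij_betw_def)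
  have sM: "is_struct M" using M by (simp add: is_model_def)
  have "is_struct N"
    unfolding is_struct_def
  proof (intro conjI ballI)
    have "f (zero M) \<in> f ` univ M" using sM by (intro imageI) (simp add: is_struct_def)
    then show "zero N \<in> univ N" using im z by simp
  next
    fix x assume "x \<in> univ N"
    then obtain a where "a \<in> univ M" "x = f a" using im by blast
    then have "succ N x = f (succ M a)" "succ M a \<in> univ M"
      using iso sM by (simp_all add: is_iso_def is_struct_def)
    then show "succ N x \<in> univ N" using im by blast
  next
    fix x y assume "x \<in> univ N" "y \<in> univ N"
    then obtain a b where "a \<in> univ M" "x = f a" "b \<in> univ M" "y = f b" using im by blast
    then have "add N x y = f (add M a b)" "add M a b \<in> univ M"
        "mul N x y = f (mul M a b)" "mul M a b \<in> univ M"
      using iso sM by (simp_all add: is_iso_def is_struct_def)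
    then show "add N x y \<in> univ N" "mul N x y \<in> univ N" using im by blast+
  qed
  moreover have "sat N e \<phi>" if "\<phi> \<in> A" "range e \<subseteq> univ N" for \<phi> e
  proof -
    have "range (?g \<circ> e) \<subseteq> univ M" using that(2) im by (auto intro!: inv_into_into simp: image_subset_iff)
    moreover have "e i \<in> f ` univ M" for i using that(2) im by auto
    then have "f \<circ> (?g \<circ> e) = e" by (simp add: fun_eq_iff f_inv_into_f)
    ultimately show ?thesis using sat_iso[OF iso sM, of "?g \<circ> e" \<phi>] M that(1)
      unfolding is_model_def by metis
  qed
  ultimately show ?thesis by (simp add: is_model_def)
qed

context peano
begin

primrec code :: "'a list \<Rightarrow> 'a" where
  "code [] = \<zero>"
| "code (x # xs) = pr x (code xs)"

lemma code_closed: "set xs \<subseteq> U \<Longrightarrow> code xs \<in> U"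
  by (induction xs) simp_all

lemma code_inj:
  "length xs = length ys \<Longrightarrow> set xs \<subseteq> U \<Longrightarrow> set ys \<subseteq> U \<Longrightarrow> code xs = code ys \<Longrightarrow> xs = ys"
  by (induction xs ys rule: list_induct2) (simp_all add: code_closed)

lemma dterm_code: assumes "dlist M ts" shows "dterm M (\<lambda>e. code (ts e))"
proof -
  obtain fs where fs: "\<forall>t\<in>set fs. dterm M t" and ts: "ts = (\<lambda>e. map (\<lambda>t. t e) fs)"
    using assms unfolding dlist_def by blast
  from fs show ?thesis unfolding ts
    by (induction fs) (auto intro: dintros dterm_pr)
qed

lemma embedding:
  assumes L: "is_model L (PA_base \<union> range induction)" and sub: "univ L \<subseteq> U"
    and univ: "dpred M (\<lambda>e. e 0 \<in> univ L)"
    and succ: "dterm M (\<lambda>e. succ L (e 0))"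
    and add: "dterm M (\<lambda>e. add L (e 0) (e (Suc 0)))"
    and mul: "dterm M (\<lambda>e. mul L (e 0) (e (Suc 0)))"
  shows "\<exists>h. dterm M (\<lambda>e. h (e 0)) \<and> (\<forall>x\<in>U. h x \<in> univ L) \<and>
    h \<zero> = zero L \<and> (\<forall>x\<in>U. h (S x) = succ L (h x)) \<and>
    (h ` U = univ L \<longrightarrow> is_iso (M\<lparr>truth := \<lambda>x. truth L (h x)\<rparr>) L h)"
proof -
  interpret L: peano L by (rule peano.intro[OF L])
  define G where "G x u v = (if x = \<zero> then zero L else succ L u)" for x u v :: 'a
  define p where "p x = (if x = \<zero> then \<zero> else THE y. y \<in> U \<and> x = S y)" for x
  have p_S: "p (S x) = x" if "x \<in> U" for x
    using that by (simp add: p_def) (rule the_equality, auto)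
  have p_U: "p x \<in> U" if "x \<in> U" for x
    using that by (rule S_cases) (simp_all add: p_S, simp add: p_def)
  have zL: "zero L \<in> U" using sub by auto
  have "dterm M (\<lambda>e. G (e 0) (e (Suc 0)) (e (Suc (Suc 0))))"
    unfolding G_def by (intro dintros dterm_comp1[OF succ]) (simp_all add: zL)
  moreover have "dterm M (\<lambda>e. p (e 0))"
  proof (rule dterm_graph)
    have "dpred M (\<lambda>e. e (Suc 0) = S (e 0) \<or> e (Suc 0) = \<zero> \<and> e 0 = \<zero>)"
      by (intro dintros) simp_all
    then show "dpred M (\<lambda>e. e 0 = p (e (Suc 0)))"
    proof (rule dpred_cong)
      fix e :: "nat \<Rightarrow> 'a" assume "range e \<subseteq> U"
      then have e: "e 0 \<in> U" "e (Suc 0) \<in> U" by auto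
      from e(2) show "(e (Suc 0) = S (e 0) \<or> e (Suc 0) = \<zero> \<and> e 0 = \<zero>) = (e 0 = p (e (Suc 0)))"
        by (rule S_cases) (use e(1) p_S in \<open>auto, simp_all add: p_def\<close>)
    qed
  qed (auto simp: p_U image_subset_iff)
  ultimately obtain h where h: "dterm M (\<lambda>e. h (e 0))"
    and rec: "\<And>x. x \<in> U \<Longrightarrow> h x = G x (if p x \<prec> x then h (p x) else \<zero>) (if \<zero> \<prec> x then h \<zero> else \<zero>)"
    using recursion[of G p "\<lambda>_. \<zero>"] dterm_const[of "\<zero>" M] by auto
  have h0: "h \<zero> = zero L" by (subst rec) (simp_all add: G_def)
  have hS: "h (S x) = succ L (h x)" if "x \<in> U" for x
    using that by (subst rec) (simp_all add: G_def p_S)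
  have hL: "h x \<in> univ L" if "x \<in> U" for x
    using that
  proof (induction rule: dinduct)
    case dpred
    show ?case by (rule dpred_comp1[OF univ h])
  qed (simp_all add: h0 hS)
  have hadd: "h (x \<oplus> y) = add L (h x) (h y)" if x: "x \<in> U" and y: "y \<in> U" for x y
    using y
  proof (induction rule: dinduct)
    case dpred
    show ?case by (intro dintros dterm_comp1[OF h] dterm_comp2[OF add]) (use x subsetD[OF sub hL[OF x]] in simp_all)
  qed (simp_all add: h0 hS hL x)
  have hmul: "h (x \<otimes> y) = mul L (h x) (h y)" if x: "x \<in> U" and y: "y \<in> U" for x y
    using y
  proof (induction rule: dinduct)
    case dpred
    show ?case by (intro dintros dterm_comp1[OF h] dterm_comp2[OF mul]) (use x subsetD[OF sub hL[OF x]] in simp_all)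
  qed (simp_all add: h0 hS hL x hadd)
  have less: "less L (h x) (h y)" if xy: "x \<in> U" "y \<in> U" "x \<prec> y" for x y
  proof -
    obtain z where z: "z \<in> U" "x \<oplus> S z = y" using xy less_iff[of x y] by blast
    then have "add L (h x) (succ L (h z)) = h y" using xy(1) hadd[of x "S z"] hS[of z] by simp
    then show ?thesis using z(1) xy(1,2) L.less_iff[of "h x" "h y"] hL by blast
  qed
  have inj: "x = y" if "x \<in> U" "y \<in> U" "h x = h y" for x y
  proof (rule ccontr)
    assume "x \<noteq> y"
    then have "x \<prec> y \<or> y \<prec> x" using le_linear[of x y] that by (auto simp: less_le)
    then show False using less[of x y] less[of y x] that hL L.less_irrefl by auto
  qed
  have less_eq: "x \<prec> y \<longleftrightarrow> less L (h x) (h y)" if U: "x \<in> U" "y \<in> U" for x y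
  proof
    assume lt: "less L (h x) (h y)"
    show "x \<prec> y"
    proof (rule ccontr)
      assume "\<not> x \<prec> y"
      then have "y \<prec> x \<or> y = x" using U by (simp add: not_less le_less)
      then show False
        using lt less[of y x] U hL L.less_irrefl[of "h x"] L.less_le_trans[of "h x" "h y" "h x"]
        by (auto simp: L.less_le)
    qed
  qed (use less U in blast)
  have "is_iso (M\<lparr>truth := \<lambda>x. truth L (h x)\<rparr>) L h" if "h ` U = univ L"
    unfolding is_iso_def bij_betw_def inj_on_def
    using that inj h0 hS hadd hmul less_eq by simp
  then show ?thesis using h h0 hS hL by blast
qed

end

locale peano_interpretation = peano M + tuple_interpretation M N k
  for M :: "'a struct" and N :: "'a list struct" and k
begin

definition decode where "decode = inv_into (univ N) code"

definition coded :: "'a struct" where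
  "coded = \<lparr>univ = code ` univ N, zero = code (zero N),
     succ = (\<lambda>u. if u \<in> code ` univ N then code (succ N (decode u)) else \<zero>),
     add = (\<lambda>u v. if u \<in> code ` univ N \<and> v \<in> code ` univ N
       then code (add N (decode u) (decode v)) else \<zero>),
     mul = (\<lambda>u v. if u \<in> code ` univ N \<and> v \<in> code ` univ N
       then code (mul N (decode u) (decode v)) else \<zero>),
     less = (\<lambda>u v. less N (decode u) (decode v)),
     truth = (\<lambda>u. truth N (decode u))\<rparr>"

lemma code_inj_on: "inj_on code (univ N)"
  using code_inj length_univ set_univ by (intro inj_onI) metis

lemma decode_code [simp]: "x \<in> univ N \<Longrightarrow> decode (code x) = x"
  unfolding decode_def using code_inj_on by simp

lemma N_closed:
  "zero N \<in> univ N" "x \<in> univ N \<Longrightarrow> succ N x \<in> univ N"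
  "x \<in> univ N \<Longrightarrow> y \<in> univ N \<Longrightarrow> add N x y \<in> univ N"
  "x \<in> univ N \<Longrightarrow> y \<in> univ N \<Longrightarrow> mul N x y \<in> univ N"
  using N by (auto simp: is_struct_def)

lemma is_iso_code: "is_iso N coded code"
  unfolding is_iso_def coded_def using code_inj_on by (auto simp: bij_betw_def)

lemma coded_subset: "univ coded \<subseteq> U"
  using code_closed set_univ by (auto simp: coded_def)

lemma dpred_coded: "dpred M (\<lambda>e. e 0 \<in> univ coded)"
proof -
  have "dpred M (\<lambda>e. \<exists>x\<in>univ N. e 0 = code x)"
    by (intro tuple_intros dintros dterm_code)
  then show ?thesis by (rule dpred_cong) (auto simp: coded_def)
qed

lemma dterm_coded1:
  assumes F: "definable M {x @ F x |x. x \<in> univ N}" and closed: "\<And>x. x \<in> univ N \<Longrightarrow> F x \<in> univ N"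
  shows "dterm M (\<lambda>e. if e 0 \<in> code ` univ N then code (F (decode (e 0))) else \<zero>)"
proof (rule dterm_graph)
  have "dpred M (\<lambda>e. (\<exists>x\<in>univ N. \<exists>y\<in>univ N. x @ y \<in> {x @ F x |x. x \<in> univ N} \<and>
      e (Suc 0) = code x \<and> e 0 = code y) \<or> \<not> (\<exists>x\<in>univ N. e (Suc 0) = code x) \<and> e 0 = \<zero>)"
    by (intro tuple_intros dpred_mem[OF is_struct F] dintros dterm_code) simp_all
  moreover have "x @ y \<in> {x @ F x |x. x \<in> univ N} \<longleftrightarrow> y = F x" if "x \<in> univ N" "y \<in> univ N" for x y
    using that closed length_univ by force
  ultimately show "dpred M (\<lambda>e. e 0 =
      (if e (Suc 0) \<in> code ` univ N then code (F (decode (e (Suc 0)))) else \<zero>))"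
    by (elim dpred_cong) (auto simp: closed inj_on_eq_iff[OF code_inj_on] simp del: mem_Collect_eq)
qed (auto simp: closed code_closed set_univ)

lemma dterm_coded2:
  assumes F: "definable M {x @ y @ F x y |x y. x \<in> univ N \<and> y \<in> univ N}"
    and closed: "\<And>x y. x \<in> univ N \<Longrightarrow> y \<in> univ N \<Longrightarrow> F x y \<in> univ N"
  shows "dterm M (\<lambda>e. if e 0 \<in> code ` univ N \<and> e (Suc 0) \<in> code ` univ N
    then code (F (decode (e 0)) (decode (e (Suc 0)))) else \<zero>)"
proof (rule dterm_graph)
  have "dpred M (\<lambda>e. (\<exists>x\<in>univ N. \<exists>y\<in>univ N. \<exists>z\<in>univ N.
      x @ y @ z \<in> {x @ y @ F x y |x y. x \<in> univ N \<and> y \<in> univ N} \<and>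
      e (Suc 0) = code x \<and> e (Suc (Suc 0)) = code y \<and> e 0 = code z) \<or>
      \<not> (\<exists>x\<in>univ N. \<exists>y\<in>univ N. e (Suc 0) = code x \<and> e (Suc (Suc 0)) = code y) \<and> e 0 = \<zero>)"
    by (intro tuple_intros dpred_mem[OF is_struct F] dintros dterm_code) simp_all
  moreover have "x @ y @ z \<in> {x @ y @ F x y |x y. x \<in> univ N \<and> y \<in> univ N} \<longleftrightarrow> z = F x y"
    if "x \<in> univ N" "y \<in> univ N" "z \<in> univ N" for x y z
    using that closed length_univ by force
  ultimately show "dpred M (\<lambda>e. e 0 = (if e (Suc 0) \<in> code ` univ N \<and> e (Suc (Suc 0)) \<in> code ` univ N
      then code (F (decode (e (Suc 0))) (decode (e (Suc (Suc 0))))) else \<zero>))"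
    by (elim dpred_cong) (auto simp: closed inj_on_eq_iff[OF code_inj_on] simp del: mem_Collect_eq)
qed (auto simp: closed code_closed set_univ)

lemma dpred_coded_truth:
  assumes h: "dterm M (\<lambda>e. h (e 0))" and hN: "\<And>x. x \<in> U \<Longrightarrow> h x \<in> univ coded"
  shows "dpred M (\<lambda>e. truth coded (h (e 0)))"
proof -
  have "dpred M (\<lambda>e. \<exists>x\<in>univ N. x \<in> {x. x \<in> univ N \<and> truth N x} \<and> h (e 0) = code x)"
    by (intro tuple_intros dintros dterm_code dterm_comp1[OF h])
  then show ?thesis
  proof (rule dpred_cong)
    fix e :: "nat \<Rightarrow> 'a" assume "range e \<subseteq> U"
    then have "h (e 0) \<in> code ` univ N" using hN by (auto simp: coded_def)
    then show "(\<exists>x\<in>univ N. x \<in> {x. x \<in> univ N \<and> truth N x} \<and> h (e 0) = code x) = truth coded (h (e 0))"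
      using code_inj_on by (auto simp: coded_def inj_on_eq_iff)
  qed
qed

lemma ex_embedding:
  assumes M: "is_model M CT" and CT: "is_model N CT"
  shows "\<exists>h. (\<forall>x\<in>U. h x \<in> univ N) \<and> definable M {x # h x |x. x \<in> U} \<and>
    h \<zero> = zero N \<and> (\<forall>x\<in>U. h (S x) = succ N (h x)) \<and> (h ` U = univ N \<longrightarrow> is_iso M N h)"
proof -
  have C: "is_model coded CT" by (rule is_model_iso[OF is_iso_code CT])
  then have PA: "is_model coded (PA_base \<union> range induction)"
    unfolding is_model_def CT_def by blast
  have succ: "dterm M (\<lambda>e. succ coded (e 0))"
    using dterm_coded1[OF def_succ N_closed(2)] by (simp add: coded_def)
  have add: "dterm M (\<lambda>e. add coded (e 0) (e (Suc 0)))"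
    using dterm_coded2[OF def_add N_closed(3)] by (simp add: coded_def)
  have mul: "dterm M (\<lambda>e. mul coded (e 0) (e (Suc 0)))"
    using dterm_coded2[OF def_mul N_closed(4)] by (simp add: coded_def)
  obtain h where h: "dterm M (\<lambda>e. h (e 0))" and hN: "\<forall>x\<in>U. h x \<in> univ coded"
    and h0: "h \<zero> = zero coded" and hS: "\<forall>x\<in>U. h (S x) = succ coded (h x)"
    and iso: "h ` U = univ coded \<longrightarrow> is_iso (M\<lparr>truth := \<lambda>x. truth coded (h x)\<rparr>) coded h"
    using embedding[OF PA coded_subset dpred_coded succ add mul] by blast
  define g where "g x = decode (h x)" for x
  have code_g: "code (g x) = h x \<and> g x \<in> univ N" if "x \<in> U" for x
    using hN that by (auto simp: g_def coded_def)
  have "definable M {xs. length xs = Suc k \<and> set xs \<subseteq> U \<and> tl xs \<in> univ N \<and> code (tl xs) = h (hd xs)}"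
  proof (rule definable_dpred[OF is_struct, of "\<lambda>xs. tl xs \<in> univ N \<and> code (tl xs) = h (hd xs)"])
    have upt: "map e [0..<Suc k] = e 0 # map (\<lambda>i. e (Suc i)) [0..<k]" for e :: "nat \<Rightarrow> 'a"
      by (simp add: upt_rec[of 0] map_Suc_upt[symmetric] del: upt_Suc)
    show "dpred M (\<lambda>e. tl (map e [0..<Suc k]) \<in> univ N \<and>
        code (tl (map e [0..<Suc k])) = h (hd (map e [0..<Suc k])))"
      unfolding upt list.sel by (intro tuple_intros dintros dterm_code dterm_comp1[OF h])
  qed
  also have "{xs. length xs = Suc k \<and> set xs \<subseteq> U \<and> tl xs \<in> univ N \<and> code (tl xs) = h (hd xs)} =
      {x # g x |x. x \<in> U}"
  proof (intro equalityI subsetI)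
    fix xs assume "xs \<in> {xs. length xs = Suc k \<and> set xs \<subseteq> U \<and> tl xs \<in> univ N \<and> code (tl xs) = h (hd xs)}"
    then obtain x ys where xs: "xs = x # ys" "x \<in> U" "ys \<in> univ N" "code ys = h x"
      by (auto simp: length_Suc_conv)
    then have "g x = ys" using decode_code[of ys] by (simp add: g_def)
    then show "xs \<in> {x # g x |x. x \<in> U}" using xs by blast
  next
    fix xs assume "xs \<in> {x # g x |x. x \<in> U}"
    then obtain x where x: "xs = x # g x" "x \<in> U" by blast
    then show "xs \<in> {xs. length xs = Suc k \<and> set xs \<subseteq> U \<and> tl xs \<in> univ N \<and> code (tl xs) = h (hd xs)}"
      using code_g[OF x(2)] length_univ[of "g x"] set_univ[of "g x"] by simp
  qed
  finally have "definable M {x # g x |x. x \<in> U}" .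
  moreover have "g \<zero> = zero N"
    using h0 by (simp add: g_def coded_def N_closed)
  moreover have "g (S x) = succ N (g x)" if "x \<in> U" for x
  proof -
    have "h (S x) = code (succ N (g x))"
      using hS hN that by (simp add: coded_def g_def)
    then show ?thesis using code_g[OF that] by (simp add: g_def N_closed)
  qed
  moreover have "is_iso M N g" if "g ` U = univ N"
  proof -
    have "h ` U = code ` g ` U" using code_g by (auto simp: image_image)
    then have "h ` U = univ coded" using that by (simp add: coded_def)
    then have iso: "is_iso (with_truth (\<lambda>x. truth coded (h x))) coded h" using iso by blast
    have sM: "is_struct (with_truth T)" for T using is_struct by (simp add: is_struct_def)
    have "sat (with_truth (\<lambda>x. truth coded (h x))) (\<lambda>_. \<zero>) Tarski"
      using sat_iso[OF iso sM, of "\<lambda>_. \<zero>" Tarski] C hN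
      by (auto simp: is_model_def CT_def image_subset_iff)
    then have 1: "tarski (\<lambda>x. truth coded (h x))" by (simp only: sat_Tarski)
    have "sat (with_truth (truth M)) (\<lambda>_. \<zero>) Tarski"
      using M by (auto simp: is_model_def CT_def image_subset_iff)
    then have 2: "tarski (truth M)" by (simp only: sat_Tarski)
    have "truth M x \<longleftrightarrow> truth coded (h x)" if "x \<in> U" for x
      using truth_unique[OF 2 1 dpred_coded_truth[OF h] that] hN by blast
    then have "is_iso M coded h" using iso by (simp add: is_iso_def)
    from is_iso_trans[OF this is_iso_sym[OF is_iso_code N]]
    have "is_iso M N (decode \<circ> h)" by (simp add: decode_def)
    then show ?thesis by (simp add: g_def[abs_def] comp_def)
  qed
  ultimately show ?thesis using code_g by blast
qed

end

lemma ex_tuple_interpretation: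
  assumes "is_struct M" "is_struct N" "M \<unrhd> N"
  obtains k where "tuple_interpretation M N k"
proof -
  obtain k where "\<And>x. x \<in> univ N \<Longrightarrow> length x = k"
    using assms(3) definable_length unfolding interprets_def by metis
  then show thesis using assms that unfolding tuple_interpretation_def by blast
qed

theorem theorem5p7:
  shows "solid TYPE('a) CT"
  unfolding solid_def
proof (intro allI impI, elim conjE)
  fix M :: "'a struct" and N :: "'a list struct" and M' :: "'a list list struct" and f
  assume M: "is_model M CT" and N: "is_model N CT" and M': "is_model M' CT"
    and MN: "M \<unrhd> N" and NM': "N \<unrhd> M'" and f: "is_iso M M' f"
    and def_f: "definable M {x # concat (f x) |x. x \<in> univ M}"
  have PA: "is_model M (PA_base \<union> range induction)" "is_model N (PA_base \<union> range induction)"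
    using M N unfolding is_model_def CT_def by blast+
  interpret M: peano M by (rule peano.intro[OF PA(1)])
  interpret N: peano N by (rule peano.intro[OF PA(2)])
  have sM': "is_struct M'" using M' by (simp add: is_model_def)
  obtain k where "tuple_interpretation M N k"
    using ex_tuple_interpretation[OF M.is_struct N.is_struct MN] .
  interpret MN: tuple_interpretation M N k by fact
  obtain l where "tuple_interpretation N M' l"
    using ex_tuple_interpretation[OF N.is_struct sM' NM'] .
  interpret NM: tuple_interpretation N M' l by fact
  interpret NM: peano_interpretation N M' l ..
  obtain h where hM: "\<And>x. x \<in> univ N \<Longrightarrow> h x \<in> univ M'" and def_h: "definable N {x # h x |x. x \<in> univ N}"
    and h0: "h (zero N) = zero M'" and hS: "\<And>x. x \<in> univ N \<Longrightarrow> h (succ N x) = succ M' (h x)"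
    and iso: "h ` univ N = univ M' \<Longrightarrow> is_iso N M' h"
    using NM.ex_embedding[OF N M'] by blast
  have "zero N \<noteq> succ N (zero N)" by simp
  then have k: "k > 0"
    using MN.length_univ[OF N.closed(1)] MN.length_univ[OF N.closed(2)[OF N.closed(1)]]
    by (metis gr0I length_0_conv)
  have def_h': "definable M (concat ` {x # h x |x. x \<in> univ N})"
    by (rule MN.definable_concat[OF k def_h])
  have fM: "f x \<in> univ M'" if "x \<in> univ M" for x
    using f that by (auto simp: is_iso_def bij_betw_def)
  have len: "length x = l \<and> set x \<subseteq> univ N" if "x \<in> univ M'" for x
    using NM.length_univ NM.set_univ that by blast
  have len_concat: "length (concat x) = l * k \<and> set (concat x) \<subseteq> univ M" if "x \<in> univ M'" for x
  proof -
    have "length (concat y) = length y * k" if "set y \<subseteq> univ N" for y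
      using that MN.length_univ by (induction y) auto
    moreover have "set (concat x) \<subseteq> univ M" using len[OF that] MN.set_univ by auto
    ultimately show ?thesis using len[OF that] by metis
  qed
  have concat_inj: "x = y" if "concat x = concat y" "x \<in> univ M'" "y \<in> univ M'" for x y
  proof (rule concat_injective[OF that(1)])
    show "length x = length y" using len that by simp
    show "\<forall>(a, b)\<in>set (zip x y). length a = length b"
    proof clarify
      fix a b assume "(a, b) \<in> set (zip x y)"
      then have "a \<in> set x" "b \<in> set y" by (blast dest: set_zip_leftD set_zip_rightD)+
      then have "a \<in> univ N" "b \<in> univ N" using len[OF that(2)] len[OF that(3)] by blast+
      then show "length a = length b" by (simp add: MN.length_univ)
    qed
  qed
  let ?Rf = "{x # concat (f x) |x. x \<in> univ M}"
  let ?Rh = "concat ` {x # h x |x. x \<in> univ N}"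
  have Rf: "x # zs \<in> ?Rf \<longleftrightarrow> zs = concat (f x)" if "x \<in> univ M" for x zs using that by auto
  have Rh: "ys @ zs \<in> ?Rh \<longleftrightarrow> zs = concat (h ys)" if "ys \<in> univ N" for ys zs
    using that MN.length_univ by (force simp: image_iff)
  have rel: "(\<exists>zs. length zs = l * k \<and> set zs \<subseteq> univ M \<and> x # zs \<in> ?Rf \<and> ys @ zs \<in> ?Rh) \<longleftrightarrow> h ys = f x"
    if "x \<in> univ M" "ys \<in> univ N" for x ys
    unfolding Rf[OF that(1)] Rh[OF that(2)]
    using len_concat[OF fM[OF that(1)]] concat_inj[OF _ hM[OF that(2)] fM[OF that(1)]] by metis
  have surj: "\<exists>ys\<in>univ N. h ys = f x" if "x \<in> univ M" for x
    using that
  proof (induction rule: M.dinduct)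
    case dpred
    have "dpred M (\<lambda>e. \<exists>ys\<in>univ N. \<exists>zs. length zs = l * k \<and> set zs \<subseteq> univ M \<and>
        e 0 # zs \<in> ?Rf \<and> ys @ zs \<in> ?Rh)"
      by (intro MN.tuple_intros dpred_ex_list dpred_mem[OF M.is_struct def_f]
          dpred_mem[OF M.is_struct def_h'] dlist_Cons M.dintros)
    then show ?case by (rule dpred_cong) (use rel in \<open>auto simp: image_subset_iff\<close>)
  next
    case zero
    show ?case using h0 f by (auto simp: is_iso_def intro: bexI[of _ "zero N"])
  next
    case (succ x)
    then obtain ys where "ys \<in> univ N" "h ys = f x" by blast
    then show ?case using hS f succ(1) by (intro bexI[of _ "succ N ys"]) (simp_all add: is_iso_def)
  qed
  have "h ` univ N = univ M'"
  proof -
    have "f ` univ M = univ M'" using f by (auto simp: is_iso_def bij_betw_def)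
    then show ?thesis using surj hM by force
  qed
  then have h: "is_iso N M' h" by (rule iso)
  let ?g = "inv_into (univ N) h \<circ> f"
  have g: "is_iso M N ?g" by (rule is_iso_trans[OF f is_iso_sym[OF h N.is_struct]])
  have "definable M {xs. length xs = Suc k \<and> set xs \<subseteq> univ M \<and> tl xs \<in> univ N \<and>
      (\<exists>zs. length zs = l * k \<and> set zs \<subseteq> univ M \<and> hd xs # zs \<in> ?Rf \<and> tl xs @ zs \<in> ?Rh)}"
  proof (rule definable_dpred[OF M.is_struct, of "\<lambda>xs. tl xs \<in> univ N \<and>
      (\<exists>zs. length zs = l * k \<and> set zs \<subseteq> univ M \<and> hd xs # zs \<in> ?Rf \<and> tl xs @ zs \<in> ?Rh)"])
    have upt: "map e [0..<Suc k] = e 0 # map (\<lambda>i. e (Suc i)) [0..<k]" for e :: "nat \<Rightarrow> 'a"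
      by (simp add: upt_rec[of 0] map_Suc_upt[symmetric] del: upt_Suc)
    show "dpred M (\<lambda>e. tl (map e [0..<Suc k]) \<in> univ N \<and>
      (\<exists>zs. length zs = l * k \<and> set zs \<subseteq> univ M \<and> hd (map e [0..<Suc k]) # zs \<in> ?Rf \<and>
        tl (map e [0..<Suc k]) @ zs \<in> ?Rh))"
      unfolding upt list.sel
      by (intro MN.tuple_intros dpred_ex_list dpred_mem[OF M.is_struct def_f]
          dpred_mem[OF M.is_struct def_h'] dlist_Cons M.dintros)
  qed
  also have "{xs. length xs = Suc k \<and> set xs \<subseteq> univ M \<and> tl xs \<in> univ N \<and>
      (\<exists>zs. length zs = l * k \<and> set zs \<subseteq> univ M \<and> hd xs # zs \<in> ?Rf \<and> tl xs @ zs \<in> ?Rh)} =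
      {x # ?g x |x. x \<in> univ M}"
  proof -
    have inj: "inj_on h (univ N)" using h by (simp add: is_iso_def bij_betw_def)
    have hg: "ys = ?g x \<longleftrightarrow> h ys = f x" if "x \<in> univ M" "ys \<in> univ N" for x ys
      using inj that fM \<open>h ` univ N = univ M'\<close> by (auto simp: f_inv_into_f) (metis inv_into_f_f)
    have gN: "?g x \<in> univ N" if "x \<in> univ M" for x
      using g that by (auto simp: is_iso_def bij_betw_def)
    show ?thesis
    proof (intro equalityI subsetI)
      fix xs assume "xs \<in> {xs. length xs = Suc k \<and> set xs \<subseteq> univ M \<and> tl xs \<in> univ N \<and>
        (\<exists>zs. length zs = l * k \<and> set zs \<subseteq> univ M \<and> hd xs # zs \<in> ?Rf \<and> tl xs @ zs \<in> ?Rh)}"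
      then obtain x ys where xs: "xs = x # ys" "x \<in> univ M" "ys \<in> univ N"
        "\<exists>zs. length zs = l * k \<and> set zs \<subseteq> univ M \<and> x # zs \<in> ?Rf \<and> ys @ zs \<in> ?Rh"
        by (cases xs) (simp_all del: mem_Collect_eq, auto)
      then have "ys = ?g x" using rel hg by blast
      then show "xs \<in> {x # ?g x |x. x \<in> univ M}" using xs by blast
    next
      fix xs assume "xs \<in> {x # ?g x |x. x \<in> univ M}"
      then obtain x where x: "xs = x # ?g x" "x \<in> univ M" by blast
      then show "xs \<in> {xs. length xs = Suc k \<and> set xs \<subseteq> univ M \<and> tl xs \<in> univ N \<and>
        (\<exists>zs. length zs = l * k \<and> set zs \<subseteq> univ M \<and> hd xs # zs \<in> ?Rf \<and> tl xs @ zs \<in> ?Rh)}"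
        using rel[OF x(2) gN[OF x(2)]] hg[OF x(2) gN[OF x(2)]] gN[OF x(2)] MN.length_univ MN.set_univ
        by (simp del: comp_apply)
    qed
  qed
  finally have "definable M {x # ?g x |x. x \<in> univ M}" .
  with g show "\<exists>g. is_iso M N g \<and> definable M {x # g x |x. x \<in> univ M}" by blast
qed

end
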